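(* Let $f:V\to\mathbb R$ be a smooth function on a manifold, $c$ a non-degenerate critical point, $E=T_cV=N\oplus P$, $q$ the Hessian form, and $\psi:U=U_N+U_P\to\mathcal U\subset V$ a Morse parametrization at $c$; let $\mu=(-q|_N)\oplus q|_P$ and let $\Phi^U_t$ be the flow on $U$ given by restriction of $\Lambda_t=e^{-t}\mathrm{Id}_N+e^{t}\mathrm{Id}_P$, with generating vector field $Z^U$. Let $p\in P$ with $\mu(p)=1$, let $R\subset P$ be the $\mu|_P$-orthogonal of $p$ in $P$, and $\gamma=(\mathbb R_{>0}\,p)\cap U$. Let $M\subset U$ be a submanifold invariant under $\Phi^U_t$ such that $\gamma$ is open in $M\cap P$, the intersection of $M$ and $P$ being transverse along $\gamma$. For $\epsilon>0$ write $\mathcal U^\epsilon=\{u\in E:\mu(u)<\epsilon^2\}$ and $N^\epsilon=N\cap\mathcal U^\epsilon$, $R^\epsilon=R\cap\mathcal U^\epsilon$. Then: (1) There are $s,\nu,\rho>0$ with $sp\in\gamma$, $N^\nu\subset U_N$, $sp+R^\rho\subset U_P$, and a smooth map $\theta:(N^\nu,0)\to(R,0)$ such that $$(M-sp)\cap(N^\nu+R^\rho)=\{n+\theta(n):n\in N^\nu\}.$$ (2) There is $\delta>0$ such that the map $$\chi:(N^\delta,\{0\})\times\,]-\delta,\delta[\ \to E,\qquad \chi(n,\tau)=n+\tau p+\frac{\tau}{s}\,\theta\Big(\frac{\tau}{s}\,n\Big)$$ is a pair of embeddings (i.e. $\chi$ and its restriction to $\{0\}\times]-\delta,\delta[$ are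 embeddings) with image tangent to the field $Z^U$, and $$\chi(0)=0,\qquad \chi(\{0\}\times]0,\delta[)=\gamma\cap\mathcal U^\delta,\qquad \chi(N^\delta\times]0,\delta[)\subset M\cap\{q>0\}=:M' .$$ (3) The only critical point of $f\circ\psi\circ\chi$ is $0$; it is non-degenerate of coindex $1$.
   Context: The Hessian form at a critical point is $q(X)=\frac12X(X(f))(c)$ on $T_cV$. A Morse parametrization at a non-degenerate critical point $c$: $E=T_cV=N\oplus P$ is a $q$-orthogonal splitting with $q|_N$ negative definite and $q|_P$ positive definite, $U_N\subset N$, $U_P\subset P$ are star-shaped neighbourhoods of $0$, $U=U_N+U_P$, and $\psi:(U,0)\to(\mathcal U,c)$ is a diffeomorphism onto a neighbourhood of $c$ with $T_0\psi=\mathrm{Id}$ and $f\circ\psi-f(c)=q|_U$. The field $Z^U$ is $n+p'\mapsto-n+p'$ on $U$ ($n\in N$, $p'\in P$), and the orbits of its (partially defined) flow $\Phi^U_t$ are the intersections with $U$ of the orbits of $\Lambda_t$. A subset $A\subset U$ is invariant under $\Phi^U_t$ if for all $u\in U$ and $t\in\mathbb R$ such that $\Phi^U_t(u)$ is defined, $u\in A$ if and only if $\Phi^U_t(u)\in A$. The coindex of a critical point is the maximal dimension of a subspace of the tangent space on which the Hessian is non-negative.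
   Formalization: The inclusion χ(N^δ×]0,δ[)⊂M∩{q>0} is false when N≠0, as q(χ(n,τ))→−μ(n)<0 for τ→0; instead χ(N^δ×]0,δ[)⊂M is proved, together with χ(n,τ)∈M∩{q>0} whenever μ(n)<τ². *)

theory Defs
  imports "HOL-Analysis.Analysis" "HOL-Library.Set_Algebras"
begin

section \<open>Smooth maps between subsets of Euclidean spaces\<close>

text \<open>The recursion computes \<open>C\<^sup>k\<close> regularity only for open \<open>S\<close>; it is used only there.\<close>

primrec Ck_on :: "nat \<Rightarrow> 'a::euclidean_space set \<Rightarrow> ('a \<Rightarrow> 'b::euclidean_space) \<Rightarrow> bool" where
  "Ck_on 0 S f \<longleftrightarrow> continuous_on S f"
| "Ck_on (Suc k) S f \<longleftrightarrow>
     (\<forall>x\<in>S. f differentiable (at x)) \<and>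
     (\<forall>v. Ck_on k S (\<lambda>x. frechet_derivative f (at x) v))"

text \<open>On a set that need not be open, smoothness means having smooth local extensions.\<close>

definition smooth_on :: "'a::euclidean_space set \<Rightarrow> ('a \<Rightarrow> 'b::euclidean_space) \<Rightarrow> bool" where
  "smooth_on S f \<longleftrightarrow>
     (\<forall>x\<in>S. \<exists>W g. open W \<and> x \<in> W \<and> (\<forall>k. Ck_on k W g) \<and> (\<forall>y\<in>S \<inter> W. g y = f y))"

definition submanifold :: "'a::euclidean_space set \<Rightarrow> bool" where
  "submanifold M \<longleftrightarrow>
     (\<forall>x\<in>M. \<exists>W (h :: 'a \<Rightarrow> 'a) L.
        open W \<and> x \<in> W \<and> open (h ` W) \<and> inj_on h W \<and>
        smooth_on W h \<and> smooth_on (h ` W) (inv_into W h) \<and>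
        subspace L \<and> h ` (M \<inter> W) = h ` W \<inter> L)"

definition curve_in :: "'a::euclidean_space set \<Rightarrow> 'a \<Rightarrow> 'a \<Rightarrow> (real \<Rightarrow> 'a) \<Rightarrow> bool" where
  "curve_in M x v \<alpha> \<longleftrightarrow>
     \<alpha> 0 = x \<and> (\<alpha> has_vector_derivative v) (at 0) \<and>
     (\<exists>e>0. smooth_on {-e<..<e} \<alpha> \<and> \<alpha> ` {-e<..<e} \<subseteq> M)"

definition tangent_space :: "'a::euclidean_space set \<Rightarrow> 'a \<Rightarrow> 'a set" where
  "tangent_space M x = {v. \<exists>\<alpha>. curve_in M x v \<alpha>}"

definition transverse_at :: "'a::euclidean_space set \<Rightarrow> 'a set \<Rightarrow> 'a \<Rightarrow> bool" where
  "transverse_at M M' x \<longleftrightarrow> tangent_space M x + tangent_space M' x = UNIV"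

definition immersion_on :: "'a::euclidean_space set \<Rightarrow> ('a \<Rightarrow> 'b::euclidean_space) \<Rightarrow> bool" where
  "immersion_on S h \<longleftrightarrow>
     smooth_on S h \<and>
     (\<forall>x\<in>S. \<forall>v \<alpha>. curve_in S x v \<alpha> \<and> v \<noteq> 0 \<longrightarrow> \<not> (h \<circ> \<alpha> has_vector_derivative 0) (at 0))"

definition embedding_on :: "'a::euclidean_space set \<Rightarrow> ('a \<Rightarrow> 'b::euclidean_space) \<Rightarrow> bool" where
  "embedding_on S h \<longleftrightarrow> immersion_on S h \<and> homeomorphism S (h ` S) h (inv_into S h)"


section \<open>Quadratic forms\<close>

definition polar_form :: "('a::real_vector \<Rightarrow> real) \<Rightarrow> 'a \<Rightarrow> 'a \<Rightarrow> real" where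
  "polar_form q u v = (q (u + v) - q u - q v) / 2"

definition nondegenerate_on :: "'a::real_vector set \<Rightarrow> ('a \<Rightarrow> real) \<Rightarrow> bool" where
  "nondegenerate_on L q \<longleftrightarrow> (\<forall>u\<in>L. (\<forall>v\<in>L. polar_form q u v = 0) \<longrightarrow> u = 0)"

definition coindex_on :: "'a::euclidean_space set \<Rightarrow> ('a \<Rightarrow> real) \<Rightarrow> nat" where
  "coindex_on L q = Max {dim F |F. subspace F \<and> F \<subseteq> L \<and> (\<forall>v\<in>F. 0 \<le> q v)}"


section \<open>Functions on a relatively open subset of a linear subspace\<close>

definition critical_point_on :: "'a::euclidean_space set \<Rightarrow> ('a \<Rightarrow> real) \<Rightarrow> 'a \<Rightarrow> bool" where
  "critical_point_on D g x \<longleftrightarrow> x \<in> D \<and> (g has_derivative (\<lambda>_. 0)) (at x within D)"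

text \<open>The Hessian form \<open>v(v(g))(x) / 2\<close>, the vector \<open>v\<close> being extended to a constant field;
  it depends only on the germ of \<open>g\<close> along the line through \<open>x\<close> in the direction \<open>v\<close>.\<close>

definition linear_hessian :: "('a::euclidean_space \<Rightarrow> real) \<Rightarrow> 'a \<Rightarrow> 'a \<Rightarrow> real" where
  "linear_hessian g x v =
     deriv (\<lambda>t. deriv (\<lambda>r. g (x + t *\<^sub>R v + r *\<^sub>R v)) 0) 0 / 2"


section \<open>Smooth manifolds\<close>

text \<open>The manifold is a whole type; a chart is a pair of its domain and its coordinate map.\<close>

type_synonym ('v, 'e) chart = "'v set \<times> ('v \<Rightarrow> 'e)"

definition smooth_manifold ::
  "('v::{t2_space, second_countable_topology}, 'e::euclidean_space) chart set \<Rightarrow> bool" where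
  "smooth_manifold A \<longleftrightarrow>
     (\<Union>(D, \<phi>)\<in>A. D) = UNIV \<and>
     (\<forall>(D, \<phi>)\<in>A. open D \<and> open (\<phi> ` D) \<and> homeomorphism D (\<phi> ` D) \<phi> (inv_into D \<phi>)) \<and>
     (\<forall>(D, \<phi>)\<in>A. \<forall>(D', \<phi>')\<in>A. smooth_on (\<phi> ` (D \<inter> D')) (\<phi>' \<circ> inv_into D \<phi>))"

definition smooth_fun_on ::
  "('v::topological_space, 'e::euclidean_space) chart set \<Rightarrow> 'v set
    \<Rightarrow> ('v \<Rightarrow> 'b::euclidean_space) \<Rightarrow> bool" where
  "smooth_fun_on A W g \<longleftrightarrow> (\<forall>(D, \<phi>)\<in>A. smooth_on (\<phi> ` (D \<inter> W)) (g \<circ> inv_into D \<phi>))"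

definition diffeomorphism_into ::
  "('v::topological_space, 'e::euclidean_space) chart set \<Rightarrow> 'e set \<Rightarrow> ('e \<Rightarrow> 'v) \<Rightarrow> bool" where
  "diffeomorphism_into A U \<psi> \<longleftrightarrow>
     open U \<and> open (\<psi> ` U) \<and> homeomorphism U (\<psi> ` U) \<psi> (inv_into U \<psi>) \<and>
     (\<forall>(D, \<phi>)\<in>A. smooth_on (U \<inter> \<psi> -` D) (\<phi> \<circ> \<psi>)) \<and>
     smooth_fun_on A (\<psi> ` U) (inv_into U \<psi>)"

definition smooth_near ::
  "('v::topological_space, 'e::euclidean_space) chart set \<Rightarrow> 'v \<Rightarrow> ('v \<Rightarrow> real) \<Rightarrow> bool" where
  "smooth_near A x g \<longleftrightarrow> (\<exists>W. open W \<and> x \<in> W \<and> smooth_fun_on A W g)"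

text \<open>Tangent vectors at \<open>x\<close> are the derivations on germs of smooth functions at \<open>x\<close>,
  with value \<open>0\<close> on functions that are not smooth near \<open>x\<close>.\<close>

definition tangent_vectors ::
  "('v::topological_space, 'e::euclidean_space) chart set \<Rightarrow> 'v
    \<Rightarrow> (('v \<Rightarrow> real) \<Rightarrow> real) set" where
  "tangent_vectors A x = {X.
     (\<forall>g. \<not> smooth_near A x g \<longrightarrow> X g = 0) \<and>
     (\<forall>g h. smooth_near A x g \<and> smooth_near A x h \<longrightarrow>
        ((\<forall>\<^sub>F y in nhds x. g y = h y) \<longrightarrow> X g = X h) \<and>
        (\<forall>a b. X (\<lambda>y. a * g y + b * h y) = a * X g + b * X h) \<and>
        X (\<lambda>y. g y * h y) = g x * X h + h x * X g)}"

definition local_vector_field ::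
  "('v::topological_space, 'e::euclidean_space) chart set \<Rightarrow> 'v
    \<Rightarrow> ('v \<Rightarrow> ('v \<Rightarrow> real) \<Rightarrow> real) \<Rightarrow> bool" where
  "local_vector_field A x Y \<longleftrightarrow>
     (\<exists>W. open W \<and> x \<in> W \<and> (\<forall>y\<in>W. Y y \<in> tangent_vectors A y) \<and>
        (\<forall>W' g. open W' \<and> W' \<subseteq> W \<and> smooth_fun_on A W' g \<longrightarrow>
           smooth_fun_on A W' (\<lambda>y. Y y g)))"

definition critical_point ::
  "('v::topological_space, 'e::euclidean_space) chart set \<Rightarrow> ('v \<Rightarrow> real) \<Rightarrow> 'v \<Rightarrow> bool" where
  "critical_point A f c \<longleftrightarrow> (\<forall>X\<in>tangent_vectors A c. X f = 0)"

text \<open>\<open>X(X(f))(c) / 2\<close>: the outer \<open>X\<close> is the tangent vector, the inner one any local field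
  extending it. At a critical point the value does not depend on the extension.\<close>

definition hessian_form ::
  "('v::topological_space, 'e::euclidean_space) chart set \<Rightarrow> ('v \<Rightarrow> real) \<Rightarrow> 'v
    \<Rightarrow> (('v \<Rightarrow> real) \<Rightarrow> real) \<Rightarrow> real" where
  "hessian_form A f c X =
     (THE r. \<forall>Y. local_vector_field A c Y \<and> Y c = X \<longrightarrow> r = X (\<lambda>y. Y y f) / 2)"

definition tangent_map ::
  "('v::topological_space, 'e::euclidean_space) chart set \<Rightarrow> ('e \<Rightarrow> 'v) \<Rightarrow> 'e \<Rightarrow> 'e
    \<Rightarrow> ('v \<Rightarrow> real) \<Rightarrow> real" where
  "tangent_map A \<psi> x v =
     (\<lambda>g. if smooth_near A (\<psi> x) g then frechet_derivative (g \<circ> \<psi>) (at x) v else 0)"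

text \<open>The set of tangent vectors at \<open>c\<close> depends on the atlas, so it is not a type. The vector
  space \<open>E = T\<^sub>cV\<close> is the type \<open>'e\<close>, identified with that set by an arbitrary linear
  isomorphism \<open>\<iota>\<close>.\<close>

definition tangent_identification ::
  "('v::topological_space, 'e::euclidean_space) chart set \<Rightarrow> 'v
    \<Rightarrow> ('e \<Rightarrow> ('v \<Rightarrow> real) \<Rightarrow> real) \<Rightarrow> bool" where
  "tangent_identification A c \<iota> \<longleftrightarrow>
     bij_betw \<iota> UNIV (tangent_vectors A c) \<and>
     (\<forall>a b v w g. \<iota> (a *\<^sub>R v + b *\<^sub>R w) g = a * \<iota> v g + b * \<iota> w g)"


section \<open>Morse parametrizations\<close>

definition comp_fst :: "'e::real_vector set \<Rightarrow> 'e set \<Rightarrow> 'e \<Rightarrow> 'e" where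
  "comp_fst N P u = (THE n. n \<in> N \<and> u - n \<in> P)"

definition comp_snd :: "'e::real_vector set \<Rightarrow> 'e set \<Rightarrow> 'e \<Rightarrow> 'e" where
  "comp_snd N P u = u - comp_fst N P u"

definition morse_splitting :: "('e::euclidean_space \<Rightarrow> real) \<Rightarrow> 'e set \<Rightarrow> 'e set \<Rightarrow> bool" where
  "morse_splitting q N P \<longleftrightarrow>
     subspace N \<and> subspace P \<and> N \<inter> P = {0} \<and> N + P = UNIV \<and>
     (\<forall>n\<in>N. \<forall>p\<in>P. polar_form q n p = 0) \<and>
     (\<forall>n\<in>N. n \<noteq> 0 \<longrightarrow> q n < 0) \<and> (\<forall>p\<in>P. p \<noteq> 0 \<longrightarrow> 0 < q p)"

definition star_neighbourhood :: "'e::euclidean_space set \<Rightarrow> 'e set \<Rightarrow> bool" where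
  "star_neighbourhood L S \<longleftrightarrow>
     openin (top_of_set L) S \<and> 0 \<in> S \<and> (\<forall>x\<in>S. closed_segment 0 x \<subseteq> S)"

definition morse_parametrization ::
  "('v::topological_space, 'e::euclidean_space) chart set \<Rightarrow> ('v \<Rightarrow> real) \<Rightarrow> 'v
    \<Rightarrow> ('e \<Rightarrow> ('v \<Rightarrow> real) \<Rightarrow> real) \<Rightarrow> 'e set \<Rightarrow> 'e set \<Rightarrow> 'e set \<Rightarrow> 'e set
    \<Rightarrow> ('e \<Rightarrow> 'v) \<Rightarrow> bool" where
  "morse_parametrization A f c \<iota> N P U\<^sub>N U\<^sub>P \<psi> \<longleftrightarrow>
     (let q = (\<lambda>v. hessian_form A f c (\<iota> v)); U = U\<^sub>N + U\<^sub>P in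
       morse_splitting q N P \<and> star_neighbourhood N U\<^sub>N \<and> star_neighbourhood P U\<^sub>P \<and>
       diffeomorphism_into A U \<psi> \<and> \<psi> 0 = c \<and> (\<forall>v. tangent_map A \<psi> 0 v = \<iota> v) \<and>
       (\<forall>u\<in>U. f (\<psi> u) - f c = q u))"

definition mu_form :: "('e::real_vector \<Rightarrow> real) \<Rightarrow> 'e set \<Rightarrow> 'e set \<Rightarrow> 'e \<Rightarrow> real" where
  "mu_form q N P u = - q (comp_fst N P u) + q (comp_snd N P u)"

definition Z_field :: "'e::real_vector set \<Rightarrow> 'e set \<Rightarrow> 'e \<Rightarrow> 'e" where
  "Z_field N P u = - comp_fst N P u + comp_snd N P u"

definition Lambda_flow :: "'e::real_vector set \<Rightarrow> 'e set \<Rightarrow> real \<Rightarrow> 'e \<Rightarrow> 'e" where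
  "Lambda_flow N P t u = exp (- t) *\<^sub>R comp_fst N P u + exp t *\<^sub>R comp_snd N P u"

text \<open>The partially defined flow on \<open>U\<close>: the trajectory has to stay in \<open>U\<close> up to time \<open>t\<close>.\<close>

definition U_flow :: "'e::real_vector set \<Rightarrow> 'e set \<Rightarrow> 'e set \<Rightarrow> real \<Rightarrow> 'e \<Rightarrow> 'e option" where
  "U_flow N P U t u =
     (if \<forall>r\<in>closed_segment 0 t. Lambda_flow N P r u \<in> U then Some (Lambda_flow N P t u) else None)"

definition flow_invariant :: "'e::real_vector set \<Rightarrow> 'e set \<Rightarrow> 'e set \<Rightarrow> 'e set \<Rightarrow> bool" where
  "flow_invariant N P U M \<longleftrightarrow>
     (\<forall>u\<in>U. \<forall>t v. U_flow N P U t u = Some v \<longrightarrow> (u \<in> M \<longleftrightarrow> v \<in> M))"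

text \<open>For \<open>N \<noteq> {0}\<close> the form \<open>q\<close> is not positive on any \<open>\<chi>(N\<^sup>\<delta> \<times> ]0,\<delta>[)\<close>, because
  \<open>q(\<chi>(n,\<tau>))\<close> tends to \<open>-\<mu>(n)\<close> as \<open>\<tau>\<close> tends to \<open>0\<close>; it is positive where \<open>\<mu>(n) < \<tau>\<^sup>2\<close>.\<close>

definition chi_map :: "real \<Rightarrow> 'e::real_vector \<Rightarrow> ('e \<Rightarrow> 'e) \<Rightarrow> 'e \<times> real \<Rightarrow> 'e" where
  "chi_map s p \<theta> = (\<lambda>(n, \<tau>). n + \<tau> *\<^sub>R p + (\<tau> / s) *\<^sub>R \<theta> ((\<tau> / s) *\<^sub>R n))"

end

theory Submission
  imports Defs
begin

text \<open>
The parametrization \<open>\<psi>\<close> carries the whole question to the vector space \<open>E = N \<oplus> P\<close>, where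
\<open>f \<circ> \<psi> - f c\<close> is the Hessian \<open>q\<close>. Since \<open>q\<close> is homogeneous of degree \<open>2\<close> and agrees near \<open>0\<close> with
a smooth function, it is the quadratic form of a symmetric bilinear form
(\<open>morse_hessian_quadratic\<close>), and \<open>\<mu>\<close> is a positive definite form with a bilinear form \<open>m\<close>.

Let \<open>T\<close> be the tangent space of \<open>M\<close> at \<open>s p \<in> \<gamma>\<close>. Transversality means \<open>T + P = E\<close>, so \<open>M \<inter> P\<close> is near
\<open>s p\<close> a submanifold with tangent space \<open>T \<inter> P\<close>; as \<open>\<gamma>\<close> is open in \<open>M \<inter> P\<close>, it follows that
\<open>T \<inter> P = \<real>p\<close>. Hence \<open>T \<inter> R = 0\<close> and \<open>T + R = E\<close>, and the implicit function theorem presents \<open>M\<close> near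
\<open>s p\<close> as a graph over \<open>N + \<real>p\<close> with values in \<open>R\<close> (\<open>transverse_graph\<close>). The slice over \<open>s p + N\<close> is the
graph of \<open>\<theta>\<close>. The constants are chosen in \<open>transverse_germ\<close>: \<open>U\<^sub>N\<close> and \<open>U\<^sub>P\<close> contain the \<open>\<mu>\<close>-balls of
radius \<open>2 s\<close>, and \<open>\<nu> \<le> \<rho> \<le> s\<close>; then \<open>\<delta> = \<nu>\<close> is small enough for everything else.

For \<open>\<tau> > 0\<close> and \<open>n' = (\<tau> / s) n\<close> the point \<open>\<chi>(n, \<tau>)\<close> is \<open>\<Lambda>\<^sub>t(n' + s p + \<theta>(n'))\<close> with \<open>e\<^sup>t = \<tau> / s < 1\<close>, and
the orbit segment in between stays in \<open>U\<close>; invariance of \<open>M\<close> gives \<open>\<chi>(n, \<tau>) \<in> M\<close> (\<open>chi_in_M\<close>). The linear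
map that sends \<open>u\<close> to its component in \<open>N\<close> and to \<open>m(p, u)\<close> is a left inverse of \<open>\<chi>\<close>, which makes \<open>\<chi>\<close> an
embedding. The identity \<open>\<chi>(e\<^sup>-\<^sup>t n, e\<^sup>t \<tau>) = \<Lambda>\<^sub>t(\<chi>(n, \<tau>))\<close> (\<open>chi_orbit\<close>) shows that its image is tangent
to the field \<open>Z\<^sup>U\<close>. Along these orbits the derivative of \<open>q\<close> is \<open>2 \<mu>\<close>, so that \<open>0\<close> is the only critical
point (\<open>critical_points\<close>); and \<open>q(\<chi>(n, \<tau>)) = \<tau>\<^sup>2 - \<mu>(n)\<close> up to a term
\<open>(\<tau> / s)\<^sup>2 \<mu>(\<theta>((\<tau> / s) n))\<close> of higher order, because \<open>\<theta>(0) = 0\<close>, so that the Hessian at \<open>0\<close> is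
\<open>\<tau>\<^sup>2 - \<mu>(n)\<close> (\<open>linear_hessian_chi\<close>).
\<close>

section \<open>Calculus of \<open>C\<^sup>k\<close> maps\<close>

lemma Ck_on_subset: "Ck_on k S f \<Longrightarrow> T \<subseteq> S \<Longrightarrow> Ck_on k T f"
  by (induction k arbitrary: f) (auto intro: continuous_on_subset)

lemma Ck_on_Suc_imp: "Ck_on (Suc k) S f \<Longrightarrow> Ck_on k S f"
proof (induction k arbitrary: f)
  case 0
  then have "f differentiable (at x)" if "x \<in> S" for x
    using that by simp
  then have "continuous_on S f"
    by (intro continuous_at_imp_continuous_on ballI differentiable_imp_continuous_within)
  then show ?case by simp
next
  case (Suc k)
  then show ?case by (metis Ck_on.simps(2))
qed

lemma Ck_on_cong:
  assumes "open S" "\<And>x. x \<in> S \<Longrightarrow> f x = g x" "Ck_on k S f"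
  shows "Ck_on k S g"
  using assms(2,3)
proof (induction k arbitrary: f g)
  case 0
  then show ?case using continuous_on_cong[OF refl, of S f g] by simp
next
  case (Suc k)
  have diff: "(g has_derivative frechet_derivative f (at x)) (at x)" if "x \<in> S" for x
  proof (rule has_derivative_transform_within_open[OF _ assms(1) that])
    show "(f has_derivative frechet_derivative f (at x)) (at x)"
      using Suc.prems(2) that by (simp add: frechet_derivative_works[symmetric])
  qed (rule Suc.prems(1))
  have "frechet_derivative f (at x) v = frechet_derivative g (at x) v" if "x \<in> S" for x v
    by (rule fun_cong[OF frechet_derivative_at[OF diff[OF that]]])
  then have "Ck_on k S (\<lambda>x. frechet_derivative g (at x) v)" for v
    by (rule Suc.IH[of "\<lambda>x. frechet_derivative f (at x) v"]) (use Suc.prems(2) in simp_all)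
  moreover have "g differentiable (at x)" if "x \<in> S" for x
    using diff[OF that] by (rule differentiableI)
  ultimately show ?case by simp
qed

lemma Ck_on_SucI:
  assumes "open S" "\<And>x. x \<in> S \<Longrightarrow> (f has_derivative f' x) (at x)"
    "\<And>v. Ck_on k S (\<lambda>x. f' x v)"
  shows "Ck_on (Suc k) S f"
proof -
  have "f' x v = frechet_derivative f (at x) v" if "x \<in> S" for x v
    by (rule fun_cong[OF frechet_derivative_at[OF assms(2)[OF that]]])
  then have "Ck_on k S (\<lambda>x. frechet_derivative f (at x) v)" for v
    by (rule Ck_on_cong[OF assms(1) _ assms(3)])
  moreover have "f differentiable (at x)" if "x \<in> S" for x
    using assms(2)[OF that] by (rule differentiableI)
  ultimately show ?thesis by simp
qed

lemma Ck_on_Suc_has_derivative: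
  "Ck_on (Suc k) S f \<Longrightarrow> x \<in> S \<Longrightarrow> (f has_derivative frechet_derivative f (at x)) (at x)"
  by (simp add: frechet_derivative_works[symmetric])

lemma Ck_on_const [simp]: "open S \<Longrightarrow> Ck_on k S (\<lambda>x. c)"
proof (induction k arbitrary: c)
  case (Suc k)
  then show ?case by (intro Ck_on_SucI[where f' = "\<lambda>_ _. 0"]) auto
qed auto

lemma Ck_on_bounded_linear:
  assumes "bounded_linear L" "open S" "Ck_on k S f"
  shows "Ck_on k S (\<lambda>x. L (f x))"
  using assms(3)
proof (induction k arbitrary: f)
  case 0
  then show ?case using assms(1) by (auto intro: bounded_linear.continuous_on)
next
  case (Suc k)
  show ?case
  proof (rule Ck_on_SucI[OF assms(2)])
    show "((\<lambda>x. L (f x)) has_derivative (\<lambda>v. L (frechet_derivative f (at x) v))) (at x)" if "x \<in> S" for x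
      using Ck_on_Suc_has_derivative[OF Suc.prems that] assms(1) bounded_linear.has_derivative by blast
  qed (use Suc in auto)
qed

lemma Ck_on_id [simp]:
  assumes "open S"
  shows "Ck_on k S (\<lambda>x. x)"
proof (cases k)
  case (Suc j)
  have "Ck_on (Suc j) S (\<lambda>x. x)"
    by (rule Ck_on_SucI[OF assms has_derivative_ident Ck_on_const[OF assms]])
  then show ?thesis using Suc by simp
qed simp

lemma Ck_on_add:
  assumes "open S" "Ck_on k S f" "Ck_on k S g"
  shows "Ck_on k S (\<lambda>x. f x + g x)"
  using assms(2,3)
proof (induction k arbitrary: f g)
  case (Suc k)
  show ?case
  proof (rule Ck_on_SucI[OF assms(1)])
    show "((\<lambda>x. f x + g x) has_derivative
        (\<lambda>v. frechet_derivative f (at x) v + frechet_derivative g (at x) v)) (at x)" if "x \<in> S" for x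
      by (rule has_derivative_add[OF Ck_on_Suc_has_derivative[OF Suc.prems(1) that]
            Ck_on_Suc_has_derivative[OF Suc.prems(2) that]])
    show "Ck_on k S (\<lambda>x. frechet_derivative f (at x) v + frechet_derivative g (at x) v)" for v
      by (rule Suc.IH) (use Suc.prems in simp_all)
  qed
qed (auto intro: continuous_on_add)

lemma Ck_on_minus:
  assumes "open S" "Ck_on k S f"
  shows "Ck_on k S (\<lambda>x. - f x)"
  by (rule Ck_on_bounded_linear[OF bounded_linear_minus[OF bounded_linear_ident] assms])

lemma Ck_on_diff:
  assumes "open S" "Ck_on k S f" "Ck_on k S g"
  shows "Ck_on k S (\<lambda>x. f x - g x)"
  using Ck_on_add[OF assms(1,2) Ck_on_minus[OF assms(1,3)]] by simp

lemma Ck_on_sum: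
  assumes "open S" "\<And>i. i \<in> I \<Longrightarrow> Ck_on k S (f i)"
  shows "Ck_on k S (\<lambda>x. \<Sum>i\<in>I. f i x)"
  using assms(2)
proof (induction I rule: infinite_finite_induct)
  case (insert i I)
  then show ?case by (simp add: Ck_on_add[OF assms(1)])
qed (use assms(1) in auto)

lemma Ck_on_bilinear:
  assumes "bounded_bilinear B" "open S" "Ck_on k S f" "Ck_on k S g"
  shows "Ck_on k S (\<lambda>x. B (f x) (g x))"
  using assms(3,4)
proof (induction k arbitrary: f g)
  case 0
  then show ?case using assms(1) by (auto intro: bounded_bilinear.continuous_on)
next
  case (Suc k)
  show ?case
  proof (rule Ck_on_SucI[OF assms(2)])
    show "((\<lambda>x. B (f x) (g x)) has_derivative
       (\<lambda>v. B (f x) (frechet_derivative g (at x) v) + B (frechet_derivative f (at x) v) (g x))) (at x)" if "x \<in> S" for x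
      by (rule bounded_bilinear.FDERIV[OF assms(1) Ck_on_Suc_has_derivative[OF Suc.prems(1) that]
            Ck_on_Suc_has_derivative[OF Suc.prems(2) that]])
    show "Ck_on k S (\<lambda>x. B (f x) (frechet_derivative g (at x) v) + B (frechet_derivative f (at x) v) (g x))" for v
    proof (rule Ck_on_add[OF assms(2)]; rule Suc.IH)
      show "Ck_on k S f" "Ck_on k S g" using Suc.prems Ck_on_Suc_imp by blast+
    qed (use Suc.prems in simp_all)
  qed
qed

lemmas Ck_on_scaleR = Ck_on_bilinear[OF bounded_bilinear_scaleR]

lemma linear_basis_sum:
  fixes L :: "'a::euclidean_space \<Rightarrow> 'b::real_vector"
  assumes "linear L"
  shows "L v = (\<Sum>b\<in>Basis. (v \<bullet> b) *\<^sub>R L b)"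
  using arg_cong[OF euclidean_representation[of v], of L]
  by (simp add: linear_sum[OF assms] linear_cmul[OF assms])

text \<open>The derivative of a composition is expanded in a basis, so that it becomes a sum of products of
  maps to which the induction hypothesis applies.\<close>

lemma Ck_on_compose:
  fixes f :: "'a::euclidean_space \<Rightarrow> 'b::euclidean_space" and g :: "'b \<Rightarrow> 'c::euclidean_space"
  assumes "open S" "f ` S \<subseteq> T" "Ck_on k S f" "Ck_on k T g"
  shows "Ck_on k S (\<lambda>x. g (f x))"
  using assms(3,4)
proof (induction k arbitrary: g)
  case 0
  then show ?case using assms(2) continuous_on_compose2[of T g S f] by simp
next
  case (Suc k)
  let ?f' = "\<lambda>x. frechet_derivative f (at x)" and ?g' = "\<lambda>x. frechet_derivative g (at x)"
  have lin: "linear (?g' (f x))" if "x \<in> S" for x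
    using Suc.prems(2) assms(2) that by (auto intro!: linear_frechet_derivative)
  show ?case
  proof (rule Ck_on_SucI[OF assms(1)])
    show "((\<lambda>x. g (f x)) has_derivative
       (\<lambda>v. \<Sum>b\<in>Basis. (?f' x v \<bullet> b) *\<^sub>R ?g' (f x) b)) (at x)" if "x \<in> S" for x
    proof -
      have "((\<lambda>x. g (f x)) has_derivative (\<lambda>v. ?g' (f x) (?f' x v))) (at x)"
        by (rule has_derivative_compose)
          (use that Suc.prems assms(2) in \<open>auto simp: frechet_derivative_works[symmetric]\<close>)
      then show ?thesis by (subst (asm) linear_basis_sum[OF lin[OF that]])
    qed
    show "Ck_on k S (\<lambda>x. \<Sum>b\<in>Basis. (?f' x v \<bullet> b) *\<^sub>R ?g' (f x) b)" for v
    proof (rule Ck_on_sum[OF assms(1)], rule Ck_on_scaleR[OF assms(1)])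
      show "Ck_on k S (\<lambda>x. ?f' x v \<bullet> b)" for b
        by (rule Ck_on_bounded_linear[OF bounded_linear_inner_left assms(1)])
          (use Suc.prems in simp)
      show "Ck_on k S (\<lambda>x. ?g' (f x) b)" for b
        using Ck_on_Suc_imp[OF Suc.prems(1)] by (rule Suc.IH) (use Suc.prems in simp)
    qed
  qed
qed

lemma Ck_on_local:
  assumes "\<And>x. x \<in> S \<Longrightarrow> \<exists>W. open W \<and> x \<in> W \<and> Ck_on k W f"
  shows "Ck_on k S f"
  using assms
proof (induction k arbitrary: f)
  case 0
  have "isCont f x" if "x \<in> S" for x
    using 0[OF that] by (auto simp: continuous_on_eq_continuous_at)
  then show ?case by (simp add: continuous_at_imp_continuous_on)
next
  case (Suc k)
  have "f differentiable (at x)" if "x \<in> S" for x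
    using Suc.prems[OF that] by auto
  moreover have "Ck_on k S (\<lambda>x. frechet_derivative f (at x) v)" for v
  proof (rule Suc.IH)
    fix x assume "x \<in> S"
    from Suc.prems[OF this] show "\<exists>W. open W \<and> x \<in> W \<and> Ck_on k W (\<lambda>x. frechet_derivative f (at x) v)"
      by auto
  qed
  ultimately show ?case by simp
qed

lemma smooth_on_open_iff:
  assumes "open S"
  shows "smooth_on S f \<longleftrightarrow> (\<forall>k. Ck_on k S f)"
proof
  assume f: "smooth_on S f"
  have "Ck_on k S f" for k
  proof (rule Ck_on_local)
    fix x assume x: "x \<in> S"
    obtain W g where W: "open W" "x \<in> W" "\<forall>k. Ck_on k W g" "\<forall>y\<in>S \<inter> W. g y = f y"
      using f x unfolding smooth_on_def by fast
    have "Ck_on k (S \<inter> W) g"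
      using W(3) Ck_on_subset[of k W g "S \<inter> W"] by simp
    then have "Ck_on k (S \<inter> W) f"
      using W(4) by (elim Ck_on_cong[OF open_Int[OF assms W(1)], rotated]) simp
    then show "\<exists>W. open W \<and> x \<in> W \<and> Ck_on k W f"
      using open_Int[OF assms W(1)] x W(2) by (intro exI[of _ "S \<inter> W"]) simp
  qed
  then show "\<forall>k. Ck_on k S f" ..
next
  assume "\<forall>k. Ck_on k S f"
  then show "smooth_on S f"
    unfolding smooth_on_def using assms by (intro ballI exI[of _ S] exI[of _ f] conjI) simp_all
qed

lemma smooth_on_subset:
  assumes "smooth_on S f" "T \<subseteq> S"
  shows "smooth_on T f"
  unfolding smooth_on_def
proof
  fix x assume "x \<in> T"
  then have "x \<in> S" using assms(2) by blast
  from assms(1)[unfolded smooth_on_def, rule_format, OF this] obtain W g where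
    "open W" "x \<in> W" "\<forall>k. Ck_on k W g" "\<forall>y\<in>S \<inter> W. g y = f y"
    by auto
  then show "\<exists>W g. open W \<and> x \<in> W \<and> (\<forall>k. Ck_on k W g) \<and> (\<forall>y\<in>T \<inter> W. g y = f y)"
    using assms(2) by (intro exI[of _ W] exI[of _ g]) auto
qed

section \<open>Inverses of families of linear maps\<close>

lemma linear_inverse_linear:
  assumes "linear g" "\<And>v. g (h v) = v" "\<And>v. h (g v) = v"
  shows "linear h"
proof
  show "h (x + y) = h x + h y" for x y
    using assms(3)[of "h x + h y"] by (simp add: linear_add[OF assms(1)] assms(2))
  show "h (r *\<^sub>R x) = r *\<^sub>R h x" for r x
    using assms(3)[of "r *\<^sub>R h x"] by (simp add: linear_cmul[OF assms(1)] assms(2))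
qed

lemma linear_inverse_continuous_on:
  fixes G :: "'a::euclidean_space \<Rightarrow> 'b::euclidean_space \<Rightarrow> 'b"
  assumes "open V" and lin: "\<And>y. y \<in> V \<Longrightarrow> linear (G y)"
    and GH: "\<And>y v. y \<in> V \<Longrightarrow> G y (H y v) = v" and HG: "\<And>y v. y \<in> V \<Longrightarrow> H y (G y v) = v"
    and cont: "\<And>w. continuous_on V (\<lambda>y. G y w)"
  shows "continuous_on V (\<lambda>y. H y v)"
proof (rule continuous_at_imp_continuous_on, rule)
  fix a assume a: "a \<in> V"
  have "bounded_linear (H a)"
    using linear_inverse_linear[OF lin[OF a] GH[OF a] HG[OF a]]
    by (simp add: linear_conv_bounded_linear)
  then obtain K where K: "K > 0" "\<And>x. norm (H a x) \<le> norm x * K"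
    using bounded_linear.pos_bounded by blast
  define e where "e y = (\<Sum>b\<in>Basis. norm (G y b - G a b))" for y
  have eb: "norm (G y w - G a w) \<le> e y * norm w" if "y \<in> V" for y w
  proof -
    have "G y w - G a w = (\<Sum>b\<in>Basis. (w \<bullet> b) *\<^sub>R (G y b - G a b))"
      by (subst linear_basis_sum[OF lin[OF that]], subst linear_basis_sum[OF lin[OF a]])
        (simp add: scaleR_diff_right sum_subtractf)
    also have "norm \<dots> \<le> (\<Sum>b\<in>Basis. norm w * norm (G y b - G a b))"
      by (rule sum_norm_le) (simp add: Basis_le_norm mult_right_mono)
    finally show ?thesis by (simp add: e_def sum_distrib_left mult.commute)
  qed
  have e0: "(e \<longlongrightarrow> 0) (at a)"
  proof -
    have "((\<lambda>y. norm (G y b - G a b)) \<longlongrightarrow> 0) (at a)" for b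
      using cont[of b] a assms(1)
      by (simp add: continuous_on_eq_continuous_at isCont_def tendsto_norm_zero LIM_zero)
    then have "(e \<longlongrightarrow> (\<Sum>b\<in>(Basis::'b set). 0)) (at a)"
      unfolding e_def[abs_def] by (rule tendsto_sum)
    then show ?thesis by simp
  qed
  have bd: "norm (H y w) \<le> 2 * K * norm w" if "y \<in> V" "e y < 1 / (2 * K)" for y w
  proof -
    define z where "z = H y w"
    have "norm z = norm (H a (G a z))" by (simp add: HG a)
    also have "\<dots> \<le> norm (G a z) * K" by (rule K)
    also have "norm (G a z) \<le> norm (G y z) + e y * norm z"
      using eb[OF that(1), of z] norm_triangle_sub[of "G a z" "G y z"] by (simp add: norm_minus_commute)
    also have "e y * norm z \<le> 1 / (2 * K) * norm z"
      using that(2) by (intro mult_right_mono) auto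
    finally show ?thesis
      using K(1) GH[OF that(1), of w] by (simp add: z_def field_simps)
  qed
  have "((\<lambda>y. H y v - H a v) \<longlongrightarrow> 0) (at a)"
  proof (rule Lim_null_comparison)
    have "\<forall>\<^sub>F y in at a. e y < 1 / (2 * K)"
      using e0 K(1) by (auto intro: order_tendstoD)
    moreover have "\<forall>\<^sub>F y in at a. y \<in> V"
      using assms(1) a by (simp add: eventually_at_topological) blast
    ultimately show "\<forall>\<^sub>F y in at a. norm (H y v - H a v) \<le> 2 * K * (e y * norm (H a v))"
    proof eventually_elim
      case (elim y)
      have "H y v - H a v = H y (G a (H a v) - G y (H a v))"
      proof -
        have "linear (H y)"
          by (rule linear_inverse_linear[OF lin[OF elim(2)] GH[OF elim(2)] HG[OF elim(2)]])
        then have "H y (u - w) = H y u - H y w" for u w by (rule linear_diff)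
        then show ?thesis by (simp add: GH HG elim(2) a)
      qed
      then have "norm (H y v - H a v) \<le> 2 * K * norm (G a (H a v) - G y (H a v))"
        using bd[OF elim(2,1)] by metis
      also have "\<dots> \<le> 2 * K * (e y * norm (H a v))"
        using eb[OF elim(2), of "H a v"] K(1) by (simp add: norm_minus_commute)
      finally show ?case .
    qed
    show "((\<lambda>y. 2 * K * (e y * norm (H a v))) \<longlongrightarrow> 0) (at a)"
      using tendsto_mult[OF tendsto_const tendsto_mult[OF e0 tendsto_const], of "2 * K" "norm (H a v)"]
      by simp
  qed
  then show "isCont (\<lambda>y. H y v) a"
    unfolding isCont_def using LIM_zero_iff by blast
qed

lemma Ck_on_imp_continuous_on: "Ck_on k S f \<Longrightarrow> continuous_on S f"
proof (induction k)
  case (Suc k)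
  from Suc.IH[OF Ck_on_Suc_imp[OF Suc.prems]] show ?case .
qed simp

text \<open>A product rule in which the second factor need not be differentiable, because the first one
  vanishes. The case of a second factor with nonzero limit follows by subtracting the limit.\<close>

lemma has_derivative_scaleR_null:
  fixes f :: "'a::real_normed_vector \<Rightarrow> real" and g :: "'a \<Rightarrow> 'b::real_normed_vector"
  assumes "(f has_derivative f') (at a)" "f a = 0" "(g \<longlongrightarrow> 0) (at a)"
  shows "((\<lambda>x. f x *\<^sub>R g x) has_derivative (\<lambda>u. 0)) (at a)"
proof -
  obtain K where K: "\<And>u. norm (f' u) \<le> norm u * K" "K > 0"
    using bounded_linear.pos_bounded[OF has_derivative_bounded_linear[OF assms(1)]] by blast
  have lim: "((\<lambda>x. (f x - f a - f' (x - a)) /\<^sub>R norm (x - a)) \<longlongrightarrow> 0) (at a)"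
    using assms(1) by (simp add: has_derivative_at_within)
  have "((\<lambda>x. norm (g x)) \<longlongrightarrow> 0) (at a)"
    using assms(3) by (rule tendsto_norm_zero)
  then have lim0: "((\<lambda>x. (norm ((f x - f a - f' (x - a)) /\<^sub>R norm (x - a)) + K) * norm (g x)) \<longlongrightarrow> (0 + K) * 0) (at a)"
    by (intro tendsto_mult tendsto_add tendsto_const tendsto_norm_zero[OF lim])
  have "((\<lambda>x. (f x *\<^sub>R g x - f a *\<^sub>R g a - 0) /\<^sub>R norm (x - a)) \<longlongrightarrow> 0) (at a)"
  proof (rule Lim_null_comparison)
    have "norm ((f x *\<^sub>R g x - f a *\<^sub>R g a - 0) /\<^sub>R norm (x - a))
        \<le> (norm ((f x - f a - f' (x - a)) /\<^sub>R norm (x - a)) + K) * norm (g x)" if "x \<noteq> a" for x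
    proof -
      have "\<bar>f x\<bar> \<le> norm (f x - f a - f' (x - a)) + norm (x - a) * K"
        using K(1)[of "x - a"] assms(2) by simp
      then have "\<bar>f x\<bar> / norm (x - a) \<le> norm (f x - f a - f' (x - a)) / norm (x - a) + K"
        using that by (simp add: divide_simps algebra_simps)
      from mult_right_mono[OF this norm_ge_zero[of "g x"]] show ?thesis
        using assms(2) by (simp add: divide_inverse abs_mult mult.commute mult.left_commute)
    qed
    then show "\<forall>\<^sub>F x in at a. norm ((f x *\<^sub>R g x - f a *\<^sub>R g a - 0) /\<^sub>R norm (x - a))
        \<le> (norm ((f x - f a - f' (x - a)) /\<^sub>R norm (x - a)) + K) * norm (g x)"
      by (auto simp: eventually_at_filter)
  qed (use lim0 in simp)
  then show ?thesis by (simp add: has_derivative_at_within)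
qed

text \<open>The derivative of the inverse \<open>H\<close> of \<open>G\<close> is \<open>- H G' H\<close>, which is \<open>C\<^sup>k\<close> if \<open>H\<close> and \<open>G'\<close> are.\<close>

lemma linear_inverse_Ck_on:
  fixes G :: "'a::euclidean_space \<Rightarrow> 'b::euclidean_space \<Rightarrow> 'b"
  assumes "open V" and lin: "\<And>y. y \<in> V \<Longrightarrow> linear (G y)"
    and GH: "\<And>y v. y \<in> V \<Longrightarrow> G y (H y v) = v" and HG: "\<And>y v. y \<in> V \<Longrightarrow> H y (G y v) = v"
    and Ck: "\<And>w. Ck_on k V (\<lambda>y. G y w)"
  shows "Ck_on k V (\<lambda>y. H y v)"
  using Ck
proof (induction k arbitrary: v)
  case 0
  have "continuous_on V (\<lambda>y. G y w)" for w using 0[of w] by simp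
  from linear_inverse_continuous_on[OF assms(1-4) this] show ?case by simp
next
  case (Suc k)
  have IH: "Ck_on k V (\<lambda>y. H y v)" for v
    using Ck_on_Suc_imp[OF Suc.prems] by (rule Suc.IH)
  have linH: "linear (H y)" if "y \<in> V" for y
    by (rule linear_inverse_linear[OF lin[OF that] GH[OF that] HG[OF that]])
  define G' where "G' y u w = frechet_derivative (\<lambda>y. G y w) (at y) u" for y u w
  have G': "((\<lambda>y. G y w) has_derivative (\<lambda>u. G' y u w)) (at y)" if "y \<in> V" for y w
    unfolding G'_def by (rule Ck_on_Suc_has_derivative[OF Suc.prems that])
  have G'_Ck: "Ck_on k V (\<lambda>y. G' y u w)" for u w
    using Suc.prems[of w] by (simp add: G'_def)
  define D where "D y u = (\<Sum>b\<in>Basis. - ((\<Sum>c\<in>Basis. (H y v \<bullet> c) *\<^sub>R G' y u c) \<bullet> b) *\<^sub>R H y b)" for y u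
  show ?case
  proof (rule Ck_on_SucI[OF assms(1)])
    show "Ck_on k V (\<lambda>y. D y u)" for u
      unfolding D_def
      by (intro Ck_on_sum[OF assms(1)] Ck_on_scaleR[OF assms(1)] IH Ck_on_minus[OF assms(1)] G'_Ck
          Ck_on_bounded_linear[OF bounded_linear_inner_left assms(1)])
    fix y0 assume y0: "y0 \<in> V"
    define z where "z = H y0 v"
    \<comment> \<open>With this notation \<open>H y v = z - H y (\<phi> y)\<close>.\<close>
    define \<phi> where "\<phi> y = G y z - v" for y
    define \<phi>' where "\<phi>' u = G' y0 u z" for u
    have \<phi>0: "\<phi> y0 = 0" by (simp add: \<phi>_def z_def GH y0)
    have \<phi>: "(\<phi> has_derivative \<phi>') (at y0)"
      unfolding \<phi>_def \<phi>'_def using G'[OF y0] has_derivative_diff[OF _ has_derivative_const] by fastforce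
    have D0: "D y0 u = - H y0 (\<phi>' u)" for u
    proof -
      have "G' y0 u w = (\<Sum>c\<in>Basis. (w \<bullet> c) *\<^sub>R G' y0 u c)" for w
      proof -
        have "((\<lambda>y. \<Sum>c\<in>Basis. (w \<bullet> c) *\<^sub>R G y c) has_derivative
            (\<lambda>u. \<Sum>c\<in>Basis. (w \<bullet> c) *\<^sub>R G' y0 u c)) (at y0)"
          by (intro has_derivative_sum has_derivative_scaleR_right G' y0)
        then have "((\<lambda>y. G y w) has_derivative (\<lambda>u. \<Sum>c\<in>Basis. (w \<bullet> c) *\<^sub>R G' y0 u c)) (at y0)"
          by (rule has_derivative_transform_within_open[OF _ assms(1) y0])
            (rule linear_basis_sum[OF lin, symmetric])
        from has_derivative_unique[OF G'[OF y0] this] show ?thesis by (rule fun_cong)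
      qed
      from this[of z, symmetric] have "(\<Sum>c\<in>Basis. (H y0 v \<bullet> c) *\<^sub>R G' y0 u c) = \<phi>' u"
        unfolding \<phi>'_def z_def .
      then have "D y0 u = - (\<Sum>b\<in>Basis. (\<phi>' u \<bullet> b) *\<^sub>R H y0 b)"
        unfolding D_def by (simp add: sum_negf)
      then show ?thesis using linear_basis_sum[OF linH[OF y0], of "\<phi>' u"] by simp
    qed
    have eq: "H y v = z - (\<Sum>b\<in>Basis. (\<phi> y \<bullet> b) *\<^sub>R H y b)" if "y \<in> V" for y
    proof -
      have "(\<Sum>b\<in>Basis. (\<phi> y \<bullet> b) *\<^sub>R H y b) = H y (\<phi> y)"
        by (rule linear_basis_sum[OF linH[OF that], symmetric])
      then show ?thesis
        using that by (simp add: \<phi>_def linear_diff[OF linH] HG)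
    qed
    \<comment> \<open>\<open>H\<close> is only known to be continuous here, which suffices because \<open>\<phi>\<close> vanishes at \<open>y0\<close>.\<close>
    have prod: "((\<lambda>y. (\<phi> y \<bullet> b) *\<^sub>R H y b) has_derivative (\<lambda>u. (\<phi>' u \<bullet> b) *\<^sub>R H y0 b)) (at y0)" for b
    proof -
      have "isCont (\<lambda>y. H y b) y0"
        using Ck_on_imp_continuous_on[OF IH[of b]] y0
        unfolding continuous_on_eq_continuous_at[OF assms(1)] by blast
      then have "((\<lambda>y. H y b - H y0 b) \<longlongrightarrow> 0) (at y0)"
        by (simp add: isCont_def LIM_zero)
      moreover have "((\<lambda>y. \<phi> y \<bullet> b) has_derivative (\<lambda>u. \<phi>' u \<bullet> b)) (at y0)"
        by (rule has_derivative_inner_left[OF \<phi>])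
      ultimately have 1: "((\<lambda>y. (\<phi> y \<bullet> b) *\<^sub>R (H y b - H y0 b)) has_derivative (\<lambda>u. 0)) (at y0)"
        using \<phi>0 by (intro has_derivative_scaleR_null) auto
      have 2: "((\<lambda>y. (\<phi> y \<bullet> b) *\<^sub>R H y0 b) has_derivative (\<lambda>u. (\<phi>' u \<bullet> b) *\<^sub>R H y0 b)) (at y0)"
        by (intro has_derivative_scaleR_left has_derivative_inner_left \<phi>)
      from has_derivative_add[OF 1 2] show ?thesis by (simp add: scaleR_diff_right)
    qed
    have "((\<lambda>y. z - (\<Sum>b\<in>Basis. (\<phi> y \<bullet> b) *\<^sub>R H y b)) has_derivative
        (\<lambda>u. 0 - (\<Sum>b\<in>Basis. (\<phi>' u \<bullet> b) *\<^sub>R H y0 b))) (at y0)"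
      by (intro has_derivative_diff has_derivative_const has_derivative_sum prod)
    moreover have "(\<lambda>u. 0 - (\<Sum>b\<in>Basis. (\<phi>' u \<bullet> b) *\<^sub>R H y0 b)) = D y0"
      using linear_basis_sum[OF linH[OF y0], of "\<phi>' _"] by (simp add: D0 fun_eq_iff)
    ultimately have "((\<lambda>y. z - (\<Sum>b\<in>Basis. (\<phi> y \<bullet> b) *\<^sub>R H y b)) has_derivative D y0) (at y0)"
      by simp
    then show "((\<lambda>y. H y v) has_derivative D y0) (at y0)"
      by (rule has_derivative_transform_within_open[OF _ assms(1) y0]) (simp add: eq[symmetric])
  qed
qed

section \<open>Inverse and implicit functions\<close>

lemma smooth_inverse_function:
  fixes f :: "'a::euclidean_space \<Rightarrow> 'a"
  assumes "open U" and Ck: "\<And>k. Ck_on k U f" and "x0 \<in> U"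
    and f': "(f has_derivative f') (at x0)" "inj f'"
  obtains U' V g where "open U'" "U' \<subseteq> U" "x0 \<in> U'" "open V" "f x0 \<in> V"
    "homeomorphism U' V f g" "\<And>k. Ck_on k V g"
proof -
  define D where "D x = frechet_derivative f (at x)" for x
  define F where "F x = Blinfun (D x)" for x
  have D: "(f has_derivative D x) (at x)" if "x \<in> U" for x
    unfolding D_def by (rule Ck_on_Suc_has_derivative[OF Ck that])
  have D_Ck: "Ck_on k U (\<lambda>x. D x v)" for k v
    using Ck[of "Suc k"] unfolding D_def by simp
  have F: "blinfun_apply (F x) = D x" if "x \<in> U" for x
    unfolding F_def
    by (rule bounded_linear_Blinfun_apply[OF has_derivative_bounded_linear[OF D[OF that]]])
  have "D x0 = f'"
    by (rule has_derivative_unique[OF D[OF assms(3)] f'(1)])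
  have linf': "linear f'"
    using has_derivative_linear[OF f'(1)] .
  obtain h where h: "linear h" "h \<circ> f' = id"
    using linear_injective_left_inverse[OF linf' f'(2)] by blast
  have bh: "bounded_linear h" using h(1) by (simp add: linear_conv_bounded_linear)
  have inv: "Blinfun h o\<^sub>L F x0 = id_blinfun"
    by (rule blinfun_eqI)
      (use h(2) \<open>D x0 = f'\<close> F[OF assms(3)] in \<open>simp add: bounded_linear_Blinfun_apply[OF bh] fun_eq_iff\<close>)
  have contF: "continuous_on U F"
  proof (rule continuous_on_blinfun_componentwise)
    fix i :: 'a
    have "continuous_on U (\<lambda>x. D x i)" by (rule Ck_on_imp_continuous_on[OF D_Ck])
    then show "continuous_on U (\<lambda>x. blinfun_apply (F x) i)"
      by (rule continuous_on_eq) (simp add: F)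
  qed
  have derf: "(f has_derivative blinfun_apply (F x)) (at x)" if "x \<in> U" for x
    using D[OF that] F[OF that] by simp
  obtain U' V g g' where 1: "open U'" "U' \<subseteq> U" "x0 \<in> U'" "open V" "f x0 \<in> V"
    and hom: "homeomorphism U' V f g"
    and g': "\<And>y. y \<in> V \<Longrightarrow> (g has_derivative (g' y)) (at y)"
    and g'_eq: "\<And>y. y \<in> V \<Longrightarrow> g' y = inv (blinfun_apply (F (g y)))"
    and bij: "\<And>y. y \<in> V \<Longrightarrow> bij (blinfun_apply (F (g y)))"
    using inverse_function_theorem[OF assms(1) derf contF assms(3) inv] by blast
  have gV: "g y \<in> U" if "y \<in> V" for y
    using hom that 1(2) by (auto simp: homeomorphism_def)
  have "Ck_on k V g" for k
  proof (induction k)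
    case 0
    have "continuous_on V g" using hom by (simp add: homeomorphism_def)
    then show ?case by simp
  next
    case (Suc k)
    show ?case
    proof (rule Ck_on_SucI[OF 1(4) g'])
      show "Ck_on k V (\<lambda>y. g' y v)" for v
      proof (rule linear_inverse_Ck_on[OF 1(4), where G = "\<lambda>y. D (g y)"])
        fix y w assume y: "y \<in> V"
        show "linear (D (g y))" using has_derivative_linear[OF D[OF gV[OF y]]] .
        have bijD: "bij (D (g y))" and "g' y = inv (D (g y))"
          using bij[OF y] g'_eq[OF y] F[OF gV[OF y]] by simp_all
        then show "D (g y) (g' y w) = w" "g' y (D (g y) w) = w"
          by (simp_all add: bij_is_surj surj_f_inv_f bij_is_inj)
      next
        show "Ck_on k V (\<lambda>y. D (g y) w)" for w
          by (rule Ck_on_compose[OF 1(4) _ Suc D_Ck]) (use gV in blast)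
      qed
    qed
  qed
  with 1 hom show thesis by (intro that)
qed

text \<open>A decomposition of the whole space into two complementary subspaces, with the projections
  \<open>fs\<close> and \<open>sn\<close> onto the summands.\<close>

locale direct_sum =
  fixes K C :: "'a::euclidean_space set"
  assumes subspaces: "subspace K" "subspace C"
    and inter: "K \<inter> C = {0}" and sum: "K + C = UNIV"
begin

abbreviation fs where "fs \<equiv> comp_fst K C"
abbreviation sn where "sn \<equiv> comp_snd K C"

lemma ex1_component: "\<exists>!n. n \<in> K \<and> u - n \<in> C"
proof -
  have "u \<in> K + C" by (simp add: sum)
  then obtain k c where "k \<in> K" "c \<in> C" "u = k + c" by (auto elim: set_plus_elim)
  then have *: "k \<in> K \<and> u - k \<in> C" by simp
  show ?thesis
  proof (rule ex1I)
    show "k \<in> K \<and> u - k \<in> C" by fact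
    fix n assume n: "n \<in> K \<and> u - n \<in> C"
    have "n - k \<in> K" using n * subspace_diff[OF subspaces(1)] by blast
    moreover have "(u - k) - (u - n) \<in> C" using n * subspace_diff[OF subspaces(2)] by blast
    ultimately have "n - k \<in> K \<inter> C" by simp
    then show "n = k" using inter by simp
  qed
qed

lemma fs_in: "fs u \<in> K" and sn_in: "sn u \<in> C"
  using theI'[OF ex1_component[of u]] by (auto simp: comp_fst_def comp_snd_def)

lemma fs_eqI: "n \<in> K \<Longrightarrow> u - n \<in> C \<Longrightarrow> fs u = n"
  unfolding comp_fst_def using the1_equality[OF ex1_component] by blast

lemma fs_plus_sn: "fs u + sn u = u"
  by (simp add: comp_snd_def)

lemma fs_add: "k \<in> K \<Longrightarrow> c \<in> C \<Longrightarrow> fs (k + c) = k"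
  by (rule fs_eqI) auto

lemma sn_add: "k \<in> K \<Longrightarrow> c \<in> C \<Longrightarrow> sn (k + c) = c"
  by (simp add: comp_snd_def fs_add)

lemma fs_K: "k \<in> K \<Longrightarrow> fs k = k" using fs_add[of k 0] subspace_0[OF subspaces(2)] by simp
lemma fs_C: "k \<in> C \<Longrightarrow> fs k = 0" using fs_add[of 0 k] subspace_0[OF subspaces(1)] by simp
lemma sn_K: "k \<in> K \<Longrightarrow> sn k = 0" by (simp add: comp_snd_def fs_K)
lemma sn_C: "k \<in> C \<Longrightarrow> sn k = k" by (simp add: comp_snd_def fs_C)

lemma linear_fs: "linear fs"
proof
  fix x y :: 'a and r :: real
  have "x + y - (fs x + fs y) = sn x + sn y" by (simp add: comp_snd_def)
  then show "fs (x + y) = fs x + fs y"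
    by (intro fs_eqI) (simp_all add: subspaces subspace_add fs_in sn_in)
  have "r *\<^sub>R x - r *\<^sub>R fs x = r *\<^sub>R sn x" by (simp add: comp_snd_def scaleR_diff_right)
  then show "fs (r *\<^sub>R x) = r *\<^sub>R fs x"
    by (intro fs_eqI) (simp_all add: subspaces subspace_scale fs_in sn_in)
qed

lemma linear_sn: "linear sn"
  unfolding comp_snd_def[abs_def] by (intro linear_compose_sub linear_fs linear_ident)

lemma bounded_linear_fs: "bounded_linear fs" and bounded_linear_sn: "bounded_linear sn"
  using linear_fs linear_sn by (simp_all add: linear_conv_bounded_linear)

end

text \<open>The zero set of \<open>H\<close> near \<open>x0\<close> is the graph over \<open>K\<close> of the part of \<open>\<Phi>\<close> with values in \<open>C\<close>. The map \<open>H\<close>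
  takes its values in a set \<open>S \<subseteq> H' ` C\<close>, so that the codomain need not be identified with \<open>C\<close>.\<close>

lemma implicit_graph:
  fixes H :: "'a::euclidean_space \<Rightarrow> 'a"
  assumes "direct_sum K C"
    and W: "open W" "x0 \<in> W" "\<And>k. Ck_on k W H" "\<And>x. x \<in> W \<Longrightarrow> H x \<in> S"
    and H': "(H has_derivative H') (at x0)"
    and inj: "\<And>c. c \<in> C \<Longrightarrow> H' c = 0 \<Longrightarrow> c = 0" and surj: "S \<subseteq> H' ` C"
    and H0: "H x0 = 0"
  obtains W' V \<Phi> where "open W'" "x0 \<in> W'" "W' \<subseteq> W" "open V" "comp_fst K C x0 \<in> V"
    "\<And>k. Ck_on k V \<Phi>" "\<Phi> (comp_fst K C x0) = x0"
    "\<And>x. x \<in> W' \<Longrightarrow> H x = 0 \<Longrightarrow> comp_fst K C x \<in> V \<and> \<Phi> (comp_fst K C x) = x"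
    "\<And>y. y \<in> V \<Longrightarrow> y \<in> K \<Longrightarrow> \<Phi> y \<in> W' \<and> H (\<Phi> y) = 0 \<and> comp_fst K C (\<Phi> y) = y"
proof -
  interpret direct_sum K C by fact
  have lin: "linear H'" using has_derivative_linear[OF H'] .
  have "inj_on H' C"
    using inj subspaces(2) by (simp add: linear_injective_on_subspace_0[OF lin])
  then obtain A where AC: "\<And>x. A x \<in> C" and linA: "linear A" and AH: "\<And>c. c \<in> C \<Longrightarrow> A (H' c) = c"
    using linear_exists_left_inverse_on[OF lin subspaces(2)] by blast
  have A_inj: "w = 0" if "w \<in> S" "A w = 0" for w
    using that surj AH linear_0[OF lin] by auto
  \<comment> \<open>\<open>\<Psi>\<close> keeps the component in \<open>K\<close> and replaces the one in \<open>C\<close> by the value of \<open>H\<close>, read in \<open>C\<close>.\<close>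
  define \<Psi> where "\<Psi> x = fs x + A (H x)" for x
  have bA: "bounded_linear A" using linA by (simp add: linear_conv_bounded_linear)
  have \<Psi>_Ck: "Ck_on k W \<Psi>" for k
    unfolding \<Psi>_def[abs_def]
    by (intro Ck_on_add[OF W(1)] Ck_on_bounded_linear[OF bounded_linear_fs W(1)]
        Ck_on_bounded_linear[OF bA W(1)] Ck_on_id W)
  have \<Psi>': "(\<Psi> has_derivative (\<lambda>v. fs v + A (H' v))) (at x0)"
    unfolding \<Psi>_def[abs_def]
    by (intro has_derivative_add bounded_linear_imp_has_derivative[OF bounded_linear_fs]
        bounded_linear.has_derivative[OF bA] H')
  have "inj (\<lambda>v. fs v + A (H' v))"
  proof (subst linear_injective_0)
    show "linear (\<lambda>v. fs v + A (H' v))" using has_derivative_linear[OF \<Psi>'] .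
    show "\<forall>v. fs v + A (H' v) = 0 \<longrightarrow> v = 0"
    proof (intro allI impI)
      fix v assume v: "fs v + A (H' v) = 0"
      then have "fs v = 0" using fs_add[OF fs_in AC, of v "H' v"] linear_0[OF linear_fs] by simp
      then have "v \<in> C" using sn_in[of v] by (simp add: comp_snd_def)
      then show "v = 0" using v AH \<open>fs v = 0\<close> by simp
    qed
  qed
  then obtain W' V \<Phi> where 1: "open W'" "W' \<subseteq> W" "x0 \<in> W'" "open V" "\<Psi> x0 \<in> V"
    and hom: "homeomorphism W' V \<Psi> \<Phi>" and \<Phi>: "\<And>k. Ck_on k V \<Phi>"
    using smooth_inverse_function[OF W(1) \<Psi>_Ck W(2) \<Psi>'] by metis
  have \<Psi>x0: "\<Psi> x0 = fs x0" by (simp add: \<Psi>_def H0 linear_0[OF linA])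
  have fs\<Psi>: "fs (\<Psi> x) = fs x" for x
    by (simp add: \<Psi>_def fs_add fs_in AC)
  show thesis
  proof (rule that[of W' V \<Phi>])
    show "\<Phi> (fs x0) = x0" using hom 1(3) \<Psi>x0 by (metis homeomorphism_def)
    show "fs x \<in> V \<and> \<Phi> (fs x) = x" if "x \<in> W'" "H x = 0" for x
    proof -
      have "\<Psi> x = fs x" using that by (simp add: \<Psi>_def linear_0[OF linA])
      then show ?thesis using hom that(1) by (metis homeomorphism_def imageI)
    qed
    show "\<Phi> y \<in> W' \<and> H (\<Phi> y) = 0 \<and> fs (\<Phi> y) = y" if y: "y \<in> V" "y \<in> K" for y
    proof -
      have x: "\<Phi> y \<in> W'" "\<Psi> (\<Phi> y) = y" using hom y(1) by (auto simp: homeomorphism_def)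
      then have f: "fs (\<Phi> y) = y" using fs\<Psi>[of "\<Phi> y"] fs_K[OF y(2)] by simp
      then have "A (H (\<Phi> y)) = 0" using x(2) by (simp add: \<Psi>_def)
      then have "H (\<Phi> y) = 0" using A_inj W(4) x(1) 1(2) by blast
      then show ?thesis using x f by simp
    qed
  qed (use 1 \<Phi> \<Psi>x0 in simp_all)
qed

section \<open>Transverse intersections with a subspace\<close>

lemma direct_sum_orthogonal_comp:
  "subspace L \<Longrightarrow> direct_sum L (orthogonal_comp L)"
  by unfold_locales (simp_all add: subspace_orthogonal_comp orthogonal_Int_0 subspace_sum_orthogonal_comp)

lemma subspace_set_plus:
  assumes "subspace A" "subspace B"
  shows "subspace (A + B)"
proof -
  have "A + B = {x + y |x y. x \<in> A \<and> y \<in> B}" by (auto simp: set_plus_def)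
  then show ?thesis using subspace_sums[OF assms] by simp
qed

text \<open>A submanifold is locally the zero set of a submersion, namely of a chart followed by the
  projection along the model subspace. It takes values in a subspace of the ambient space, and
  being a submersion onto that subspace is expressed by \<open>H x \<in> range H'\<close>.\<close>

lemma submanifold_submersion:
  fixes M :: "'a::euclidean_space set"
  assumes "submanifold M" "x0 \<in> M"
  obtains W H H' where "open W" "x0 \<in> W" "\<And>k. Ck_on k W (H :: 'a \<Rightarrow> 'a)"
    "(H has_derivative H') (at x0)" "\<And>x. x \<in> W \<Longrightarrow> H x \<in> range H'"
    "\<And>x. x \<in> W \<Longrightarrow> x \<in> M \<longleftrightarrow> H x = 0"
proof -
  from assms(1)[unfolded submanifold_def, rule_format, OF assms(2)]
  obtain W L and h :: "'a \<Rightarrow> 'a" where W: "open W" "x0 \<in> W" "open (h ` W)" "inj_on h W"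
    and h: "smooth_on W h" and k: "smooth_on (h ` W) (inv_into W h)"
    and L: "subspace L" "h ` (M \<inter> W) = h ` W \<inter> L"
    by auto
  interpret L: direct_sum L "orthogonal_comp L" by (rule direct_sum_orthogonal_comp[OF L(1)])
  let ?Q = "comp_snd L (orthogonal_comp L)"
  have hC: "Ck_on j W h" for j using h by (simp add: smooth_on_open_iff[OF W(1)])
  have kC: "Ck_on j (h ` W) (inv_into W h)" for j using k by (simp add: smooth_on_open_iff[OF W(3)])
  define h' where "h' = frechet_derivative h (at x0)"
  define k' where "k' = frechet_derivative (inv_into W h) (at (h x0))"
  have h': "(h has_derivative h') (at x0)"
    unfolding h'_def by (rule Ck_on_Suc_has_derivative[OF hC W(2)])
  have inv: "inv_into W h (h x0) = x0" using W by simp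
  have k': "(inv_into W h has_derivative k') (at (h x0))"
    unfolding k'_def by (rule Ck_on_Suc_has_derivative[OF kC]) (use W(2) in simp)
  have hk: "h' (k' w) = w" for w
  proof -
    have "((\<lambda>y. h (inv_into W h y)) has_derivative (\<lambda>w. h' (k' w))) (at (h x0))"
      by (rule has_derivative_compose[OF k']) (use h' inv in simp)
    moreover have "((\<lambda>y. y) has_derivative (\<lambda>w. h' (k' w))) (at (h x0))"
      by (rule has_derivative_transform_within_open[OF calculation W(3)])
        (use W(2) in \<open>auto simp: f_inv_into_f\<close>)
    ultimately show ?thesis using has_derivative_unique[OF _ has_derivative_ident] by metis
  qed
  define H where "H x = ?Q (h x)" for x
  show thesis
  proof (rule that[OF W(1,2)])
    show "Ck_on j W H" for j
      unfolding H_def[abs_def] by (rule Ck_on_bounded_linear[OF L.bounded_linear_sn W(1) hC])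
    show "(H has_derivative (\<lambda>v. ?Q (h' v))) (at x0)"
      unfolding H_def[abs_def] by (rule bounded_linear.has_derivative[OF L.bounded_linear_sn h'])
    show "H x \<in> range (\<lambda>v. ?Q (h' v))" for x
      unfolding H_def using hk[of "h x"] by (metis rangeI)
    show "x \<in> M \<longleftrightarrow> H x = 0" if x: "x \<in> W" for x
    proof -
      have "x \<in> M \<longleftrightarrow> h x \<in> L"
        using L(2) x W(4) by (auto simp: inj_on_def) 
      also have "\<dots> \<longleftrightarrow> H x = 0"
        unfolding H_def using L.sn_K L.fs_plus_sn[of "h x"] L.fs_in[of "h x"] by auto
      finally show ?thesis .
    qed
  qed
qed

lemma derivative_along_curve_zero:
  fixes \<alpha> :: "real \<Rightarrow> 'a::real_normed_vector"
  assumes "open W" "\<alpha> 0 \<in> W" "(\<alpha> has_vector_derivative v) (at 0)"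
    and "(H has_derivative H') (at (\<alpha> 0))" "\<And>x. x \<in> W \<Longrightarrow> x \<in> M \<Longrightarrow> H x = 0"
    and "0 < e" "\<alpha> ` {-e<..<e} \<subseteq> M"
  shows "H' v = 0"
proof -
  have "isCont \<alpha> 0" using assms(3) by (rule has_vector_derivative_continuous)
  then have "\<forall>\<^sub>F t in at 0. \<alpha> t \<in> W"
    using assms(1,2) by (auto simp: isCont_def topological_tendstoD)
  moreover have "\<forall>\<^sub>F t in at 0. t \<in> {-e<..<e}"
    using assms(6) by (intro eventually_at_in_open') auto
  ultimately have ev: "\<forall>\<^sub>F t in at 0. H (\<alpha> t) = 0"
    by eventually_elim (use assms(5,7) in \<open>simp add: image_subset_iff\<close>)
  have H0: "H (\<alpha> 0) = 0" using assms(2,5,6,7) by (simp add: image_subset_iff)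
  have lin: "linear H'" using has_derivative_linear[OF assms(4)] .
  have "((\<lambda>t. H (\<alpha> t)) has_derivative (\<lambda>r. H' (r *\<^sub>R v))) (at 0)"
    by (rule has_derivative_compose[OF assms(3)[unfolded has_vector_derivative_def] assms(4)])
  then have "((\<lambda>t. 0) has_derivative (\<lambda>r. H' (r *\<^sub>R v))) (at 0)"
    by (rule has_derivative_transform_eventually) (use ev H0 in auto)
  from has_derivative_unique[OF this has_derivative_const] have "H' (1 *\<^sub>R v) = 0"
    by metis
  then show ?thesis by simp
qed

lemma tangent_space_subspace:
  fixes P :: "'a::euclidean_space set"
  assumes "subspace P"
  shows "tangent_space P x \<subseteq> P"
proof
  interpret direct_sum P "orthogonal_comp P" by (rule direct_sum_orthogonal_comp[OF assms])
  fix v assume "v \<in> tangent_space P x"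
  then obtain \<alpha> e where "(\<alpha> has_vector_derivative v) (at 0)" "0 < e" "\<alpha> ` {-e<..<e} \<subseteq> P"
    by (auto simp: tangent_space_def curve_in_def)
  then have "comp_snd P (orthogonal_comp P) v = 0"
    by (intro derivative_along_curve_zero[of UNIV \<alpha> v sn sn P])
      (auto simp: sn_K intro: bounded_linear_imp_has_derivative bounded_linear_sn)
  then show "v \<in> P" using fs_plus_sn[of v] fs_in[of v] by simp
qed

text \<open>If \<open>M \<inter> P\<close> coincides near \<open>s p\<close> with the line spanned by \<open>p\<close>, the intersection being transverse,
  then \<open>M\<close> is near \<open>s p\<close> a graph over \<open>N + \<real>p\<close> with values in a complement \<open>R\<close> of the line in \<open>P\<close>.\<close>

lemma transverse_graph:
  fixes N P R M :: "'a::euclidean_space set"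
  assumes NP: "direct_sum N P" and p: "p \<in> P" "p \<notin> R"
    and R: "subspace R" "R \<subseteq> P" "\<And>x. x \<in> P \<Longrightarrow> \<exists>a. x - a *\<^sub>R p \<in> R"
    and M: "submanifold M" "transverse_at M P (s *\<^sub>R p)"
    and line: "0 < e" "\<And>t. \<bar>t - s\<bar> < e \<Longrightarrow> t *\<^sub>R p \<in> M"
    and inter: "open X" "s *\<^sub>R p \<in> X" "M \<inter> P \<inter> X \<subseteq> span {p}"
  defines "K \<equiv> N + span {p}"
  obtains W V \<Phi> where "direct_sum K R" "open W" "s *\<^sub>R p \<in> W" "open V" "s *\<^sub>R p \<in> V"
    "\<And>k. Ck_on k V \<Phi>" "\<Phi> (s *\<^sub>R p) = s *\<^sub>R p"
    "\<And>x. x \<in> W \<Longrightarrow> x \<in> M \<Longrightarrow> comp_fst K R x \<in> V \<and> \<Phi> (comp_fst K R x) = x"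
    "\<And>y. y \<in> V \<Longrightarrow> y \<in> K \<Longrightarrow> \<Phi> y \<in> M \<and> comp_fst K R (\<Phi> y) = y"
proof -
  interpret NP: direct_sum N P by fact
  define x0 where "x0 = s *\<^sub>R p"
  have x0M: "x0 \<in> M" unfolding x0_def using line by simp
  obtain W H H' where W: "open W" "x0 \<in> W" and Ck: "\<And>k. Ck_on k W (H :: 'a \<Rightarrow> 'a)"
    and H': "(H has_derivative H') (at x0)" and HW: "\<And>x. x \<in> W \<Longrightarrow> H x \<in> range H'"
    and HM: "\<And>x. x \<in> W \<Longrightarrow> x \<in> M \<longleftrightarrow> H x = 0"
    using submanifold_submersion[OF M(1) x0M] by blast
  have lin: "linear H'" using has_derivative_linear[OF H'] .
  have H0: "H x0 = 0" using HM W x0M by simp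
  define T where "T = {v. H' v = 0}"
  have subT: "subspace T" unfolding T_def by (rule linear_subspace_kernel[OF lin])
  have subP: "subspace P" and subN: "subspace N" using NP.subspaces by auto
  have "tangent_space M x0 \<subseteq> T"
  proof
    fix v assume "v \<in> tangent_space M x0"
    then obtain \<alpha> e where "\<alpha> 0 = x0" "(\<alpha> has_vector_derivative v) (at 0)" "0 < e" "\<alpha> ` {-e<..<e} \<subseteq> M"
      by (auto simp: tangent_space_def curve_in_def)
    then show "v \<in> T"
      unfolding T_def using W H' HM derivative_along_curve_zero[of W \<alpha> v H H' M e] by simp
  qed
  then have "UNIV \<subseteq> T + P"
    using M(2) tangent_space_subspace[OF subP] set_plus_mono2[of "tangent_space M x0" T "tangent_space P x0" P]
    unfolding transverse_at_def x0_def by simp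
  then have TP: "\<exists>t\<in>T. \<exists>u\<in>P. x = t + u" for x
    by (meson UNIV_I set_plus_elim subsetD)
  have pT: "p \<in> T"
  proof -
    have "((\<lambda>t. (s + t) *\<^sub>R p) has_vector_derivative p) (at 0)"
      by (auto intro!: derivative_eq_intros simp: has_vector_derivative_def)
    moreover have "(\<lambda>t. (s + t) *\<^sub>R p) ` {-e<..<e} \<subseteq> M" using line(2) by auto
    ultimately have "H' p = 0"
      using W H' HM line(1) by (intro derivative_along_curve_zero[of W "\<lambda>t. (s + t) *\<^sub>R p" p H H' M e])
        (auto simp: x0_def)
    then show ?thesis by (simp add: T_def)
  qed
  \<comment> \<open>\<open>M\<close> is a graph over \<open>N + T \<inter> P\<close> with values in a complement \<open>C \<subseteq> P\<close> of \<open>T \<inter> P\<close>. The point of \<open>M\<close>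
    above \<open>s p + t v\<close> with \<open>v \<in> T \<inter> P\<close> lies in \<open>P\<close>, therefore on the line, and so does \<open>v\<close>.\<close>
  have TP_span: "T \<inter> P \<subseteq> span {p}"
  proof
    fix v assume v: "v \<in> T \<inter> P"
    define Q where "Q = T \<inter> P"
    have subQ: "subspace Q" unfolding Q_def by (rule subspace_inter[OF subT subP])
    interpret Q: direct_sum Q "orthogonal_comp Q" by (rule direct_sum_orthogonal_comp[OF subQ])
    define C where "C = orthogonal_comp Q \<inter> P"
    have subC: "subspace C" unfolding C_def by (rule subspace_inter[OF Q.subspaces(2) subP])
    have dec: "\<exists>t\<in>Q. \<exists>c\<in>C. u = t + c" if "u \<in> P" for u
    proof (intro bexI)
      show "u = Q.fs u + Q.sn u" by (simp add: Q.fs_plus_sn)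
      have "Q.fs u \<in> P" using Q.fs_in Q_def by auto
      then show "Q.sn u \<in> C"
        unfolding C_def using Q.sn_in that subspace_diff[OF subP] by (simp add: comp_snd_def)
    qed (rule Q.fs_in)
    interpret KC: direct_sum "N + Q" C
    proof
      show "subspace (N + Q)" by (rule subspace_set_plus[OF subN subQ])
      show "subspace C" by fact
      show "(N + Q) \<inter> C = {0}"
      proof (intro equalityI subsetI)
        fix x assume x: "x \<in> (N + Q) \<inter> C"
        then obtain n t where nt: "n \<in> N" "t \<in> Q" "x = n + t" by (auto elim: set_plus_elim)
        have "x - t \<in> P" using x nt(2) by (intro subspace_diff[OF subP]) (auto simp: C_def Q_def)
        then have "n \<in> P" using nt(3) by simp
        then have "n = 0" using nt NP.inter by auto
        then show "x \<in> {0}" using x nt Q.inter by (auto simp: C_def)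
      qed (use subC subQ subN subspace_0 set_plus_intro[of 0 N 0 Q] in auto)
      show "N + Q + C = UNIV"
      proof (intro equalityI subsetI)
        fix x :: 'a
        obtain t c where tc: "t \<in> Q" "c \<in> C" "NP.sn x = t + c" using dec[OF NP.sn_in] by blast
        have "x = NP.fs x + t + c" using NP.fs_plus_sn[of x] tc(3) by (simp add: add.assoc)
        then show "x \<in> N + Q + C" using set_plus_intro[OF set_plus_intro[OF NP.fs_in tc(1)] tc(2)] by metis
      qed simp
    qed
    have QK: "x \<in> N + Q" if "x \<in> Q" for x
      using set_plus_intro[OF subspace_0[OF subN] that] by simp
    have pQ: "p \<in> Q" using pT p Q_def by simp
    then have x0Q: "x0 \<in> Q" unfolding x0_def by (rule subspace_scale[OF subQ])
    have fs0: "KC.fs x0 = x0" using KC.fs_K QK x0Q by blast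
    have surj: "range H' \<subseteq> H' ` C"
    proof
      fix y assume "y \<in> range H'"
      then obtain x where x: "y = H' x" by blast
      obtain t u where "t \<in> T" "u \<in> P" "x = t + u" using TP by blast
      moreover obtain t' c where "t' \<in> Q" "c \<in> C" "u = t' + c" using dec \<open>u \<in> P\<close> by blast
      ultimately have "y = H' c" using x by (simp add: linear_add[OF lin] T_def Q_def)
      then show "y \<in> H' ` C" using \<open>c \<in> C\<close> by blast
    qed
    have injC: "c = 0" if "c \<in> C" "H' c = 0" for c
      using that Q.inter by (auto simp: C_def Q_def T_def)
    obtain W' V \<Phi> where 1: "open W'" "x0 \<in> W'" "W' \<subseteq> W" "open V" "KC.fs x0 \<in> V"
      "\<And>k. Ck_on k V \<Phi>" "\<Phi> (KC.fs x0) = x0"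
      "\<And>x. x \<in> W' \<Longrightarrow> H x = 0 \<Longrightarrow> KC.fs x \<in> V \<and> \<Phi> (KC.fs x) = x"
      "\<And>y. y \<in> V \<Longrightarrow> y \<in> N + Q \<Longrightarrow> \<Phi> y \<in> W' \<and> H (\<Phi> y) = 0 \<and> KC.fs (\<Phi> y) = y"
      using implicit_graph[OF KC.direct_sum_axioms W Ck HW H' injC surj H0] by blast
    have "open (V \<inter> \<Phi> -` X)"
      by (rule continuous_open_preimage[OF Ck_on_imp_continuous_on[OF 1(6)] 1(4) inter(1)])
    moreover have "x0 \<in> V \<inter> \<Phi> -` X" using 1(5,7) inter(2) unfolding fs0 x0_def[symmetric] by simp
    ultimately have "\<forall>\<^sub>F y in nhds x0. y \<in> V \<inter> \<Phi> -` X" by (rule eventually_nhds_in_open)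
    moreover have "((\<lambda>t. x0 + t *\<^sub>R v) \<longlongrightarrow> x0) (at_right 0)"
    proof -
      have "((\<lambda>t. x0 + t *\<^sub>R v) \<longlongrightarrow> x0 + 0 *\<^sub>R v) (at_right 0)" by (intro tendsto_intros)
      then show ?thesis by simp
    qed
    ultimately have "\<forall>\<^sub>F t in at_right 0. x0 + t *\<^sub>R v \<in> V \<inter> \<Phi> -` X"
      by (rule eventually_compose_filterlim)
    from eventually_happens'[OF trivial_limit_at_right_real eventually_conj[OF eventually_at_right_less[of 0] this]]
    obtain t :: real where t: "t > 0" "\<Phi> (x0 + t *\<^sub>R v) \<in> X" "x0 + t *\<^sub>R v \<in> V"
      by auto
    define y where "y = x0 + t *\<^sub>R v"
    have yQ: "y \<in> Q" unfolding y_def using v x0Q by (intro subspace_add subspace_scale subQ) (auto simp: Q_def)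
    have \<Phi>y: "\<Phi> y \<in> M" "KC.fs (\<Phi> y) = y" using 1(3) 1(9)[OF _ QK[OF yQ]] t(3) HM unfolding y_def by auto
    then have "\<Phi> y = y + KC.sn (\<Phi> y)" using KC.fs_plus_sn[of "\<Phi> y"] by simp
    moreover have "y + KC.sn (\<Phi> y) \<in> P" 
      using KC.sn_in[of "\<Phi> y"] yQ by (intro subspace_add[OF subP]) (auto simp: C_def Q_def)
    ultimately have "\<Phi> y \<in> P" by simp
    then have "\<Phi> y \<in> span {p}" using \<Phi>y(1) t(2) inter(3) unfolding y_def by blast
    then obtain a where a: "\<Phi> y = a *\<^sub>R p" by (auto simp: span_singleton)
    then have "y = a *\<^sub>R p" using \<Phi>y(2) KC.fs_K[OF QK[OF subspace_scale[OF subQ pQ]], of a] by simp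
    then have "t *\<^sub>R v = (a - s) *\<^sub>R p" by (simp add: y_def x0_def algebra_simps)
    from arg_cong[OF this, of "scaleR (inverse t)"] have "v = (inverse t * (a - s)) *\<^sub>R p"
      using t(1) by simp
    then show "v \<in> span {p}" by (auto simp: span_singleton)
  qed
  have pR: "a = 0" if "a *\<^sub>R p \<in> R" for a
    using p(2) subspace_scale[OF R(1) that, of "inverse a"] by (cases "a = 0") auto
  interpret KR: direct_sum K R
  proof
    show "subspace K" unfolding K_def by (rule subspace_set_plus[OF subN subspace_span])
    show "subspace R" by fact
    show "K \<inter> R = {0}"
    proof (intro equalityI subsetI)
      fix x assume x: "x \<in> K \<inter> R"
      then obtain n a where nt: "n \<in> N" "x = n + a *\<^sub>R p" by (auto simp: K_def span_singleton elim!: set_plus_elim)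
      have "x - a *\<^sub>R p \<in> P" using x p(1) R(2) by (intro subspace_diff[OF subP] subspace_scale[OF subP]) auto
      then have "n \<in> P" using nt(2) by simp
      then have "n = 0" using nt NP.inter by auto
      then show "x \<in> {0}" using x nt pR by auto
    qed (use subspace_0[OF R(1)] subspace_0[OF subN] set_plus_intro[of 0 N 0 "span {p}"] span_0 in \<open>auto simp: K_def\<close>)
    show "K + R = UNIV"
    proof (intro equalityI subsetI)
      fix x :: 'a
      obtain a where a: "NP.sn x - a *\<^sub>R p \<in> R" using R(3)[OF NP.sn_in] by blast
      have "x = (NP.fs x + a *\<^sub>R p) + (NP.sn x - a *\<^sub>R p)" using NP.fs_plus_sn[of x] by simp
      moreover have "NP.fs x + a *\<^sub>R p \<in> K"
        unfolding K_def by (intro set_plus_intro NP.fs_in) (auto simp: span_singleton)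
      ultimately show "x \<in> K + R" using set_plus_intro a by metis
    qed simp
  qed
  have x0K: "x0 \<in> K" unfolding K_def x0_def
    using set_plus_intro[OF subspace_0[OF subN], of "s *\<^sub>R p" "span {p}"] by (auto simp: span_singleton)
  have fs0: "KR.fs x0 = x0" using KR.fs_K[OF x0K] .
  have surj: "range H' \<subseteq> H' ` R"
  proof
    fix y assume "y \<in> range H'"
    then obtain x where x: "y = H' x" by blast
    obtain t u where tu: "t \<in> T" "u \<in> P" "x = t + u" using TP by blast
    obtain a where a: "u - a *\<^sub>R p \<in> R" using R(3)[OF tu(2)] by blast
    have "H' (u - a *\<^sub>R p) = H' u"
      using pT by (simp add: linear_diff[OF lin] linear_cmul[OF lin] T_def)
    then have "y = H' (u - a *\<^sub>R p)" using x tu by (simp add: linear_add[OF lin] T_def)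
    then show "y \<in> H' ` R" using a by blast
  qed
  have injR: "c = 0" if "c \<in> R" "H' c = 0" for c
  proof -
    have "c \<in> span {p}" using that R(2) TP_span by (auto simp: T_def)
    then show ?thesis using that(1) pR by (auto simp: span_singleton)
  qed
  obtain W' V \<Phi> where 1: "open W'" "x0 \<in> W'" "W' \<subseteq> W" "open V" "KR.fs x0 \<in> V"
    "\<And>k. Ck_on k V \<Phi>" "\<Phi> (KR.fs x0) = x0"
    "\<And>x. x \<in> W' \<Longrightarrow> H x = 0 \<Longrightarrow> KR.fs x \<in> V \<and> \<Phi> (KR.fs x) = x"
    "\<And>y. y \<in> V \<Longrightarrow> y \<in> K \<Longrightarrow> \<Phi> y \<in> W' \<and> H (\<Phi> y) = 0 \<and> KR.fs (\<Phi> y) = y"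
    using implicit_graph[OF KR.direct_sum_axioms W Ck HW H' injR surj H0] by blast
  show thesis
  proof (rule that[of W' V \<Phi>, OF KR.direct_sum_axioms, folded x0_def, OF 1(1,2,4) _ 1(6)])
    show "x0 \<in> V" "\<Phi> x0 = x0" using 1(5,7) by (simp_all add: fs0)
    show "KR.fs x \<in> V \<and> \<Phi> (KR.fs x) = x" if "x \<in> W'" "x \<in> M" for x
      using 1(3,8) that HM by blast
    show "\<Phi> y \<in> M \<and> KR.fs (\<Phi> y) = y" if "y \<in> V" "y \<in> K" for y
      using 1(3) 1(9)[OF that] HM by blast
  qed
qed

section \<open>The Hessian is a quadratic form\<close>

text \<open>The bilinear form is half of the symmetrized second derivative at \<open>0\<close>; the symmetry of the second
  derivative itself is not needed.\<close>

lemma quadratic_if_homogeneous_C2: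
  fixes q :: "'a::euclidean_space \<Rightarrow> real"
  assumes "open U" "0 \<in> U" "Ck_on (Suc (Suc 0)) U q"
    and hom: "\<And>t v. q (t *\<^sub>R v) = t\<^sup>2 * q v"
  obtains B where "bounded_bilinear B" "\<And>u v. B u v = B v u" "\<And>v. q v = B v v"
proof -
  define D where "D x v = frechet_derivative q (at x) v" for x v
  define E where "E v w = frechet_derivative (\<lambda>x. D x v) (at 0) w" for v w
  have D: "(q has_derivative D x) (at x)" if "x \<in> U" for x
    unfolding D_def[abs_def] by (rule Ck_on_Suc_has_derivative[OF assms(3) that])
  have E: "((\<lambda>x. D x v) has_derivative E v) (at 0)" for v
    unfolding E_def[abs_def]
    by (rule Ck_on_Suc_has_derivative[OF _ assms(2), of 0]) (use assms(3) in \<open>simp add: D_def\<close>)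
  have linD: "linear (D x)" if "x \<in> U" for x
    using has_derivative_linear[OF D[OF that]] .
  have linE: "linear (E v)" for v using has_derivative_linear[OF E] .
  have E_add: "E (u + v) w = E u w + E v w" for u v w
  proof -
    have "((\<lambda>x. D x (u + v)) has_derivative (\<lambda>w. E u w + E v w)) (at 0)"
      by (rule has_derivative_transform_within_open[OF has_derivative_add[OF E E] assms(1,2)])
        (simp add: linear_add[OF linD])
    from has_derivative_unique[OF E this] show ?thesis by (rule fun_cong)
  qed
  have E_scale: "E (r *\<^sub>R v) w = r * E v w" for r v w
  proof -
    have "((\<lambda>x. D x (r *\<^sub>R v)) has_derivative (\<lambda>w. r * E v w)) (at 0)"
      by (rule has_derivative_transform_within_open[OF has_derivative_mult_right[OF E] assms(1,2)])
        (simp add: linear_cmul[OF linD])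
    from has_derivative_unique[OF E this] show ?thesis by (rule fun_cong)
  qed
  have E_diag: "E v v = 2 * q v" for v
  proof -
    have "((\<lambda>t. t *\<^sub>R v) \<longlongrightarrow> 0 *\<^sub>R v) (nhds 0)"
      by (intro tendsto_intros filterlim_ident)
    then have "\<forall>\<^sub>F t in nhds 0. t *\<^sub>R v \<in> U"
      using topological_tendstoD[OF _ assms(1), of "\<lambda>t. t *\<^sub>R v" 0] assms(2) by simp
    then have "\<forall>\<^sub>F t in nhds 0. D (t *\<^sub>R v) v = 2 * t * q v"
    proof eventually_elim
      case (elim t)
      have "((\<lambda>t. q (t *\<^sub>R v)) has_derivative (\<lambda>r. D (t *\<^sub>R v) (r *\<^sub>R v))) (at t)"
        by (rule has_derivative_compose[of "\<lambda>t. t *\<^sub>R v" "\<lambda>r. r *\<^sub>R v" t UNIV q "D (t *\<^sub>R v)"])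
          (auto intro: bounded_linear_imp_has_derivative bounded_linear_scaleR_left D elim)
      moreover have "((\<lambda>t. q (t *\<^sub>R v)) has_derivative (\<lambda>r. r * (2 * t * q v))) (at t)"
        unfolding hom by (auto intro!: derivative_eq_intros)
      ultimately have "(\<lambda>r. D (t *\<^sub>R v) (r *\<^sub>R v)) = (\<lambda>r. r * (2 * t * q v))"
        by (rule has_derivative_unique)
      from fun_cong[OF this, of 1] show ?case by simp
    qed
    moreover have "((\<lambda>t. D (t *\<^sub>R v) v) has_derivative (\<lambda>r. E v (r *\<^sub>R v))) (at 0)"
      by (rule has_derivative_compose[of "\<lambda>t. t *\<^sub>R v" "\<lambda>r. r *\<^sub>R v" 0 UNIV "\<lambda>x. D x v" "E v"])
        (auto intro: bounded_linear_imp_has_derivative bounded_linear_scaleR_left simp: E)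
    ultimately have "((\<lambda>t. 2 * t * q v) has_derivative (\<lambda>r. E v (r *\<^sub>R v))) (at 0)"
      by (elim has_derivative_transform_eventually)
        (auto simp: eventually_nhds_conv_at)
    moreover have "((\<lambda>t. 2 * t * q v) has_derivative (\<lambda>r. 2 * r * q v)) (at 0)"
      by (auto intro!: derivative_eq_intros)
    ultimately have "(\<lambda>r. E v (r *\<^sub>R v)) = (\<lambda>r. 2 * r * q v)" by (rule has_derivative_unique)
    from fun_cong[OF this, of 1] show ?thesis by simp
  qed
  define B where "B u v = (E u v + E v u) / 4" for u v
  have "bilinear B"
    unfolding bilinear_def B_def
    by (auto intro!: linearI simp: E_add E_scale linear_add[OF linE] linear_cmul[OF linE] field_simps)
  then have "bounded_bilinear B" by (simp add: bilinear_conv_bounded_bilinear)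
  then show thesis
    by (rule that) (simp_all add: B_def E_diag add.commute)
qed

lemma smooth_on_cmult:
  fixes g :: "'a::euclidean_space \<Rightarrow> real"
  assumes "smooth_on S g"
  shows "smooth_on S (\<lambda>x. a * g x)"
  unfolding smooth_on_def
proof
  fix x assume "x \<in> S"
  from assms[unfolded smooth_on_def, rule_format, OF this] obtain W h where
    W: "open W" "x \<in> W" "\<forall>k. Ck_on k W h" "\<forall>y\<in>S \<inter> W. h y = g y" by auto
  have "\<forall>k. Ck_on k W (\<lambda>x. a * h x)"
    using W(3) by (intro allI Ck_on_bounded_linear[OF bounded_linear_mult_right W(1)]) simp
  then show "\<exists>W h. open W \<and> x \<in> W \<and> (\<forall>k. Ck_on k W h) \<and> (\<forall>y\<in>S \<inter> W. h y = a * g y)"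
    using W by (intro exI[of _ W] exI[of _ "\<lambda>x. a * h x"]) simp
qed

lemma smooth_fun_on_cmult:
  fixes g :: "'v::topological_space \<Rightarrow> real"
  assumes "smooth_fun_on A W g"
  shows "smooth_fun_on A W (\<lambda>x. a * g x)"
  unfolding smooth_fun_on_def
proof (intro ballI, clarify)
  fix D \<phi> assume "(D, \<phi>) \<in> A"
  then have "smooth_on (\<phi> ` (D \<inter> W)) (g \<circ> inv_into D \<phi>)"
    using assms unfolding smooth_fun_on_def by blast
  from smooth_on_cmult[OF this, of a] show "smooth_on (\<phi> ` (D \<inter> W)) ((\<lambda>x. a * g x) \<circ> inv_into D \<phi>)"
    by (simp add: comp_def)
qed

lemma smooth_fun_on_subset:
  assumes "smooth_fun_on A W g" "W' \<subseteq> W"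
  shows "smooth_fun_on A W' g"
  unfolding smooth_fun_on_def
proof (intro ballI, clarify)
  fix D \<phi> assume "(D, \<phi>) \<in> A"
  then have "smooth_on (\<phi> ` (D \<inter> W)) (g \<circ> inv_into D \<phi>)"
    using assms(1) by (auto simp: smooth_fun_on_def)
  then show "smooth_on (\<phi> ` (D \<inter> W')) (g \<circ> inv_into D \<phi>)"
    by (rule smooth_on_subset) (use assms(2) in auto)
qed

lemma tangent_vectorsD:
  assumes "X \<in> tangent_vectors A x" "smooth_near A x g" "smooth_near A x h"
  shows "(\<forall>\<^sub>F y in nhds x. g y = h y) \<longrightarrow> X g = X h"
    and "\<forall>a b. X (\<lambda>y. a * g y + b * h y) = a * X g + b * X h"
    and "X (\<lambda>y. g y * h y) = g x * X h + h x * X g"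
proof -
  note * = assms(1)[unfolded tangent_vectors_def mem_Collect_eq, THEN conjunct2, THEN spec, THEN spec,
      THEN mp, OF conjI[OF assms(2,3)]]
  show "(\<forall>\<^sub>F y in nhds x. g y = h y) \<longrightarrow> X g = X h" by (rule *[THEN conjunct1])
  show "\<forall>a b. X (\<lambda>y. a * g y + b * h y) = a * X g + b * X h" by (rule *[THEN conjunct2, THEN conjunct1])
  show "X (\<lambda>y. g y * h y) = g x * X h + h x * X g" by (rule *[THEN conjunct2, THEN conjunct2])
qed

lemma tangent_vectors_scale:
  assumes "X \<in> tangent_vectors A x"
  shows "(\<lambda>g. a * X g) \<in> tangent_vectors A x"
  unfolding tangent_vectors_def mem_Collect_eq
proof (intro conjI allI impI; (elim conjE)?)
  fix g assume "\<not> smooth_near A x g"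
  then have "X g = 0"
    using assms[unfolded tangent_vectors_def mem_Collect_eq, THEN conjunct1] by (elim allE[of _ g]) simp
  then show "a * X g = 0" by simp
next
  fix g h assume gh: "smooth_near A x g" "smooth_near A x h"
  note * = tangent_vectorsD[OF assms gh]
  show "a * X (\<lambda>y. g y * h y) = g x * (a * X h) + h x * (a * X g)"
    unfolding *(3) by (simp add: algebra_simps)
  show "a * X (\<lambda>y. a' * g y + b * h y) = a' * (a * X g) + b * (a * X h)" for a' b
    unfolding *(2)[rule_format] by (simp add: algebra_simps)
  assume "\<forall>\<^sub>F y in nhds x. g y = h y"
  then show "a * X g = a * X h" using *(1) by simp
qed

lemma tangent_vectors_cmult:
  assumes "X \<in> tangent_vectors A x" "smooth_near A x g"
  shows "X (\<lambda>y. a * g y) = a * X g"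
  using tangent_vectorsD(2)[OF assms assms(2), rule_format, of a 0] by simp

lemma local_vector_field_scale:
  assumes "local_vector_field A x Y"
  shows "local_vector_field A x (\<lambda>y g. a * Y y g)"
proof -
  obtain W where W: "open W" "x \<in> W" "\<forall>y\<in>W. Y y \<in> tangent_vectors A y"
    "\<forall>W' g. open W' \<and> W' \<subseteq> W \<and> smooth_fun_on A W' g \<longrightarrow> smooth_fun_on A W' (\<lambda>y. Y y g)"
    using assms unfolding local_vector_field_def by (elim exE conjE)
  show ?thesis
    unfolding local_vector_field_def
    by (intro exI[of _ W] conjI W(1,2) ballI tangent_vectors_scale allI impI smooth_fun_on_cmult)
      (use W(3,4) in auto)
qed

lemma smooth_near_local_vector_field:
  assumes "local_vector_field A x Y" "smooth_fun_on A UNIV f"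
  shows "smooth_near A x (\<lambda>y. Y y f)"
proof -
  obtain W where W: "open W" "x \<in> W"
    "\<forall>W' g. open W' \<and> W' \<subseteq> W \<and> smooth_fun_on A W' g \<longrightarrow> smooth_fun_on A W' (\<lambda>y. Y y g)"
    using assms(1) unfolding local_vector_field_def by (elim exE conjE)
  have "smooth_fun_on A W f" by (rule smooth_fun_on_subset[OF assms(2)]) simp
  then have "smooth_fun_on A W (\<lambda>y. Y y f)" using W(1,3) by simp
  then show ?thesis unfolding smooth_near_def using W(1,2) by blast
qed

text \<open>The second alternative covers the case in which the number described by \<open>hessian_form\<close> does not
  exist or is not unique. Then all numbers or none satisfy the description, at every nonzero
  multiple of \<open>X\<close>, so that the default value is constant along the line through \<open>X\<close>
  without \<open>0\<close>.\<close>

lemma hessian_form_scale: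
  fixes A :: "('v::topological_space, 'e::euclidean_space) chart set"
  assumes "smooth_fun_on A UNIV f" and X: "X \<in> tangent_vectors A c"
  shows "(\<forall>t. t \<noteq> 0 \<longrightarrow> hessian_form A f c (\<lambda>g. t * X g) = t\<^sup>2 * hessian_form A f c X) \<or>
    (\<forall>t. t \<noteq> 0 \<longrightarrow> hessian_form A f c (\<lambda>g. t * X g) = hessian_form A f c X)"
proof -
  define S where "S X = {r. \<forall>Y. local_vector_field A c Y \<and> Y c = X \<longrightarrow> r = X (\<lambda>y. Y y f) / 2}" for X
  have hess: "hessian_form A f c X = (THE r. r \<in> S X)" for X
    by (simp add: hessian_form_def S_def)
  have scale: "t\<^sup>2 * r \<in> S (\<lambda>g. t * X g)" if "r \<in> S X" "t \<noteq> 0" "X \<in> tangent_vectors A c" for r t X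
    unfolding S_def
  proof (clarify)
    fix Y assume Y: "local_vector_field A c Y" "Y c = (\<lambda>g. t * X g)"
    have "r = X (\<lambda>y. (1 / t) * Y y f) / 2"
      using that(1,2) Y(2) local_vector_field_scale[OF Y(1), of "1 / t"] by (auto simp: S_def)
    also have "\<dots> = (1 / t) * X (\<lambda>y. Y y f) / 2"
      using tangent_vectors_cmult[OF that(3) smooth_near_local_vector_field[OF Y(1) assms(1)], of "1 / t"] by simp
    finally show "t\<^sup>2 * r = t * X (\<lambda>y. Y y f) / 2"
      using that(2) by (simp add: power2_eq_square)
  qed
  have scale_iff: "t\<^sup>2 * r \<in> S (\<lambda>g. t * X g) \<longleftrightarrow> r \<in> S X" if "t \<noteq> 0" for r t
  proof
    assume "t\<^sup>2 * r \<in> S (\<lambda>g. t * X g)"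
    from scale[OF this _ tangent_vectors_scale[OF X], of "1 / t"] that show "r \<in> S X"
      by (simp add: power_divide)
  qed (use scale that X in blast)
  consider r where "S X = {r}" | "S X = {}" | "S X = UNIV"
  proof -
    have "S X = UNIV" if "r1 \<in> S X" "r2 \<in> S X" "r1 \<noteq> r2" for r1 r2
    proof -
      have "\<not> (local_vector_field A c Y \<and> Y c = X)" for Y
        using that unfolding S_def by blast
      then show ?thesis unfolding S_def by blast
    qed
    then show thesis using that by blast
  qed
  then show ?thesis
  proof cases
    case 1
    have "S (\<lambda>g. t * X g) = {t\<^sup>2 * r}" if "t \<noteq> 0" for t
    proof (intro equalityI subsetI)
      fix x assume "x \<in> S (\<lambda>g. t * X g)"
      then have "x / t\<^sup>2 \<in> S X" using scale_iff[OF that, of "x / t\<^sup>2"] that by simp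
      then show "x \<in> {t\<^sup>2 * r}" using 1 that by (auto simp: field_simps)
    qed (use scale_iff[OF that] 1 in auto)
    then show ?thesis using 1 by (simp add: hess)
  next
    case 2
    have "S (\<lambda>g. t * X g) = {}" if "t \<noteq> 0" for t
    proof -
      have "x \<notin> S (\<lambda>g. t * X g)" for x using scale_iff[OF that, of "x / t\<^sup>2"] that 2 by simp
      then show ?thesis by blast
    qed
    then show ?thesis using 2 by (simp add: hess)
  next
    case 3
    have "S (\<lambda>g. t * X g) = UNIV" if "t \<noteq> 0" for t
    proof -
      have "x \<in> S (\<lambda>g. t * X g)" for x using scale_iff[OF that, of "x / t\<^sup>2"] that 3 by simp
      then show ?thesis by blast
    qed
    then show ?thesis using 3 by (simp add: hess)
  qed
qed

lemma morse_parametrization_smooth: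
  fixes A :: "('v::{t2_space, second_countable_topology}, 'e::euclidean_space) chart set"
  assumes "smooth_manifold A" "smooth_fun_on A UNIV (f :: 'v \<Rightarrow> real)" "diffeomorphism_into A U \<psi>" "x \<in> U"
  obtains U' where "open U'" "x \<in> U'" "U' \<subseteq> U" "\<And>k. Ck_on k U' (\<lambda>u. f (\<psi> u))"
proof -
  have "(\<Union>(D, \<phi>)\<in>A. D) = UNIV"
    using assms(1) unfolding smooth_manifold_def by (rule conjunct1)
  then have "\<psi> x \<in> (\<Union>(D, \<phi>)\<in>A. D)" by simp
  then obtain D \<phi> where D: "(D, \<phi>) \<in> A" "\<psi> x \<in> D" by auto
  have ch: "open D" "open (\<phi> ` D)" "homeomorphism D (\<phi> ` D) \<phi> (inv_into D \<phi>)"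
    using assms(1)[unfolded smooth_manifold_def, THEN conjunct2, THEN conjunct1, THEN bspec, OF D(1)]
    by simp_all
  note di = assms(3)[unfolded diffeomorphism_into_def]
  have U: "open U" "continuous_on U \<psi>"
    using di[THEN conjunct1] di[THEN conjunct2, THEN conjunct2, THEN conjunct1]
    by (simp_all add: homeomorphism_def)
  have U3: "smooth_on (U \<inter> \<psi> -` D) (\<phi> \<circ> \<psi>)"
    using di[THEN conjunct2, THEN conjunct2, THEN conjunct2, THEN conjunct1, THEN bspec, OF D(1)]
    by simp
  have op: "open (U \<inter> \<psi> -` D)" by (rule continuous_open_preimage[OF U(2,1) ch(1)])
  have 1: "Ck_on k (U \<inter> \<psi> -` D) (\<phi> \<circ> \<psi>)" for k
    using U3 smooth_on_open_iff[OF op] by blast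
  have "smooth_on (\<phi> ` (D \<inter> UNIV)) (f \<circ> inv_into D \<phi>)"
    using assms(2)[unfolded smooth_fun_on_def, THEN bspec, OF D(1)] by simp
  then have 2: "Ck_on k (\<phi> ` D) (f \<circ> inv_into D \<phi>)" for k
    unfolding Int_UNIV_right smooth_on_open_iff[OF ch(2)] by blast
  have 3: "Ck_on k (U \<inter> \<psi> -` D) (\<lambda>u. (f \<circ> inv_into D \<phi>) ((\<phi> \<circ> \<psi>) u))" for k
    by (rule Ck_on_compose[OF op _ 1 2]) auto
  have "inv_into D \<phi> (\<phi> y) = y" if "y \<in> D" for y
    using ch(3) that by (simp add: homeomorphism_def)
  then have "Ck_on k (U \<inter> \<psi> -` D) (\<lambda>u. f (\<psi> u))" for k
    by (intro Ck_on_cong[OF op _ 3]) simp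
  then show thesis using that[OF op] assms(4) D(2) by simp
qed

text \<open>The Hessian is homogeneous of degree \<open>2\<close> in both cases of \<open>hessian_form_scale\<close>: in the second one
  it vanishes on the line, being constant there and continuous at \<open>0\<close> with value \<open>0\<close>. It is smooth
  near \<open>0\<close> because \<open>f \<circ> \<psi>\<close> is.\<close>

lemma morse_hessian_quadratic:
  fixes A :: "('v::{t2_space, second_countable_topology}, 'e::euclidean_space) chart set"
  assumes "smooth_manifold A" and f: "smooth_fun_on A UNIV f" and \<iota>: "tangent_identification A c \<iota>"
    and U: "diffeomorphism_into A U \<psi>" "0 \<in> U" "\<psi> 0 = c"
    and hess: "\<And>u. u \<in> U \<Longrightarrow> f (\<psi> u) - f c = hessian_form A f c (\<iota> u)"
  obtains B where "bounded_bilinear B" "\<And>u v. B u v = B v u"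
    "\<And>v. hessian_form A f c (\<iota> v) = B v v"
proof -
  define q where "q v = hessian_form A f c (\<iota> v)" for v
  obtain U' where U': "open U'" "0 \<in> U'" "U' \<subseteq> U" "\<And>k. Ck_on k U' (\<lambda>u. f (\<psi> u))"
    using morse_parametrization_smooth[OF assms(1) f U(1,2)] by blast
  have qC: "Ck_on k U' q" for k
  proof (rule Ck_on_cong[OF U'(1)])
    show "Ck_on k U' (\<lambda>u. f (\<psi> u) - f c)" by (intro Ck_on_diff[OF U'(1)] U'(4) Ck_on_const[OF U'(1)])
  qed (use hess U'(3) in \<open>auto simp: q_def\<close>)
  have q0: "q 0 = 0" using hess[OF U(2)] U(3) by (simp add: q_def)
  have "isCont q 0"
    using Ck_on_imp_continuous_on[OF qC] U'(2) unfolding continuous_on_eq_continuous_at[OF U'(1)] by blast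
  then have lim: "((\<lambda>t. q (t *\<^sub>R v)) \<longlongrightarrow> 0) (at 0)" for v
  proof -
    have "isCont (\<lambda>t. q (t *\<^sub>R v)) 0"
      by (rule isCont_o2[of 0 "\<lambda>t. t *\<^sub>R v" q]) (use \<open>isCont q 0\<close> in auto)
    then show ?thesis by (simp add: isCont_def q0)
  qed
  have hom: "q (t *\<^sub>R v) = t\<^sup>2 * q v" for t v
  proof (cases "t = 0")
    case False
    have "\<iota> v \<in> tangent_vectors A c"
      using \<iota> unfolding tangent_identification_def bij_betw_def by blast
    moreover have \<iota>t: "\<iota> (t *\<^sub>R v) = (\<lambda>g. t * \<iota> v g)" for t
    proof
      fix g
      have "\<iota> (t *\<^sub>R v + 0 *\<^sub>R v) g = t * \<iota> v g + 0 * \<iota> v g"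
        using \<iota> unfolding tangent_identification_def by blast
      then show "\<iota> (t *\<^sub>R v) g = t * \<iota> v g" by simp
    qed
    ultimately have "(\<forall>t. t \<noteq> 0 \<longrightarrow> q (t *\<^sub>R v) = t\<^sup>2 * q v) \<or> (\<forall>t. t \<noteq> 0 \<longrightarrow> q (t *\<^sub>R v) = q v)"
      using hessian_form_scale[OF f, of "\<iota> v" c] unfolding q_def by simp
    then show ?thesis
    proof
      assume const: "\<forall>t. t \<noteq> 0 \<longrightarrow> q (t *\<^sub>R v) = q v"
      then have "\<forall>\<^sub>F t in at 0. q (t *\<^sub>R v) = q v" by (simp add: eventually_at_filter)
      with lim[of v] have "((\<lambda>t::real. q v) \<longlongrightarrow> 0) (at 0)"
        by (rule Lim_transform_eventually)
      then have "q v = 0" by (simp add: tendsto_const_iff)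
      then show ?thesis using const False by simp
    qed (use False in blast)
  qed (simp add: q0)
  show thesis
    using quadratic_if_homogeneous_C2[OF U'(1,2) qC hom] that unfolding q_def by blast
qed

section \<open>The positive definite form of a splitting\<close>

lemma polar_form_bilinear:
  assumes "bounded_bilinear b" "\<And>u v. b u v = b v u"
  shows "polar_form (\<lambda>v. b v v) u v = b u v"
  by (simp add: polar_form_def bounded_bilinear.add_left[OF assms(1)]
      bounded_bilinear.add_right[OF assms(1)] assms(2)[of v u])

lemma positive_definite_lower_bound:
  fixes b :: "'a::euclidean_space \<Rightarrow> 'a \<Rightarrow> real"
  assumes b: "bounded_bilinear b" and pos: "\<And>u. u \<noteq> 0 \<Longrightarrow> 0 < b u u"
  obtains c where "0 < c" "\<And>u. c * (norm u)\<^sup>2 \<le> b u u"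
proof -
  have "continuous_on (sphere 0 1) (\<lambda>u. b u u)"
    by (intro bounded_bilinear.continuous_on[OF b] continuous_on_id)
  moreover have "(SOME i. i \<in> Basis) \<in> sphere (0::'a) 1"
    by (simp add: SOME_Basis)
  ultimately obtain w where w: "w \<in> sphere 0 1" "\<And>u. u \<in> sphere 0 1 \<Longrightarrow> b w w \<le> b u u"
    using continuous_attains_inf[OF compact_sphere, of 0 1 "\<lambda>u. b u u"] by blast
  show thesis
  proof (rule that[of "b w w"])
    show "0 < b w w" using w(1) by (intro pos) auto
    show "b w w * (norm u)\<^sup>2 \<le> b u u" for u
    proof (cases "u = 0")
      case False
      have "b w w \<le> b (u /\<^sub>R norm u) (u /\<^sub>R norm u)" using False by (intro w(2)) simp
      also have "\<dots> = b u u / (norm u)\<^sup>2"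
        by (simp add: bounded_bilinear.scaleR_left[OF b] bounded_bilinear.scaleR_right[OF b]
            power2_eq_square divide_inverse)
      finally show ?thesis using False by (simp add: field_simps)
    qed (simp add: bounded_bilinear.zero_left[OF b])
  qed
qed

text \<open>A Morse splitting for the quadratic form \<open>\<lambda>v. B v v\<close>.\<close>

locale split_form = direct_sum N P for N P :: "'e::euclidean_space set" +
  fixes B :: "'e \<Rightarrow> 'e \<Rightarrow> real"
  assumes bilinear: "bounded_bilinear B" and sym: "B u v = B v u"
    and orth: "\<And>n p. n \<in> N \<Longrightarrow> p \<in> P \<Longrightarrow> B n p = 0"
    and neg: "\<And>n. n \<in> N \<Longrightarrow> n \<noteq> 0 \<Longrightarrow> B n n < 0"
    and pos: "\<And>p. p \<in> P \<Longrightarrow> p \<noteq> 0 \<Longrightarrow> 0 < B p p"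
begin

text \<open>The bilinear form of \<open>\<mu> = (- q|N) \<oplus> q|P\<close>.\<close>

definition m :: "'e \<Rightarrow> 'e \<Rightarrow> real" where
  "m u v = - B (fs u) (fs v) + B (sn u) (sn v)"

lemma mu_form_eq: "mu_form (\<lambda>v. B v v) N P u = m u u"
  by (simp add: mu_form_def m_def)

lemma bilinear_m: "bounded_bilinear m"
proof -
  have "bilinear m"
    unfolding bilinear_def m_def
    by (auto intro!: linearI simp: linear_add[OF linear_fs] linear_cmul[OF linear_fs]
        linear_add[OF linear_sn] linear_cmul[OF linear_sn] algebra_simps
        bounded_bilinear.add_left[OF bilinear] bounded_bilinear.add_right[OF bilinear]
        bounded_bilinear.scaleR_left[OF bilinear] bounded_bilinear.scaleR_right[OF bilinear])
  then show ?thesis by (simp add: bilinear_conv_bounded_bilinear)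
qed

lemma m_sym: "m u v = m v u"
  by (simp add: m_def sym[of "fs v"] sym[of "sn v"])

lemma polar_mu: "polar_form (mu_form (\<lambda>v. B v v) N P) u v = m u v"
proof -
  have "mu_form (\<lambda>v. B v v) N P = (\<lambda>u. m u u)" by (rule ext) (rule mu_form_eq)
  then show ?thesis using polar_form_bilinear[OF bilinear_m m_sym] by simp
qed

lemmas m_add_left = bounded_bilinear.add_left[OF bilinear_m]
lemmas m_add_right = bounded_bilinear.add_right[OF bilinear_m]
lemmas m_scaleR_left = bounded_bilinear.scaleR_left[OF bilinear_m]
lemmas m_scaleR_right = bounded_bilinear.scaleR_right[OF bilinear_m]

lemma m_0: "m 0 u = 0" "m u 0 = 0"
  by (simp_all add: bounded_bilinear.zero_left[OF bilinear_m] bounded_bilinear.zero_right[OF bilinear_m])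

lemma m_scale: "m (a *\<^sub>R u) (a *\<^sub>R u) = a\<^sup>2 * m u u"
  by (simp add: m_scaleR_left m_scaleR_right power2_eq_square)

lemma m_N: "n \<in> N \<Longrightarrow> m n n = - B n n"
  and m_P: "w \<in> P \<Longrightarrow> m w w = B w w"
  by (simp_all add: m_def fs_K sn_K fs_C sn_C bounded_bilinear.zero_left[OF bilinear])

lemma m_N_P: "n \<in> N \<Longrightarrow> w \<in> P \<Longrightarrow> m n w = 0" "n \<in> N \<Longrightarrow> w \<in> P \<Longrightarrow> m w n = 0"
  by (simp_all add: m_def fs_K sn_K fs_C sn_C bounded_bilinear.zero_left[OF bilinear]
      bounded_bilinear.zero_right[OF bilinear])

lemma m_pos: "u \<noteq> 0 \<Longrightarrow> 0 < m u u"
proof -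
  assume u: "u \<noteq> 0"
  have 1: "0 \<le> - B (fs u) (fs u)" "fs u \<noteq> 0 \<Longrightarrow> 0 < - B (fs u) (fs u)"
    using neg[OF fs_in[of u]] by (cases "fs u = 0"; simp add: bounded_bilinear.zero_left[OF bilinear])+
  have 2: "0 \<le> B (sn u) (sn u)" "sn u \<noteq> 0 \<Longrightarrow> 0 < B (sn u) (sn u)"
    using pos[OF sn_in[of u]] by (cases "sn u = 0"; simp add: bounded_bilinear.zero_left[OF bilinear])+
  have "fs u \<noteq> 0 \<or> sn u \<noteq> 0" using u fs_plus_sn[of u] by auto
  then show ?thesis using 1 2 by (auto simp: m_def)
qed

lemma m_nonneg: "0 \<le> m u u"
  by (cases "u = 0") (use m_pos in \<open>auto simp: m_0 intro: less_imp_le\<close>)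

lemma m_eq_0: "m u u = 0 \<longleftrightarrow> u = 0"
proof
  assume "m u u = 0"
  then show "u = 0" using m_pos[of u] by (cases "u = 0") auto
qed (simp add: m_0)

lemma B_sum: "n \<in> N \<Longrightarrow> w \<in> P \<Longrightarrow> B (n + w) (n + w) = - m n n + m w w"
  by (simp add: m_N m_P bounded_bilinear.add_left[OF bilinear] bounded_bilinear.add_right[OF bilinear]
      orth sym[of w n])

lemma m_sum: "n \<in> N \<Longrightarrow> w \<in> P \<Longrightarrow> m (n + w) (n + w) = m n n + m w w"
  by (simp add: m_add_left m_add_right m_N_P)

lemma continuous_m: "continuous_on S f \<Longrightarrow> continuous_on S (\<lambda>x. m (f x) (f x))"
  by (rule bounded_bilinear.continuous_on[OF bilinear_m])

lemma small_ball:
  assumes "open X" "0 \<in> X"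
  obtains \<epsilon> where "0 < \<epsilon>" "\<And>u. m u u < \<epsilon>\<^sup>2 \<Longrightarrow> u \<in> X"
proof -
  obtain c where c: "0 < c" "\<And>u. c * (norm u)\<^sup>2 \<le> m u u"
    using positive_definite_lower_bound[OF bilinear_m m_pos] by blast
  obtain e where e: "0 < e" "ball 0 e \<subseteq> X" using assms open_contains_ball by blast
  show thesis
  proof (rule that[of "sqrt c * e"])
    show "0 < sqrt c * e" using c(1) e(1) by simp
    fix u assume "m u u < (sqrt c * e)\<^sup>2"
    also have "(sqrt c * e)\<^sup>2 = c * e\<^sup>2" using c(1) by (simp add: power_mult_distrib)
    finally have "c * (norm u)\<^sup>2 < c * e\<^sup>2" using c(2)[of u] by linarith
    then have "(norm u)\<^sup>2 < e\<^sup>2" using c(1) by simp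
    then have "norm u < e" using e(1) by (simp add: power2_less_imp_less)
    then show "u \<in> X" using e(2) by auto
  qed
qed

end

section \<open>The embedding \<open>\<chi>\<close>\<close>

lemma embedding_on_left_inverse:
  fixes h :: "'a::euclidean_space \<Rightarrow> 'b::euclidean_space"
  assumes h: "smooth_on S h" and L: "bounded_linear L" and Lh: "\<And>x. x \<in> S \<Longrightarrow> L (h x) = x"
  shows "embedding_on S h"
  unfolding embedding_on_def immersion_on_def
proof (intro conjI ballI allI impI notI)
  show "smooth_on S h" by fact
  have inv: "inv_into S h y = L y" if "y \<in> h ` S" for y
    using that Lh by (auto intro!: inv_into_f_eq inj_on_inverseI[of S L h])
  show "homeomorphism S (h ` S) h (inv_into S h)"
  proof (rule homeomorphismI)
    show "continuous_on S h"
      unfolding continuous_on_eq_continuous_within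
    proof
      fix x assume x: "x \<in> S"
      from h[unfolded smooth_on_def, rule_format, OF x] obtain W g where
        W: "open W" "x \<in> W" "\<forall>k. Ck_on k W g" "\<forall>y\<in>S \<inter> W. g y = h y" by auto
      have "continuous_on W g" using W(3)[rule_format] by (rule Ck_on_imp_continuous_on)
      then have "isCont g x" using W(1,2) by (simp add: continuous_on_eq_continuous_at)
      then have "continuous (at x within S) g" by (rule continuous_at_imp_continuous_at_within)
      moreover obtain d where d: "0 < d" "ball x d \<subseteq> W" using W(1,2) open_contains_ball by blast
      have "g y = h y" if "y \<in> S" "dist y x < d" for y
        using d(2) W(4) that by (auto simp: dist_commute)
      ultimately show "continuous (at x within S) h"
        using continuous_transform_within[OF _ d(1) x] by blast
    qed
    show "continuous_on (h ` S) (inv_into S h)"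
      by (rule continuous_on_eq[OF linear_continuous_on[OF L]]) (simp add: inv)
    show "inv_into S h ` h ` S \<subseteq> S" by (auto simp: inv Lh)
  qed (auto simp: inv Lh)
  fix x v \<alpha>
  assume "curve_in S x v \<alpha> \<and> v \<noteq> 0" and 0: "(h \<circ> \<alpha> has_vector_derivative 0) (at 0)"
  then obtain e where \<alpha>: "(\<alpha> has_vector_derivative v) (at 0)" "v \<noteq> 0" "0 < e" "\<alpha> ` {-e<..<e} \<subseteq> S"
    unfolding curve_in_def by blast
  have "((\<lambda>t. L (h (\<alpha> t))) has_vector_derivative L 0) (at 0)"
    using bounded_linear.has_vector_derivative[OF L 0] by (simp add: comp_def)
  then have "(\<alpha> has_vector_derivative L 0) (at 0)"
    by (rule has_vector_derivative_transform_within_open[of _ _ _ "{-e<..<e}"])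
      (use \<alpha>(3,4) Lh in \<open>auto simp: image_subset_iff\<close>)
  then have "v = L 0" using \<alpha>(1) vector_derivative_unique_at by blast
  then show False using \<alpha>(2) linear_0[OF bounded_linear.linear[OF L]] by simp
qed

lemma orbit_derivative:
  "((\<lambda>t. exp (- t) *\<^sub>R a + exp t *\<^sub>R b) has_vector_derivative - a + b) (at (0::real))"
  by (auto intro!: derivative_eq_intros simp: has_vector_derivative_def algebra_simps)

lemma orbit_smooth:
  fixes a b :: "'x::euclidean_space"
  shows "open S \<Longrightarrow> Ck_on k S (\<lambda>t::real. exp (- t) *\<^sub>R a + exp t *\<^sub>R b)"
proof (induction k arbitrary: a b)
  case 0
  then show ?case by (auto intro!: continuous_intros)
next
  case (Suc k)
  show ?case
  proof (rule Ck_on_SucI[OF Suc.prems])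
    show "((\<lambda>t. exp (- t) *\<^sub>R a + exp t *\<^sub>R b) has_derivative
        (\<lambda>v. exp (- t) *\<^sub>R (- v *\<^sub>R a) + exp t *\<^sub>R (v *\<^sub>R b))) (at t)" for t
      by (auto intro!: derivative_eq_intros simp: algebra_simps)
    show "Ck_on k S (\<lambda>t. exp (- t) *\<^sub>R (- v *\<^sub>R a) + exp t *\<^sub>R (v *\<^sub>R b))" for v
      by (rule Suc.IH[OF Suc.prems])
  qed
qed

text \<open>A smooth map \<open>\<theta>\<close> from the \<open>\<mu>\<close>-ball of radius \<open>\<nu>\<close> in \<open>N\<close> to the orthogonal of \<open>p\<close> in \<open>P\<close>, with values in the
  ball of radius \<open>s\<close>. The open set \<open>V\<close> is a neighbourhood of the ball in the whole space to which the
  smooth map extends.\<close>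

locale graph_germ = split_form N P B for N P :: "'e::euclidean_space set" and B +
  fixes p :: 'e and s \<nu> :: real and \<theta> :: "'e \<Rightarrow> 'e" and V :: "'e set"
  assumes p: "p \<in> P" "m p p = 1"
    and \<nu>: "0 < \<nu>" "\<nu> \<le> s"
    and V: "open V" "\<And>k. Ck_on k V \<theta>" "\<And>n. n \<in> N \<Longrightarrow> m n n < \<nu>\<^sup>2 \<Longrightarrow> n \<in> V"
    and \<theta>: "\<And>n. n \<in> N \<Longrightarrow> m n n < \<nu>\<^sup>2 \<Longrightarrow> \<theta> n \<in> P \<and> m p (\<theta> n) = 0 \<and> m (\<theta> n) (\<theta> n) < s\<^sup>2"
    and \<theta>0: "\<theta> 0 = 0"
begin

abbreviation chi where "chi \<equiv> chi_map s p \<theta>"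

text \<open>The domain of \<open>\<chi>\<close> for \<open>\<delta> = \<nu>\<close>.\<close>

definition D :: "('e \<times> real) set" where "D = {n \<in> N. m n n < \<nu>\<^sup>2} \<times> {-\<nu><..<\<nu>}"

text \<open>The component of \<open>\<chi>(n, \<tau>)\<close> in \<open>P\<close>.\<close>

definition w :: "'e \<Rightarrow> real \<Rightarrow> 'e" where "w n \<tau> = \<tau> *\<^sub>R p + (\<tau> / s) *\<^sub>R \<theta> ((\<tau> / s) *\<^sub>R n)"

lemma s_pos: "0 < s" using \<nu> by simp

lemma chi_eq: "chi (n, \<tau>) = n + w n \<tau>"
  by (simp add: chi_map_def w_def)

lemma D_iff: "(n, \<tau>) \<in> D \<longleftrightarrow> n \<in> N \<and> m n n < \<nu>\<^sup>2 \<and> \<bar>\<tau>\<bar> < \<nu>"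
  by (auto simp: D_def)

lemma ratio: "\<bar>\<tau>\<bar> < \<nu> \<Longrightarrow> \<bar>\<tau> / s\<bar> \<le> 1"
  using \<nu> by (simp add: abs_divide)

lemma scaled:
  assumes "(n, \<tau>) \<in> D"
  shows "(\<tau> / s) *\<^sub>R n \<in> N" "m ((\<tau> / s) *\<^sub>R n) ((\<tau> / s) *\<^sub>R n) < \<nu>\<^sup>2"
proof -
  show "(\<tau> / s) *\<^sub>R n \<in> N" using assms by (auto simp: D_iff intro: subspace_scale[OF subspaces(1)])
  have "(\<tau> / s)\<^sup>2 \<le> 1" using ratio assms by (simp add: D_iff abs_square_le_1)
  then have "(\<tau> / s)\<^sup>2 * m n n \<le> 1 * m n n" by (intro mult_right_mono m_nonneg)
  then show "m ((\<tau> / s) *\<^sub>R n) ((\<tau> / s) *\<^sub>R n) < \<nu>\<^sup>2"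
    unfolding m_scale using assms by (simp add: D_iff)
qed

lemma w_properties:
  assumes "(n, \<tau>) \<in> D"
  shows "w n \<tau> \<in> P" "m p (w n \<tau>) = \<tau>" "\<tau>\<^sup>2 \<le> m (w n \<tau>) (w n \<tau>)" "m (w n \<tau>) (w n \<tau>) < 2 * s\<^sup>2"
proof -
  note \<theta>' = \<theta>[OF scaled[OF assms]]
  have \<theta>p: "m (\<theta> ((\<tau> / s) *\<^sub>R n)) p = 0" using \<theta>' m_sym by metis
  show "w n \<tau> \<in> P" unfolding w_def
    using \<theta>' p by (intro subspace_add subspace_scale subspaces) auto
  show "m p (w n \<tau>) = \<tau>" unfolding w_def using \<theta>' p by (simp add: m_add_right m_scaleR_right)
  have eq: "m (w n \<tau>) (w n \<tau>) = \<tau>\<^sup>2 + (\<tau> / s)\<^sup>2 * m (\<theta> ((\<tau> / s) *\<^sub>R n)) (\<theta> ((\<tau> / s) *\<^sub>R n))"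
    unfolding w_def using \<theta>' p
    by (simp add: m_add_right m_add_left m_scaleR_right m_scaleR_left power2_eq_square \<theta>p)
  then show "\<tau>\<^sup>2 \<le> m (w n \<tau>) (w n \<tau>)" using m_nonneg by simp
  have "(\<tau> / s)\<^sup>2 \<le> 1" using ratio assms by (simp add: D_iff abs_square_le_1)
  then have "(\<tau> / s)\<^sup>2 * m (\<theta> ((\<tau> / s) *\<^sub>R n)) (\<theta> ((\<tau> / s) *\<^sub>R n)) \<le> 1 * m (\<theta> ((\<tau> / s) *\<^sub>R n)) (\<theta> ((\<tau> / s) *\<^sub>R n))"
    by (intro mult_right_mono m_nonneg)
  moreover have "\<tau>\<^sup>2 \<le> s\<^sup>2" using assms \<nu> by (simp add: D_iff abs_le_square_iff[symmetric])
  ultimately show "m (w n \<tau>) (w n \<tau>) < 2 * s\<^sup>2" unfolding eq using \<theta>' by linarith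
qed

lemma chi_split:
  assumes "(n, \<tau>) \<in> D"
  shows "fs (chi (n, \<tau>)) = n" "sn (chi (n, \<tau>)) = w n \<tau>"
  using assms w_properties(1)[OF assms] by (simp_all add: chi_eq fs_add sn_add D_iff)

text \<open>A linear left inverse of \<open>\<chi>\<close>.\<close>

definition L :: "'e \<Rightarrow> 'e \<times> real" where "L u = (fs u, m p u)"

lemma L_left_inverse: "bounded_linear L" "x \<in> D \<Longrightarrow> L (chi x) = x"
proof -
  show "bounded_linear L" unfolding L_def[abs_def]
    by (intro bounded_linear_Pair bounded_linear_fs bounded_bilinear.bounded_linear_right[OF bilinear_m])
  assume "x \<in> D"
  moreover obtain n \<tau> where x: "x = (n, \<tau>)" by (cases x)
  ultimately have *: "(n, \<tau>) \<in> D" by simp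
  have "m p (n + w n \<tau>) = \<tau>"
    using w_properties(2)[OF *] m_N_P(2)[of n p] * p by (simp add: m_add_right D_iff)
  then show "L (chi x) = x" unfolding L_def x by (simp add: chi_split[OF *]) (simp add: chi_eq)
qed

lemma chi_Ck: "\<exists>W. open W \<and> D \<subseteq> W \<and> (\<forall>k. Ck_on k W chi)"
proof (intro exI conjI allI)
  let ?z = "\<lambda>x :: 'e \<times> real. (snd x / s) *\<^sub>R fst x"
  define W where "W = ?z -` V"
  have z: "continuous_on UNIV ?z" by (intro continuous_intros) (use s_pos in simp)
  show W: "open W" unfolding W_def using open_vimage[OF V(1) z] .
  show "D \<subseteq> W" using scaled V(3) by (auto simp: W_def)
  have sndC: "Ck_on k W (\<lambda>x. snd x)" and fstC: "Ck_on k W (\<lambda>x. fst x)" for k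
    by (rule Ck_on_bounded_linear[OF bounded_linear_snd W Ck_on_id[OF W]],
        rule Ck_on_bounded_linear[OF bounded_linear_fst W Ck_on_id[OF W]])
  have ratC: "Ck_on k W (\<lambda>x. snd x / s)" for k
    by (rule Ck_on_bounded_linear[OF bounded_linear_divide W sndC])
  have zC: "Ck_on k W ?z" for k by (rule Ck_on_scaleR[OF W ratC fstC])
  have \<theta>C: "Ck_on k W (\<lambda>x. \<theta> (?z x))" for k
    by (rule Ck_on_compose[OF W _ zC V(2)]) (auto simp: W_def)
  have "Ck_on k W (\<lambda>x. fst x + snd x *\<^sub>R p + (snd x / s) *\<^sub>R \<theta> (?z x))" for k
    by (rule Ck_on_add[OF W Ck_on_add[OF W fstC Ck_on_scaleR[OF W sndC Ck_on_const[OF W]]]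
          Ck_on_scaleR[OF W ratC \<theta>C]])
  moreover have "(\<lambda>x. fst x + snd x *\<^sub>R p + (snd x / s) *\<^sub>R \<theta> (?z x)) = chi"
    by (rule ext) (simp add: chi_map_def case_prod_beta)
  ultimately show "Ck_on k W chi" for k by metis
qed

lemma smooth_chi: "smooth_on D chi"
proof -
  obtain W where W: "open W" "D \<subseteq> W" "\<forall>k. Ck_on k W chi" using chi_Ck by metis
  then have "smooth_on W chi" by (simp add: smooth_on_open_iff)
  then show ?thesis using W(2) by (rule smooth_on_subset)
qed

lemma embedding_chi:
  assumes "S \<subseteq> D"
  shows "embedding_on S chi"
  by (rule embedding_on_left_inverse[OF smooth_on_subset[OF smooth_chi assms] L_left_inverse(1)]) (use assms L_left_inverse(2) in auto)

text \<open>The map \<open>\<chi>\<close> intertwines the flow \<open>(n, \<tau>) \<mapsto> (e\<^sup>-\<^sup>t n, e\<^sup>t \<tau>)\<close> with \<open>\<Lambda>\<^sub>t\<close>, because \<open>\<tau> n\<close> is constant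
  along that flow.\<close>

lemma chi_orbit:
  "chi (exp (- t) *\<^sub>R n, exp t * \<tau>) = exp (- t) *\<^sub>R n + exp t *\<^sub>R w n \<tau>"
  by (simp add: chi_eq w_def scaleR_add_right exp_minus field_simps)

lemma orbit_in_D:
  assumes "(n, \<tau>) \<in> D"
  obtains e where "0 < e" "\<And>t. \<bar>t\<bar> < e \<Longrightarrow> (exp (- t) *\<^sub>R n, exp t * \<tau>) \<in> D"
proof -
  have "isCont (\<lambda>t. (exp (- t))\<^sup>2 * m n n) 0" "isCont (\<lambda>t. exp t * \<bar>\<tau>\<bar>) 0"
    by (auto intro!: continuous_intros)
  then have "((\<lambda>t. (exp (- t))\<^sup>2 * m n n) \<longlongrightarrow> m n n) (at 0)" "((\<lambda>t. exp t * \<bar>\<tau>\<bar>) \<longlongrightarrow> \<bar>\<tau>\<bar>) (at 0)"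
    by (simp_all add: isCont_def)
  then have "\<forall>\<^sub>F t in at 0. (exp (- t))\<^sup>2 * m n n < \<nu>\<^sup>2 \<and> exp t * \<bar>\<tau>\<bar> < \<nu>"
    using assms by (intro eventually_conj) (auto simp: D_iff elim: order_tendstoD)
  then obtain e where e: "0 < e" "\<And>t. t \<noteq> 0 \<Longrightarrow> \<bar>t\<bar> < e \<Longrightarrow> (exp (- t))\<^sup>2 * m n n < \<nu>\<^sup>2 \<and> exp t * \<bar>\<tau>\<bar> < \<nu>"
    by (auto simp: eventually_at)
  show thesis
  proof (rule that[OF e(1)])
    fix t :: real assume "\<bar>t\<bar> < e"
    then have "(exp (- t))\<^sup>2 * m n n < \<nu>\<^sup>2 \<and> exp t * \<bar>\<tau>\<bar> < \<nu>"
      using e(2)[of t] assms by (cases "t = 0") (auto simp: D_iff)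
    then show "(exp (- t) *\<^sub>R n, exp t * \<tau>) \<in> D"
      using assms by (simp add: D_iff m_scale abs_mult subspace_scale[OF subspaces(1)])
  qed
qed

text \<open>The second hypothesis says that \<open>S\<close> is invariant under that flow as long as it stays in \<open>D\<close>; it
  holds for \<open>D\<close> itself and for \<open>{0} \<times> ]-\<nu>, \<nu>[\<close>.\<close>

lemma Z_tangent:
  assumes S: "S \<subseteq> D" "\<And>n \<tau> t. (n, \<tau>) \<in> S \<Longrightarrow> (exp (- t) *\<^sub>R n, exp t * \<tau>) \<in> D \<Longrightarrow> (exp (- t) *\<^sub>R n, exp t * \<tau>) \<in> S"
    and u: "u \<in> chi ` S"
  shows "Z_field N P u \<in> tangent_space (chi ` S) u"
proof -
  obtain n \<tau> where x: "(n, \<tau>) \<in> S" "u = chi (n, \<tau>)" using u by auto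
  have xD: "(n, \<tau>) \<in> D" using x S by blast
  obtain e where e: "0 < e" "\<And>t. \<bar>t\<bar> < e \<Longrightarrow> (exp (- t) *\<^sub>R n, exp t * \<tau>) \<in> D"
    using orbit_in_D[OF xD] by metis
  define \<alpha> where "\<alpha> t = exp (- t) *\<^sub>R n + exp t *\<^sub>R w n \<tau>" for t
  have "\<alpha> t \<in> chi ` S" if "\<bar>t\<bar> < e" for t
    unfolding \<alpha>_def chi_orbit[symmetric] using S(2)[OF x(1) e(2)[OF that]] by blast
  then have "\<alpha> ` {-e<..<e} \<subseteq> chi ` S" by auto
  moreover have "smooth_on {-e<..<e} \<alpha>"
    unfolding smooth_on_open_iff[OF open_greaterThanLessThan] \<alpha>_def[abs_def]
    by (intro allI orbit_smooth) simp
  moreover have "(\<alpha> has_vector_derivative Z_field N P u) (at 0)"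
    unfolding Z_field_def x(2) chi_split[OF xD] \<alpha>_def[abs_def] by (rule orbit_derivative)
  moreover have "\<alpha> 0 = u" by (simp add: \<alpha>_def x(2) chi_eq)
  ultimately show ?thesis
    unfolding tangent_space_def curve_in_def using e(1) by blast
qed

lemma B_chi: "(n, \<tau>) \<in> D \<Longrightarrow> B (chi (n, \<tau>)) (chi (n, \<tau>)) = - m n n + m (w n \<tau>) (w n \<tau>)"
  using w_properties(1) by (simp add: chi_eq B_sum D_iff)

lemma zero_in_D: "(0, 0) \<in> D"
  using \<nu> by (simp add: D_iff subspace_0[OF subspaces(1)] m_0)

section \<open>Critical points and Hessian of \<open>q \<circ> \<chi>\<close>\<close>

text \<open>The derivative of \<open>q\<close> along the orbit through \<open>\<chi>(n, \<tau>)\<close> is \<open>2 (\<mu>(n) + \<mu>(w n \<tau>))\<close>.\<close>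

lemma critical_points:
  assumes g: "\<And>x. x \<in> D \<Longrightarrow> g x = c0 + B (chi x) (chi x)"
  shows "{x. critical_point_on D g x} = {(0, 0)}"
proof (intro equalityI subsetI)
  fix x assume "x \<in> {x. critical_point_on D g x}"
  then have x: "x \<in> D" and crit: "(g has_derivative (\<lambda>_. 0)) (at x within D)"
    by (auto simp: critical_point_on_def)
  obtain n \<tau> where nt: "x = (n, \<tau>)" by (cases x)
  have xD: "(n, \<tau>) \<in> D" using x nt by simp
  obtain e where e: "0 < e" "\<And>t. \<bar>t\<bar> < e \<Longrightarrow> (exp (- t) *\<^sub>R n, exp t * \<tau>) \<in> D"
    using orbit_in_D[OF xD] by metis
  let ?\<beta> = "\<lambda>t. (exp (- t) *\<^sub>R n, exp t * \<tau>)" and ?I = "{-e<..<e}"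
  have \<beta>0: "?\<beta> 0 = x" by (simp add: nt)
  have "(?\<beta> has_derivative (\<lambda>r. (- r *\<^sub>R n, r * \<tau>))) (at 0 within ?I)"
    by (auto intro!: derivative_eq_intros)
  moreover have "(g has_derivative (\<lambda>_. 0)) (at (?\<beta> 0) within ?\<beta> ` ?I)"
    unfolding \<beta>0 by (rule has_derivative_subset[OF crit]) (use e(2) in auto)
  ultimately have "((\<lambda>t. g (?\<beta> t)) has_derivative (\<lambda>r. 0)) (at 0 within ?I)"
    by (rule has_derivative_in_compose)
  then have 1: "((\<lambda>t. g (?\<beta> t)) has_derivative (\<lambda>r. 0)) (at 0)"
  proof -
    have "at 0 within ?I = at 0" using e(1) by (intro at_within_open) auto
    with \<open>((\<lambda>t. g (?\<beta> t)) has_derivative (\<lambda>r. 0)) (at 0 within ?I)\<close> show ?thesis by (simp only:)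
  qed
  have "g (?\<beta> t) = c0 - (exp (- t))\<^sup>2 * m n n + (exp t)\<^sup>2 * m (w n \<tau>) (w n \<tau>)" if "t \<in> ?I" for t
  proof -
    have tD: "?\<beta> t \<in> D" using e(2) that by auto
    have nN: "exp (- t) *\<^sub>R n \<in> N" using tD by (simp add: D_iff)
    have wP: "exp t *\<^sub>R w n \<tau> \<in> P" using w_properties(1)[OF xD] by (rule subspace_scale[OF subspaces(2)])
    show ?thesis unfolding g[OF tD] chi_orbit B_sum[OF nN wP] m_scale by simp
  qed
  then have "((\<lambda>t. c0 - (exp (- t))\<^sup>2 * m n n + (exp t)\<^sup>2 * m (w n \<tau>) (w n \<tau>)) has_derivative (\<lambda>r. 0)) (at 0)"
    by (rule has_derivative_transform_within_open[OF 1 open_greaterThanLessThan, rotated]) (use e(1) in auto)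
  moreover have "((\<lambda>t. c0 - (exp (- t))\<^sup>2 * m n n + (exp t)\<^sup>2 * m (w n \<tau>) (w n \<tau>)) has_derivative
      (\<lambda>r. r * (2 * m n n + 2 * m (w n \<tau>) (w n \<tau>)))) (at 0)"
    by (auto intro!: derivative_eq_intros simp: algebra_simps)
  ultimately have "(\<lambda>r. 0) = (\<lambda>r. r * (2 * m n n + 2 * m (w n \<tau>) (w n \<tau>)))"
    by (rule has_derivative_unique)
  from fun_cong[OF this, of 1] have "m n n + m (w n \<tau>) (w n \<tau>) = 0" by simp
  then have "m n n = 0" "m (w n \<tau>) (w n \<tau>) = 0"
    using m_nonneg[of n] m_nonneg[of "w n \<tau>"] by linarith+
  then have "n = 0" "\<tau> = 0"
    using m_eq_0 w_properties(2)[OF xD] by (simp_all add: m_0)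
  then show "x \<in> {(0, 0)}" by (simp add: nt)
next
  fix x assume "x \<in> {(0::'e, 0::real)}"
  then have x: "x = (0, 0)" by simp
  obtain W where W: "open W" "D \<subseteq> W" "\<forall>k. Ck_on k W chi" using chi_Ck by metis
  have chi': "(chi has_derivative frechet_derivative chi (at x)) (at x)"
    by (rule Ck_on_Suc_has_derivative[of 0 W]) (use W zero_in_D x in blast)+
  have chi0: "chi x = 0" by (simp add: x chi_eq w_def)
  have "((\<lambda>u. B u u) has_derivative (\<lambda>h. B (chi x) h + B h (chi x))) (at (chi x))"
    by (rule bounded_bilinear.FDERIV[OF bilinear has_derivative_ident has_derivative_ident])
  then have "((\<lambda>u. B u u) has_derivative (\<lambda>h. 0)) (at (chi x))"
    by (simp add: chi0 bounded_bilinear.zero_left[OF bilinear] bounded_bilinear.zero_right[OF bilinear])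
  from has_derivative_compose[OF chi' this]
  have "((\<lambda>x. B (chi x) (chi x)) has_derivative (\<lambda>h. 0)) (at x)" by simp
  from has_derivative_add[OF has_derivative_const[of c0] this]
  have "((\<lambda>x. c0 + B (chi x) (chi x)) has_derivative (\<lambda>h. 0)) (at x)" by simp
  then have "((\<lambda>x. c0 + B (chi x) (chi x)) has_derivative (\<lambda>h. 0)) (at x within D)"
    by (rule has_derivative_at_withinI)
  then have "(g has_derivative (\<lambda>h. 0)) (at x within D)"
    by (rule has_derivative_transform[rotated 2]) (use zero_in_D x g in auto)
  then show "x \<in> {x. critical_point_on D g x}" using zero_in_D x by (simp add: critical_point_on_def)
qed

text \<open>The derivative of \<open>t \<mapsto> g (t n, t \<tau>)\<close> has the form \<open>t F(t)\<close> with \<open>F\<close> continuous at \<open>0\<close>. The second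
  derivative at \<open>0\<close> is therefore \<open>F(0)\<close>, and no second derivative of \<open>\<theta>\<close> enters.\<close>

lemma linear_hessian_chi:
  assumes g: "\<And>x. x \<in> D \<Longrightarrow> g x = c0 + B (chi x) (chi x)" and n: "n \<in> N"
  shows "linear_hessian g (0, 0) (n, \<tau>) = \<tau>\<^sup>2 - m n n"
proof -
  define \<zeta> where "\<zeta> t = (t\<^sup>2 * (\<tau> / s)) *\<^sub>R n" for t
  define k where "k t = m (\<theta> (\<zeta> t)) (\<theta> (\<zeta> t))" for t
  define k' where "k' t = frechet_derivative k (at t) 1" for t
  define h where "h t = c0 + t\<^sup>2 * ((\<tau>\<^sup>2 - m n n) + (\<tau> / s)\<^sup>2 * k t)" for t
  define F where "F t = 2 * ((\<tau>\<^sup>2 - m n n) + (\<tau> / s)\<^sup>2 * k t) + t * ((\<tau> / s)\<^sup>2 * k' t)" for t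
  define J where "J = \<zeta> -` V \<inter> {t. \<bar>t * \<tau>\<bar> < \<nu> \<and> t\<^sup>2 * m n n < \<nu>\<^sup>2}"
  have \<zeta>: "continuous_on UNIV \<zeta>" unfolding \<zeta>_def[abs_def] by (intro continuous_intros) 
  have oV: "open (\<zeta> -` V)" using open_vimage[OF V(1) \<zeta>] .
  have oJ: "open J" unfolding J_def
    by (intro open_Int oV open_Collect_conj open_Collect_less continuous_intros)
  have "\<zeta> 0 \<in> V" using V(3)[of 0] \<nu> by (simp add: \<zeta>_def subspace_0[OF subspaces(1)] m_0)
  then have J0: "0 \<in> J" using \<nu> by (simp add: J_def)
  have \<zeta>C: "Ck_on j (\<zeta> -` V) \<zeta>" for j
  proof -
    have "Ck_on j (\<zeta> -` V) (\<lambda>t. t * t)"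
      by (intro Ck_on_bilinear[OF bounded_bilinear_mult oV] Ck_on_id oV)
    from Ck_on_bounded_linear[OF bounded_linear_scaleR_left[of "(\<tau> / s) *\<^sub>R n"] oV this]
    show ?thesis by (simp add: \<zeta>_def[abs_def] power2_eq_square)
  qed
  have "Ck_on j (\<zeta> -` V) (\<lambda>t. \<theta> (\<zeta> t))" for j
    by (rule Ck_on_compose[OF oV _ \<zeta>C V(2)]) auto
  then have kC: "Ck_on j (\<zeta> -` V) k" for j
    unfolding k_def[abs_def] by (intro Ck_on_bilinear[OF bilinear_m oV])
  have k': "(k has_real_derivative k' t) (at t)" if "t \<in> J" for t
  proof -
    have "(k has_derivative frechet_derivative k (at t)) (at t)"
      by (rule Ck_on_Suc_has_derivative[OF kC]) (use that in \<open>simp add: J_def\<close>)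
    moreover have "frechet_derivative k (at t) = (*) (k' t)"
    proof
      fix r
      show "frechet_derivative k (at t) r = k' t * r"
        using linear_cmul[OF has_derivative_linear[OF calculation], of r 1]
        unfolding k'_def by (simp add: mult.commute)
    qed
    ultimately show ?thesis unfolding has_field_derivative_def by (simp only:)
  qed
  have "continuous_on (\<zeta> -` V) k'" "continuous_on (\<zeta> -` V) k"
    using kC[of "Suc 0"] Ck_on_imp_continuous_on[OF kC] by (simp_all add: k'_def[abs_def])
  then have "isCont k' 0" "isCont k 0"
    using J0 unfolding continuous_on_eq_continuous_at[OF oV] by (auto simp: J_def)
  then have F0: "isCont F 0" unfolding F_def[abs_def] by (intro continuous_intros)
  have "k 0 = 0" by (simp add: k_def \<zeta>_def \<theta>0 m_0)
  then have F00: "F 0 = 2 * (\<tau>\<^sup>2 - m n n)" by (simp add: F_def)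
  have gh: "g ((0, 0) + t *\<^sub>R (n, \<tau>)) = h t" if "t \<in> J" for t
  proof -
    have tD: "(t *\<^sub>R n, t * \<tau>) \<in> D"
      using that n by (simp add: D_iff J_def m_scale subspace_scale[OF subspaces(1)])
    have \<zeta>t: "((t * \<tau>) / s) *\<^sub>R (t *\<^sub>R n) = \<zeta> t" by (simp add: \<zeta>_def power2_eq_square mult_ac)
    note \<theta>' = \<theta>[OF scaled[OF tD], unfolded \<zeta>t]
    have \<theta>p: "m (\<theta> (\<zeta> t)) p = 0" using \<theta>' m_sym by metis
    have "m (w (t *\<^sub>R n) (t * \<tau>)) (w (t *\<^sub>R n) (t * \<tau>)) = (t * \<tau>)\<^sup>2 + (t * \<tau> / s)\<^sup>2 * k t"
      unfolding w_def \<zeta>t k_def using \<theta>' p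
      by (simp add: m_add_right m_add_left m_scaleR_right m_scaleR_left power2_eq_square \<theta>p)
    then have "g (t *\<^sub>R n, t * \<tau>) = c0 + (- (t\<^sup>2 * m n n) + ((t * \<tau>)\<^sup>2 + (t * \<tau> / s)\<^sup>2 * k t))"
      unfolding g[OF tD] B_chi[OF tD] m_scale by simp
    also have "\<dots> = h t" by (simp add: h_def power_mult_distrib power_divide field_simps)
    finally show ?thesis by simp
  qed
  have h': "(h has_real_derivative t * F t) (at t)" if "t \<in> J" for t
    unfolding h_def[abs_def]
    by (rule derivative_eq_intros k'[OF that] refl)+ (simp add: F_def power2_eq_square algebra_simps)
  have inner: "deriv (\<lambda>r. g ((0, 0) + t *\<^sub>R (n, \<tau>) + r *\<^sub>R (n, \<tau>))) 0 = t * F t" if "t \<in> J" for t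
  proof (rule DERIV_imp_deriv)
    have "((\<lambda>r. h (t + r)) has_real_derivative t * F t) (at 0)"
      using h'[OF that] DERIV_shift[of h "t * F t" 0 t] by (simp add: add.commute)
    moreover have "open ((\<lambda>r. t + r) -` J)" by (intro open_vimage oJ continuous_intros)
    moreover have "0 \<in> (\<lambda>r. t + r) -` J" using that by simp
    moreover have "h (t + r) = g ((0, 0) + t *\<^sub>R (n, \<tau>) + r *\<^sub>R (n, \<tau>))" if "r \<in> (\<lambda>r. t + r) -` J" for r
      using gh[of "t + r"] that by (simp add: algebra_simps)
    ultimately show "((\<lambda>r. g ((0, 0) + t *\<^sub>R (n, \<tau>) + r *\<^sub>R (n, \<tau>))) has_real_derivative t * F t) (at 0)"
      by (rule has_field_derivative_transform_within_open)
  qed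
  have "((\<lambda>t. t * F t) has_real_derivative F 0) (at 0)"
    unfolding CARAT_DERIV using F0 by (intro exI[of _ F]) (simp add: mult.commute)
  then have "((\<lambda>t. deriv (\<lambda>r. g ((0, 0) + t *\<^sub>R (n, \<tau>) + r *\<^sub>R (n, \<tau>))) 0) has_real_derivative F 0) (at 0)"
    by (rule has_field_derivative_transform_within_open[OF _ oJ J0]) (simp only: inner)
  then show ?thesis
    unfolding linear_hessian_def by (simp only: DERIV_imp_deriv F00) simp
qed

end

context split_form
begin

lemma nondegenerate_model:
  assumes h: "\<And>n \<tau>. n \<in> N \<Longrightarrow> h (n, \<tau>) = \<tau>\<^sup>2 - m n n"
  shows "nondegenerate_on (N \<times> UNIV) (h :: 'e \<times> real \<Rightarrow> real)"
  unfolding nondegenerate_on_def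
proof (intro ballI impI)
  have polar: "polar_form h (n, \<tau>) (n', \<tau>') = \<tau> * \<tau>' - m n n'" if "n \<in> N" "n' \<in> N" for n \<tau> n' \<tau>'
  proof -
    have "n + n' \<in> N" using that subspace_add[OF subspaces(1)] by blast
    then have "polar_form h (n, \<tau>) (n', \<tau>')
        = ((\<tau> + \<tau>')\<^sup>2 - m (n + n') (n + n') - (\<tau>\<^sup>2 - m n n) - (\<tau>'\<^sup>2 - m n' n')) / 2"
      unfolding polar_form_def using that by (simp add: h)
    also have "\<dots> = \<tau> * \<tau>' - m n n'"
      by (simp add: m_add_left m_add_right m_sym[of n' n] power2_eq_square field_simps)
    finally show ?thesis .
  qed
  fix u assume "u \<in> N \<times> (UNIV :: real set)" and 0: "\<forall>v\<in>N \<times> UNIV. polar_form h u v = 0"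
  then obtain n \<tau> where u: "u = (n, \<tau>)" "n \<in> N" by auto
  have "0 \<in> N" by (rule subspace_0[OF subspaces(1)])
  then have "polar_form h u (0, 1) = 0" "polar_form h u (n, 0) = 0" using 0 u by auto
  then have "\<tau> = 0" "m n n = 0" unfolding u(1) using polar[OF u(2)] \<open>0 \<in> N\<close> u(2) by (simp_all add: m_0)
  then show "u = 0" using m_eq_0 u(1) by (simp add: zero_prod_def)
qed

lemma coindex_model:
  assumes h: "\<And>n \<tau>. n \<in> N \<Longrightarrow> h (n, \<tau>) = \<tau>\<^sup>2 - m n n"
  shows "coindex_on (N \<times> UNIV) (h :: 'e \<times> real \<Rightarrow> real) = 1"
  unfolding coindex_on_def
proof (rule Max_eqI)
  let ?S = "{dim F |F. subspace F \<and> F \<subseteq> N \<times> UNIV \<and> (\<forall>v\<in>F. 0 \<le> h v)}"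
  have "dim F \<le> DIM('e \<times> real)" for F :: "('e \<times> real) set" by (rule dim_subset_UNIV)
  then have "?S \<subseteq> {..DIM('e \<times> real)}" unfolding atMost_def by blast
  then show "finite ?S" by (rule finite_subset) simp
  fix d assume "d \<in> ?S"
  then obtain F where F: "d = dim F" "subspace F" "F \<subseteq> N \<times> UNIV" "\<forall>v\<in>F. 0 \<le> h v" by blast
  have "inj_on snd F"
    unfolding linear_injective_on_subspace_0[OF linear_snd F(2)]
  proof (intro ballI impI)
    fix v assume v: "v \<in> F" "snd v = 0"
    obtain n \<tau> where nt: "v = (n, \<tau>)" by (cases v)
    then have n: "n \<in> N" "\<tau> = 0" using v F(3) by auto
    have "0 \<le> h v" using F(4) v(1) by blast
    then have "m n n \<le> 0" using h[OF n(1), of 0] nt n(2) by simp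
    then have "n = 0" using m_pos[of n] by (cases "n = 0") auto
    then show "v = 0" using nt n(2) by (simp add: zero_prod_def)
  qed
  then have "dim (snd ` F) = dim F"
    using F(2) by (intro dim_image_eq[OF linear_snd]) (simp add: span_eq_iff[THEN iffD2])
  moreover have "dim (snd ` F) \<le> 1" using dim_subset_UNIV[of "snd ` F"] by simp
  ultimately show "d \<le> 1" using F(1) by simp
next
  let ?F = "span {(0 :: 'e, 1 :: real)}"
  have F: "?F \<subseteq> N \<times> UNIV" "\<forall>v\<in>?F. 0 \<le> h v"
    using subspace_0[OF subspaces(1)] by (auto simp: span_singleton h m_0)
  have "1 = dim ?F" by (simp add: dim_span_eq_card_independent zero_prod_def)
  then show "1 \<in> {dim F |F. subspace F \<and> F \<subseteq> N \<times> UNIV \<and> (\<forall>v\<in>F. 0 \<le> h v)}"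
    by (intro CollectI exI[of _ ?F] conjI subspace_span F)
qed

end

section \<open>Flow invariance\<close>

text \<open>The data of \<open>graph_germ\<close> together with sets \<open>U\<^sub>N\<close> and \<open>U\<^sub>P\<close> that contain the \<open>\<mu>\<close>-balls of radius
  \<open>2 s\<close> in \<open>N\<close> and \<open>P\<close>, and an invariant set \<open>M\<close> that contains the translated graph of \<open>\<theta>\<close>.\<close>

locale invariant_germ = graph_germ N P B p s \<nu> \<theta> V
  for N P :: "'e::euclidean_space set" and B p s \<nu> \<theta> V +
  fixes U\<^sub>N U\<^sub>P M :: "'e set"
  assumes UN: "\<And>n. n \<in> N \<Longrightarrow> m n n < (2 * s)\<^sup>2 \<Longrightarrow> n \<in> U\<^sub>N"
    and UP: "\<And>u. u \<in> P \<Longrightarrow> m u u < (2 * s)\<^sup>2 \<Longrightarrow> u \<in> U\<^sub>P"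
    and invariant: "flow_invariant N P (U\<^sub>N + U\<^sub>P) M" "M \<subseteq> U\<^sub>N + U\<^sub>P"
    and graph: "\<And>n. n \<in> N \<Longrightarrow> m n n < \<nu>\<^sup>2 \<Longrightarrow> s *\<^sub>R p + n + \<theta> n \<in> M"
begin

lemma in_U:
  assumes "n \<in> N" "m n n < (2 * s)\<^sup>2" "u \<in> P" "m u u < (2 * s)\<^sup>2"
  shows "n + u \<in> U\<^sub>N + U\<^sub>P"
  by (rule set_plus_intro[OF UN[OF assms(1,2)] UP[OF assms(3,4)]])

lemma N_bound: "m n n < \<nu>\<^sup>2 \<Longrightarrow> m n n < (2 * s)\<^sup>2"
proof -
  assume "m n n < \<nu>\<^sup>2"
  also have "\<nu>\<^sup>2 \<le> (2 * s)\<^sup>2" using \<nu> by (intro power_mono) auto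
  finally show ?thesis .
qed

lemma P_bound: "x < 2 * s\<^sup>2 \<Longrightarrow> x < (2 * s)\<^sup>2"
proof -
  assume "x < 2 * s\<^sup>2"
  also have "2 * s\<^sup>2 \<le> (2 * s)\<^sup>2" by (simp add: power_mult_distrib)
  finally show ?thesis .
qed

lemma chi_in_U: "x \<in> D \<Longrightarrow> chi x \<in> U\<^sub>N + U\<^sub>P"
proof -
  assume "x \<in> D"
  moreover obtain n \<tau> where x: "x = (n, \<tau>)" by (cases x)
  ultimately have D: "(n, \<tau>) \<in> D" by simp
  show "chi x \<in> U\<^sub>N + U\<^sub>P"
    unfolding x chi_eq
  proof (rule in_U)
    show "n \<in> N" "m n n < (2 * s)\<^sup>2" using D N_bound by (auto simp: D_iff)
    show "w n \<tau> \<in> P" "m (w n \<tau>) (w n \<tau>) < (2 * s)\<^sup>2" using w_properties[OF D] P_bound by auto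
  qed
qed

text \<open>The point \<open>\<chi>(n, \<tau>)\<close> is reached from the point \<open>u\<close> of the translated graph by flowing for the negative
  time \<open>t\<close>. Backwards in time the component in \<open>P\<close> shrinks, and the one in \<open>N\<close> grows to \<open>n\<close>
  only, so that the orbit stays in \<open>U\<close>.\<close>

lemma chi_in_M:
  assumes D: "(n, \<tau>) \<in> D" and \<tau>: "0 < \<tau>"
  shows "chi (n, \<tau>) \<in> M"
proof -
  define t where "t = ln (\<tau> / s)"
  define n' where "n' = (\<tau> / s) *\<^sub>R n"
  define u where "u = n' + (s *\<^sub>R p + \<theta> n')"
  have et: "exp t = \<tau> / s" using \<tau> s_pos by (simp add: t_def)
  have \<tau>s: "\<tau> < s" using D \<nu> abs_ge_self[of \<tau>] unfolding D_iff by linarith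
  then have t0: "t \<le> 0" using \<tau> s_pos by (simp add: t_def)
  have n': "n' \<in> N" "m n' n' < \<nu>\<^sup>2" unfolding n'_def by (rule scaled[OF D])+
  note \<theta>' = \<theta>[OF n']
  have vP: "s *\<^sub>R p + \<theta> n' \<in> P" using \<theta>' p by (intro subspace_add subspace_scale subspaces) auto
  have \<theta>p: "m (\<theta> n') p = 0" using \<theta>' m_sym by metis
  have "m (s *\<^sub>R p + \<theta> n') (s *\<^sub>R p + \<theta> n') = s\<^sup>2 + m (\<theta> n') (\<theta> n')"
    using \<theta>' \<theta>p p by (simp add: m_add_left m_add_right m_scaleR_left m_scaleR_right power2_eq_square)
  then have v_bound: "m (s *\<^sub>R p + \<theta> n') (s *\<^sub>R p + \<theta> n') < 2 * s\<^sup>2" using \<theta>' by linarith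
  have "u = s *\<^sub>R p + n' + \<theta> n'" by (simp add: u_def)
  then have uM: "u \<in> M" using graph[OF n'] by simp
  have Lam: "Lambda_flow N P r u = exp (- r) *\<^sub>R n' + exp r *\<^sub>R (s *\<^sub>R p + \<theta> n')" for r
    unfolding Lambda_flow_def u_def fs_add[OF n'(1) vP] sn_add[OF n'(1) vP] ..
  have "Lambda_flow N P r u \<in> U\<^sub>N + U\<^sub>P" if "r \<in> closed_segment 0 t" for r
    unfolding Lam
  proof (rule in_U)
    have r: "t \<le> r" "r \<le> 0" using that t0 by (auto simp: closed_segment_eq_real_ivl split: if_splits)
    show "exp (- r) *\<^sub>R n' \<in> N" using n'(1) by (rule subspace_scale[OF subspaces(1)])
    show "exp r *\<^sub>R (s *\<^sub>R p + \<theta> n') \<in> P" using vP by (rule subspace_scale[OF subspaces(2)])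
    have "exp (- r) *\<^sub>R n' = exp (t - r) *\<^sub>R n"
      unfolding n'_def et[symmetric] by (simp add: exp_diff exp_minus field_simps)
    moreover have "(exp (t - r))\<^sup>2 * m n n \<le> 1 * m n n"
      using r by (intro mult_right_mono m_nonneg power_le_one) auto
    ultimately have "m (exp (- r) *\<^sub>R n') (exp (- r) *\<^sub>R n') < \<nu>\<^sup>2"
      using D by (simp add: m_scale D_iff)
    then show "m (exp (- r) *\<^sub>R n') (exp (- r) *\<^sub>R n') < (2 * s)\<^sup>2" by (rule N_bound)
    have "(exp r)\<^sup>2 * m (s *\<^sub>R p + \<theta> n') (s *\<^sub>R p + \<theta> n') \<le> 1 * m (s *\<^sub>R p + \<theta> n') (s *\<^sub>R p + \<theta> n')"
      using r by (intro mult_right_mono m_nonneg power_le_one) auto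
    then show "m (exp r *\<^sub>R (s *\<^sub>R p + \<theta> n')) (exp r *\<^sub>R (s *\<^sub>R p + \<theta> n')) < (2 * s)\<^sup>2"
      unfolding m_scale using v_bound by (intro P_bound) linarith
  qed
  then have "U_flow N P (U\<^sub>N + U\<^sub>P) t u = Some (Lambda_flow N P t u)" by (simp add: U_flow_def)
  moreover have "u \<in> U\<^sub>N + U\<^sub>P" using uM invariant(2) by blast
  ultimately have "Lambda_flow N P t u \<in> M"
    using invariant(1) uM unfolding flow_invariant_def by blast
  moreover have "Lambda_flow N P t u = chi (n, \<tau>)"
    unfolding Lam exp_minus et chi_eq w_def n'_def using \<tau> s_pos by (simp add: scaleR_add_right)
  ultimately show ?thesis by simp
qed

end

section \<open>The slice of an invariant submanifold\<close>

lemma (in split_form) openin_ball: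
  assumes "openin (top_of_set Q) S" "0 \<in> S"
  obtains \<epsilon> where "0 < \<epsilon>" "\<And>u. u \<in> Q \<Longrightarrow> m u u < \<epsilon>\<^sup>2 \<Longrightarrow> u \<in> S"
proof -
  obtain X where X: "open X" "S = Q \<inter> X" using assms(1) by (auto simp: openin_open)
  obtain \<epsilon> where "0 < \<epsilon>" "\<And>u. m u u < \<epsilon>\<^sup>2 \<Longrightarrow> u \<in> X" using small_ball[OF X(1)] assms(2) X(2) by blast
  then show thesis using that[of \<epsilon>] X(2) by blast
qed

text \<open>The choice of the constants. The last clause is the uniqueness half of the graph property of \<open>\<theta>\<close>.\<close>

lemma (in split_form) transverse_germ:
  assumes p: "p \<in> P" "m p p = 1"
    and UN: "openin (top_of_set N) U\<^sub>N" "0 \<in> U\<^sub>N" and UP: "openin (top_of_set P) U\<^sub>P" "0 \<in> U\<^sub>P"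
    and M: "submanifold M"
    and \<gamma>: "openin (top_of_set (M \<inter> P)) ({t *\<^sub>R p |t. 0 < t} \<inter> (U\<^sub>N + U\<^sub>P))"
    and trans: "\<forall>x\<in>{t *\<^sub>R p |t. 0 < t} \<inter> (U\<^sub>N + U\<^sub>P). transverse_at M P x"
  shows "\<exists>s \<nu> \<rho> \<theta> V. graph_germ N P B p s \<nu> \<theta> V \<and> 0 < \<rho> \<and> \<rho> \<le> s \<and>
    (\<forall>n\<in>N. m n n < (2 * s)\<^sup>2 \<longrightarrow> n \<in> U\<^sub>N) \<and> (\<forall>u\<in>P. m u u < (2 * s)\<^sup>2 \<longrightarrow> u \<in> U\<^sub>P) \<and>
    (\<forall>n\<in>N. m n n < \<nu>\<^sup>2 \<longrightarrow> m (\<theta> n) (\<theta> n) < \<rho>\<^sup>2 \<and> s *\<^sub>R p + n + \<theta> n \<in> M) \<and>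
    (\<forall>n\<in>N. m n n < \<nu>\<^sup>2 \<longrightarrow> (\<forall>r\<in>P. m p r = 0 \<and> m r r < \<rho>\<^sup>2 \<and> s *\<^sub>R p + n + r \<in> M \<longrightarrow> r = \<theta> n))"
proof -
  obtain e1 where e1: "0 < e1" "\<And>n. n \<in> N \<Longrightarrow> m n n < e1\<^sup>2 \<Longrightarrow> n \<in> U\<^sub>N"
    by (rule openin_ball[OF UN]) blast
  obtain e2 where e2: "0 < e2" "\<And>n. n \<in> P \<Longrightarrow> m n n < e2\<^sup>2 \<Longrightarrow> n \<in> U\<^sub>P"
    by (rule openin_ball[OF UP]) blast
  \<comment> \<open>With this choice \<open>U\<^sub>P\<close> contains all \<open>s p + r\<close> with \<open>m p r = 0\<close> and \<open>m r r < s\<^sup>2\<close>, as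
    \<open>s\<^sup>2 + s\<^sup>2 \<le> (2 s)\<^sup>2\<close>.\<close>
  define s where "s = min e1 e2 / 2"
  have s: "0 < s" "2 * s \<le> e1" "2 * s \<le> e2" using e1(1) e2(1) by (auto simp: s_def)
  have sN: "n \<in> U\<^sub>N" if "n \<in> N" "m n n < (2 * s)\<^sup>2" for n
  proof -
    have "(2 * s)\<^sup>2 \<le> e1\<^sup>2" using s by (intro power_mono) auto
    then show ?thesis using e1(2) that by simp
  qed
  have sP: "n \<in> U\<^sub>P" if "n \<in> P" "m n n < (2 * s)\<^sup>2" for n
  proof -
    have "(2 * s)\<^sup>2 \<le> e2\<^sup>2" using s by (intro power_mono) auto
    then show ?thesis using e2(2) that by simp
  qed
  let ?\<gamma> = "{t *\<^sub>R p |t. 0 < t} \<inter> (U\<^sub>N + U\<^sub>P)"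
  define R where "R = {r \<in> P. m p r = 0}"
  have tp: "t *\<^sub>R p \<in> ?\<gamma>" if "0 < t" "t < 2 * s" for t
  proof -
    have "t\<^sup>2 < (2 * s)\<^sup>2" using that by (intro power_strict_mono) auto
    then have "t *\<^sub>R p \<in> U\<^sub>P" using p by (intro sP subspace_scale[OF subspaces(2)]) (auto simp: m_scale)
    then show ?thesis using set_plus_intro[OF UN(2), of "t *\<^sub>R p" U\<^sub>P] that(1) by auto
  qed
  have s\<gamma>: "s *\<^sub>R p \<in> ?\<gamma>" using tp[of s] s(1) by simp
  obtain X where X: "open X" "?\<gamma> = M \<inter> P \<inter> X" using \<gamma> by (auto simp: openin_open)
  have R: "subspace R" "R \<subseteq> P" "p \<notin> R"
    unfolding R_def using p
    by (auto simp: subspace_def m_add_right m_scaleR_right m_0 subspace_0[OF subspaces(2)]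
        subspace_add[OF subspaces(2)] subspace_scale[OF subspaces(2)])
  have dec: "\<exists>a. x - a *\<^sub>R p \<in> R" if "x \<in> P" for x
  proof
    show "x - m p x *\<^sub>R p \<in> R"
      unfolding R_def using p that
      by (simp add: bounded_bilinear.diff_right[OF bilinear_m] m_scaleR_right
          subspace_diff[OF subspaces(2)] subspace_scale[OF subspaces(2)])
  qed
  have line: "t *\<^sub>R p \<in> M" if "\<bar>t - s\<bar> < s" for t
  proof -
    have "t *\<^sub>R p \<in> ?\<gamma>" using that by (intro tp) auto
    then show ?thesis unfolding X(2) by blast
  qed
  have sX: "s *\<^sub>R p \<in> X" using s\<gamma> unfolding X(2) by blast
  have "?\<gamma> \<subseteq> span {p}" by (auto simp: span_singleton)
  then have inter: "M \<inter> P \<inter> X \<subseteq> span {p}" unfolding X(2)[symmetric] .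
  let ?K = "N + span {p}"
  obtain W V0 \<Phi> where KR: "direct_sum ?K R" and W: "open W" "s *\<^sub>R p \<in> W" and V0: "open V0" "s *\<^sub>R p \<in> V0"
    and \<Phi>: "\<And>k. Ck_on k V0 \<Phi>" "\<Phi> (s *\<^sub>R p) = s *\<^sub>R p"
    and uniq: "\<And>x. x \<in> W \<Longrightarrow> x \<in> M \<Longrightarrow> comp_fst ?K R x \<in> V0 \<and> \<Phi> (comp_fst ?K R x) = x"
    and ex: "\<And>y. y \<in> V0 \<Longrightarrow> y \<in> ?K \<Longrightarrow> \<Phi> y \<in> M \<and> comp_fst ?K R (\<Phi> y) = y"
    using transverse_graph[OF direct_sum_axioms p(1) R(3,1,2) dec M bspec[OF trans s\<gamma>] s(1) line X(1) sX inter] by blast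
  interpret KR: direct_sum ?K R by fact
  define V where "V = (\<lambda>n. s *\<^sub>R p + n) -` V0"
  define \<theta> where "\<theta> n = \<Phi> (s *\<^sub>R p + n) - (s *\<^sub>R p + n)" for n
  have oV: "open V" unfolding V_def by (intro open_vimage V0 continuous_intros)
  have \<theta>C: "Ck_on k V \<theta>" for k
    unfolding \<theta>_def[abs_def]
    by (intro Ck_on_diff[OF oV] Ck_on_add[OF oV] Ck_on_const[OF oV] Ck_on_id[OF oV]
        Ck_on_compose[OF oV _ _ \<Phi>(1)]) (auto simp: V_def)
  have \<theta>0: "\<theta> 0 = 0" by (simp add: \<theta>_def \<Phi>)
  have V00: "0 \<in> V" using V0(2) by (simp add: V_def)
  have inK: "s *\<^sub>R p + n \<in> ?K" if "n \<in> N" for n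
    using set_plus_intro[OF that, of "s *\<^sub>R p" "span {p}"] by (auto simp: span_singleton add.commute)
  have \<theta>R: "\<theta> n \<in> R" and \<theta>M: "s *\<^sub>R p + n + \<theta> n \<in> M" if "n \<in> N" "n \<in> V" for n
  proof -
    have *: "\<Phi> (s *\<^sub>R p + n) \<in> M \<and> KR.fs (\<Phi> (s *\<^sub>R p + n)) = s *\<^sub>R p + n"
      using ex[OF _ inK[OF that(1)]] that(2) by (simp add: V_def)
    then show "s *\<^sub>R p + n + \<theta> n \<in> M" by (simp add: \<theta>_def)
    show "\<theta> n \<in> R" using KR.sn_in[of "\<Phi> (s *\<^sub>R p + n)"] * by (simp add: \<theta>_def comp_snd_def)
  qed
  have "open ((\<lambda>u. s *\<^sub>R p + u) -` W)" by (intro open_vimage W continuous_intros)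
  then obtain \<eta> where \<eta>: "0 < \<eta>" "\<And>u. m u u < \<eta>\<^sup>2 \<Longrightarrow> u \<in> (\<lambda>u. s *\<^sub>R p + u) -` W"
    by (rule small_ball) (use W(2) in auto)
  \<comment> \<open>For \<open>\<nu> \<le> \<rho>\<close> the sum of the balls of radius \<open>\<nu>\<close> and \<open>\<rho>\<close> lies in the ball of radius \<open>2 \<rho> \<le> \<eta>\<close>.\<close>
  define \<rho> where "\<rho> = min (\<eta> / 2) s"
  have \<rho>: "0 < \<rho>" "\<rho> \<le> s" "2 * \<rho> \<le> \<eta>" using \<eta>(1) s(1) by (auto simp: \<rho>_def)
  have "open (V \<inter> (\<lambda>n. m (\<theta> n) (\<theta> n)) -` {..<\<rho>\<^sup>2})"
    by (rule continuous_open_preimage[OF continuous_m[OF Ck_on_imp_continuous_on[OF \<theta>C]] oV]) simp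
  moreover have "0 \<in> V \<inter> (\<lambda>n. m (\<theta> n) (\<theta> n)) -` {..<\<rho>\<^sup>2}" using V00 \<rho>(1) by (simp add: \<theta>0 m_0)
  ultimately obtain \<nu>1 where \<nu>1: "0 < \<nu>1"
    "\<And>n. m n n < \<nu>1\<^sup>2 \<Longrightarrow> n \<in> V \<inter> (\<lambda>n. m (\<theta> n) (\<theta> n)) -` {..<\<rho>\<^sup>2}"
    by (rule small_ball) blast
  define \<nu> where "\<nu> = min \<nu>1 \<rho>"
  have \<nu>: "0 < \<nu>" "\<nu> \<le> \<rho>" "\<nu> \<le> \<nu>1" using \<nu>1(1) \<rho>(1) by (auto simp: \<nu>_def)
  have nu: "n \<in> V" "m (\<theta> n) (\<theta> n) < \<rho>\<^sup>2" if "m n n < \<nu>\<^sup>2" for n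
  proof -
    have "\<nu>\<^sup>2 \<le> \<nu>1\<^sup>2" using \<nu> by (intro power_mono) auto
    then have "m n n < \<nu>1\<^sup>2" using that by simp
    from \<nu>1(2)[OF this] show "n \<in> V" "m (\<theta> n) (\<theta> n) < \<rho>\<^sup>2" by auto
  qed
  show ?thesis
  proof (rule exI[of _ s], rule exI[of _ \<nu>], rule exI[of _ \<rho>], rule exI[of _ \<theta>], rule exI[of _ V],
      intro conjI ballI impI; (elim conjE)?)
    show "graph_germ N P B p s \<nu> \<theta> V"
    proof unfold_locales
      have "\<rho>\<^sup>2 \<le> s\<^sup>2" using \<rho> by (intro power_mono) auto
      then show "\<theta> n \<in> P \<and> m p (\<theta> n) = 0 \<and> m (\<theta> n) (\<theta> n) < s\<^sup>2" if "n \<in> N" "m n n < \<nu>\<^sup>2" for n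
        using \<theta>R[OF that(1) nu(1)[OF that(2)]] nu(2)[OF that(2)] by (auto simp: R_def)
      show "n \<in> V" if "n \<in> N" "m n n < \<nu>\<^sup>2" for n using nu(1)[OF that(2)] .
      show "\<nu> \<le> s" using \<nu> \<rho> by simp
    qed (use p \<nu> oV \<theta>C \<theta>0 in simp_all)
    show "m (\<theta> n) (\<theta> n) < \<rho>\<^sup>2" "s *\<^sub>R p + n + \<theta> n \<in> M" if "n \<in> N" "m n n < \<nu>\<^sup>2" for n
      using \<theta>M[OF that(1) nu(1)[OF that(2)]] nu(2)[OF that(2)] by blast+
    fix n r assume nr: "n \<in> N" "m n n < \<nu>\<^sup>2" "r \<in> P" "m p r = 0" "m r r < \<rho>\<^sup>2" "s *\<^sub>R p + n + r \<in> M"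
    have "\<nu>\<^sup>2 \<le> \<rho>\<^sup>2" using \<nu> by (intro power_mono) auto
    then have "m (n + r) (n + r) < 2 * \<rho>\<^sup>2" unfolding m_sum[OF nr(1,3)] using nr(2,5) by linarith
    also have "2 * \<rho>\<^sup>2 \<le> (2 * \<rho>)\<^sup>2" by (simp add: power_mult_distrib)
    also have "(2 * \<rho>)\<^sup>2 \<le> \<eta>\<^sup>2" using \<rho> by (intro power_mono) auto
    finally have "s *\<^sub>R p + (n + r) \<in> W" using \<eta>(2)[of "n + r"] by simp
    then have "s *\<^sub>R p + n + r \<in> W" by (simp add: add.assoc)
    from uniq[OF this nr(6)] have "\<Phi> (KR.fs (s *\<^sub>R p + n + r)) = s *\<^sub>R p + n + r" ..
    moreover have "KR.fs (s *\<^sub>R p + n + r) = s *\<^sub>R p + n"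
      using nr(3,4) by (intro KR.fs_add inK nr(1)) (simp add: R_def)
    ultimately show "r = \<theta> n" by (simp add: \<theta>_def)
  qed (use \<rho> sN sP in simp_all)
qed

section \<open>The theorem\<close>

theorem mainTheorem9:
  fixes A :: "('v::{t2_space, second_countable_topology}, 'e::euclidean_space) chart set"
    and f :: "'v \<Rightarrow> real" and c :: 'v
    and \<iota> :: "'e \<Rightarrow> ('v \<Rightarrow> real) \<Rightarrow> real"
    and N P U\<^sub>N U\<^sub>P U M R \<gamma> :: "'e set"
    and \<psi> :: "'e \<Rightarrow> 'v"
    and q \<mu> :: "'e \<Rightarrow> real"
    and p :: 'e
    and ball\<^sub>\<mu> N_ball R_ball :: "real \<Rightarrow> 'e set"
  defines "q \<equiv> \<lambda>v. hessian_form A f c (\<iota> v)"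
    and "U \<equiv> U\<^sub>N + U\<^sub>P"
    and "\<mu> \<equiv> mu_form q N P"
    and "R \<equiv> {r \<in> P. polar_form \<mu> p r = 0}"
    and "\<gamma> \<equiv> {t *\<^sub>R p |t. 0 < t} \<inter> U"
    and "ball\<^sub>\<mu> \<equiv> \<lambda>\<epsilon>. {u. \<mu> u < \<epsilon>\<^sup>2}"
    and "N_ball \<equiv> \<lambda>\<epsilon>. N \<inter> ball\<^sub>\<mu> \<epsilon>"
    and "R_ball \<equiv> \<lambda>\<epsilon>. R \<inter> ball\<^sub>\<mu> \<epsilon>"
  assumes manifold: "smooth_manifold A"
    and smooth_f: "smooth_fun_on A UNIV f"
    and tangent: "tangent_identification A c \<iota>"
    and critical: "critical_point A f c"
    and nondegenerate: "nondegenerate_on UNIV q"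
    and morse: "morse_parametrization A f c \<iota> N P U\<^sub>N U\<^sub>P \<psi>"
    and p: "p \<in> P" "\<mu> p = 1"
    and M: "M \<subseteq> U" "submanifold M" "flow_invariant N P U M"
    and open_\<gamma>: "openin (top_of_set (M \<inter> P)) \<gamma>"
    and transverse: "\<forall>x\<in>\<gamma>. transverse_at M P x"
  shows "\<exists>s \<nu> \<rho> \<theta>.
    0 < s \<and> 0 < \<nu> \<and> 0 < \<rho> \<and>
    s *\<^sub>R p \<in> \<gamma> \<and> N_ball \<nu> \<subseteq> U\<^sub>N \<and> (\<lambda>r. s *\<^sub>R p + r) ` R_ball \<rho> \<subseteq> U\<^sub>P \<and>
    smooth_on (N_ball \<nu>) \<theta> \<and> \<theta> ` N_ball \<nu> \<subseteq> R \<and> \<theta> 0 = 0 \<and>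
    (\<lambda>x. x - s *\<^sub>R p) ` M \<inter> (N_ball \<nu> + R_ball \<rho>) = {n + \<theta> n |n. n \<in> N_ball \<nu>} \<and>
    (\<exists>\<delta>>0. let I = {-\<delta><..<\<delta>}; D = N_ball \<delta> \<times> I; D\<^sub>0 = {0} \<times> I; chi = chi_map s p \<theta> in
      (\<forall>(n, \<tau>)\<in>D. (\<tau> / s) *\<^sub>R n \<in> N_ball \<nu>) \<and>
      embedding_on D chi \<and> embedding_on D\<^sub>0 chi \<and> chi ` D \<subseteq> U \<and>
      (\<forall>u\<in>chi ` D. Z_field N P u \<in> tangent_space (chi ` D) u) \<and>
      (\<forall>u\<in>chi ` D\<^sub>0. Z_field N P u \<in> tangent_space (chi ` D\<^sub>0) u) \<and>
      chi (0, 0) = 0 \<and>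
      chi ` ({0} \<times> {0<..<\<delta>}) = \<gamma> \<inter> ball\<^sub>\<mu> \<delta> \<and>
      chi ` (N_ball \<delta> \<times> {0<..<\<delta>}) \<subseteq> M \<and>
      chi ` {(n, \<tau>) \<in> N_ball \<delta> \<times> {0<..<\<delta>}. \<mu> n < \<tau>\<^sup>2} \<subseteq> M \<inter> {u. 0 < q u} \<and>
      {x. critical_point_on D (f \<circ> \<psi> \<circ> chi) x} = {(0, 0)} \<and>
      nondegenerate_on (N \<times> UNIV) (linear_hessian (f \<circ> \<psi> \<circ> chi) (0, 0)) \<and>
      coindex_on (N \<times> UNIV) (linear_hessian (f \<circ> \<psi> \<circ> chi) (0, 0)) = 1)"
proof -
  from morse[unfolded morse_parametrization_def Let_def, folded q_def U_def]
  have split: "morse_splitting q N P" and starN: "star_neighbourhood N U\<^sub>N" and starP: "star_neighbourhood P U\<^sub>P"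
    and diffeo: "diffeomorphism_into A U \<psi>" and \<psi>0: "\<psi> 0 = c" and f\<psi>: "\<forall>u\<in>U. f (\<psi> u) - f c = hessian_form A f c (\<iota> u)"
    by auto
  have UN: "openin (top_of_set N) U\<^sub>N" "0 \<in> U\<^sub>N" and UP: "openin (top_of_set P) U\<^sub>P" "0 \<in> U\<^sub>P"
    using starN starP by (auto simp: star_neighbourhood_def)
  have "0 \<in> U" using set_plus_intro[OF UN(2) UP(2)] by (simp add: U_def)
  have hess: "f (\<psi> u) - f c = hessian_form A f c (\<iota> u)" if "u \<in> U" for u
    using f\<psi> that by blast
  obtain B where B: "bounded_bilinear B" "\<And>u v. B u v = B v u" and hB: "\<And>v. hessian_form A f c (\<iota> v) = B v v"
    using morse_hessian_quadratic[OF manifold smooth_f tangent diffeo \<open>0 \<in> U\<close> \<psi>0 hess] by blast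
  have qB: "q = (\<lambda>v. B v v)" unfolding q_def by (rule ext) (rule hB)
  note sp = split[unfolded morse_splitting_def]
  interpret split_form N P B
  proof (intro split_form.intro split_form_axioms.intro direct_sum.intro)
    show "bounded_bilinear B" "B u v = B v u" for u v by (rule B)+
    show "B n u = 0" if "n \<in> N" "u \<in> P" for n u
    proof -
      have "polar_form q n u = 0" using sp that by blast
      then show ?thesis unfolding qB polar_form_bilinear[OF B] .
    qed
  qed (use sp in \<open>simp_all add: qB\<close>)
  have \<mu>: "\<mu> u = m u u" for u unfolding \<mu>_def qB by (rule mu_form_eq)
  have R: "R = {r \<in> P. m p r = 0}" unfolding R_def \<mu>_def qB polar_mu ..
  have Nb: "n \<in> N_ball \<epsilon> \<longleftrightarrow> n \<in> N \<and> m n n < \<epsilon>\<^sup>2" for n \<epsilon>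
    by (simp add: N_ball_def ball\<^sub>\<mu>_def \<mu>)
  have Rb: "r \<in> R_ball \<epsilon> \<longleftrightarrow> r \<in> P \<and> m p r = 0 \<and> m r r < \<epsilon>\<^sup>2" for r \<epsilon>
    by (auto simp: R_ball_def ball\<^sub>\<mu>_def \<mu> R)
  have pp: "m p p = 1" using p(2) by (simp add: \<mu>)
  obtain s \<nu> \<rho> \<theta> V where germ: "graph_germ N P B p s \<nu> \<theta> V" and \<rho>: "0 < \<rho>" "\<rho> \<le> s"
    and sN: "\<forall>n\<in>N. m n n < (2 * s)\<^sup>2 \<longrightarrow> n \<in> U\<^sub>N"
    and sP: "\<forall>u\<in>P. m u u < (2 * s)\<^sup>2 \<longrightarrow> u \<in> U\<^sub>P"
    and near: "\<forall>n\<in>N. m n n < \<nu>\<^sup>2 \<longrightarrow> m (\<theta> n) (\<theta> n) < \<rho>\<^sup>2 \<and> s *\<^sub>R p + n + \<theta> n \<in> M"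
    and uniq: "\<forall>n\<in>N. m n n < \<nu>\<^sup>2 \<longrightarrow>
      (\<forall>r\<in>P. m p r = 0 \<and> m r r < \<rho>\<^sup>2 \<and> s *\<^sub>R p + n + r \<in> M \<longrightarrow> r = \<theta> n)"
    using transverse_germ[OF p(1) pp UN UP M(2) open_\<gamma>[unfolded \<gamma>_def U_def]
        transverse[unfolded \<gamma>_def U_def]]
    by (elim exE conjE)
  interpret graph_germ N P B p s \<nu> \<theta> V by (rule germ)
  interpret invariant_germ N P B p s \<nu> \<theta> V U\<^sub>N U\<^sub>P M
    by unfold_locales (use sN sP M(1,3) near in \<open>auto simp: U_def\<close>)
  define chi where "chi = chi_map s p \<theta>"
  have D: "D = N_ball \<nu> \<times> {-\<nu><..<\<nu>}" by (auto simp: D_iff Nb)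
  have D0: "{0} \<times> {-\<nu><..<\<nu>} \<subseteq> D"
    using \<nu>(1) by (auto simp: D_iff m_0 subspace_0[OF subspaces(1)])
  have subP: "subspace P" and subN: "subspace N" using subspaces by auto
  have tpU: "t *\<^sub>R p \<in> U" if "0 \<le> t" "t < 2 * s" for t
  proof -
    have "t\<^sup>2 < (2 * s)\<^sup>2" using that by (intro power_strict_mono) auto
    then show ?thesis using in_U[of 0 "t *\<^sub>R p"] p(1) pp s_pos
      by (simp add: U_def m_scale m_0 subspace_0[OF subN] subspace_scale[OF subP])
  qed
  have c1: "s *\<^sub>R p \<in> \<gamma>" using tpU[of s] s_pos by (auto simp: \<gamma>_def)
  have c2: "N_ball \<nu> \<subseteq> U\<^sub>N" using sN N_bound by (auto simp: Nb)
  have c3: "(\<lambda>r. s *\<^sub>R p + r) ` R_ball \<rho> \<subseteq> U\<^sub>P"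
  proof clarify
    fix r assume "r \<in> R_ball \<rho>"
    then have r: "r \<in> P" "m p r = 0" "m r r < \<rho>\<^sup>2" by (simp_all add: Rb)
    have "m r p = 0" using r(2) m_sym by metis
    then have "m (s *\<^sub>R p + r) (s *\<^sub>R p + r) = s\<^sup>2 + m r r"
      using r pp by (simp add: m_add_left m_add_right m_scaleR_left m_scaleR_right power2_eq_square)
    moreover have "\<rho>\<^sup>2 \<le> s\<^sup>2" using \<rho> by (intro power_mono) auto
    ultimately have "m (s *\<^sub>R p + r) (s *\<^sub>R p + r) < (2 * s)\<^sup>2" using r(3) by (intro P_bound) linarith
    moreover have "s *\<^sub>R p + r \<in> P" using r(1) p(1) by (intro subspace_add[OF subP] subspace_scale[OF subP])
    ultimately show "s *\<^sub>R p + r \<in> U\<^sub>P" using sP by blast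
  qed
  have c4: "smooth_on (N_ball \<nu>) \<theta>"
  proof (rule smooth_on_subset)
    show "smooth_on V \<theta>" unfolding smooth_on_open_iff[OF V(1)] using V(2) by (rule allI)
    show "N_ball \<nu> \<subseteq> V" using V(3) by (auto simp: Nb)
  qed
  have c5: "\<theta> ` N_ball \<nu> \<subseteq> R" using \<theta> by (auto simp: Nb R)
  have c6: "(\<lambda>x. x - s *\<^sub>R p) ` M \<inter> (N_ball \<nu> + R_ball \<rho>) = {n + \<theta> n |n. n \<in> N_ball \<nu>}"
  proof (intro equalityI subsetI)
    fix y assume y: "y \<in> (\<lambda>x. x - s *\<^sub>R p) ` M \<inter> (N_ball \<nu> + R_ball \<rho>)"
    then obtain x where x: "x \<in> M" "y = x - s *\<^sub>R p" by blast
    obtain n r where nr: "n \<in> N_ball \<nu>" "r \<in> R_ball \<rho>" "y = n + r" using y by (blast elim: set_plus_elim)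
    have "x = s *\<^sub>R p + n + r" using x(2) nr(3) by (simp add: algebra_simps)
    then have "r = \<theta> n" using x(1) nr(1,2) uniq by (simp add: Nb Rb)
    then show "y \<in> {n + \<theta> n |n. n \<in> N_ball \<nu>}" using nr by blast
  next
    fix y assume "y \<in> {n + \<theta> n |n. n \<in> N_ball \<nu>}"
    then obtain n where n: "y = n + \<theta> n" "n \<in> N_ball \<nu>" by blast
    then have n': "n \<in> N" "m n n < \<nu>\<^sup>2" by (simp_all add: Nb)
    have "\<theta> n \<in> R_ball \<rho>" using near n' \<theta>[OF n'] by (simp add: Rb)
    then have "y \<in> N_ball \<nu> + R_ball \<rho>" unfolding n(1) by (rule set_plus_intro[OF n(2)])
    moreover have "y \<in> (\<lambda>x. x - s *\<^sub>R p) ` M"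
    proof (rule image_eqI)
      show "y = (s *\<^sub>R p + n + \<theta> n) - s *\<^sub>R p" by (simp add: n(1))
      show "s *\<^sub>R p + n + \<theta> n \<in> M" using near n' by blast
    qed
    ultimately show "y \<in> (\<lambda>x. x - s *\<^sub>R p) ` M \<inter> (N_ball \<nu> + R_ball \<rho>)" by blast
  qed
  have d1: "\<forall>(n, \<tau>)\<in>D. (\<tau> / s) *\<^sub>R n \<in> N_ball \<nu>"
    using scaled by (auto simp: Nb)
  have d2: "embedding_on D chi" "embedding_on ({0} \<times> {-\<nu><..<\<nu>}) chi"
    unfolding chi_def by (rule embedding_chi, simp) (rule embedding_chi[OF D0])
  have d3: "chi ` D \<subseteq> U" using chi_in_U by (auto simp: chi_def U_def)
  have d4: "\<forall>u\<in>chi ` D. Z_field N P u \<in> tangent_space (chi ` D) u"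
    unfolding chi_def by (intro ballI Z_tangent) auto
  have d5: "\<forall>u\<in>chi ` ({0} \<times> {-\<nu><..<\<nu>}). Z_field N P u \<in> tangent_space (chi ` ({0} \<times> {-\<nu><..<\<nu>})) u"
    unfolding chi_def by (intro ballI Z_tangent[OF D0]) (auto simp: D_iff)
  have chi0: "chi (0, \<tau>) = \<tau> *\<^sub>R p" for \<tau> by (simp add: chi_def chi_map_def \<theta>0)
  have d6: "chi ` ({0} \<times> {0<..<\<nu>}) = \<gamma> \<inter> ball\<^sub>\<mu> \<nu>"
  proof (intro equalityI subsetI)
    fix u assume "u \<in> chi ` ({0} \<times> {0<..<\<nu>})"
    then obtain \<tau> where \<tau>: "0 < \<tau>" "\<tau> < \<nu>" "u = \<tau> *\<^sub>R p" by (auto simp: chi0)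
    have "\<tau>\<^sup>2 < \<nu>\<^sup>2" using \<tau> by (intro power_strict_mono) auto
    moreover have "u \<in> U" unfolding \<tau>(3) using \<tau> \<nu> s_pos by (intro tpU) auto
    ultimately show "u \<in> \<gamma> \<inter> ball\<^sub>\<mu> \<nu>"
      using \<tau> pp by (auto simp: \<gamma>_def ball\<^sub>\<mu>_def \<mu> m_scale)
  next
    fix u assume u: "u \<in> \<gamma> \<inter> ball\<^sub>\<mu> \<nu>"
    then obtain t where t: "0 < t" "u = t *\<^sub>R p" by (auto simp: \<gamma>_def)
    have "t\<^sup>2 < \<nu>\<^sup>2" using u pp by (simp add: t(2) ball\<^sub>\<mu>_def \<mu> m_scale)
    then have "t < \<nu>" using \<nu>(1) by (simp add: power2_less_imp_less)
    then show "u \<in> chi ` ({0} \<times> {0<..<\<nu>})"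
      unfolding t(2) chi0[symmetric] using t(1) by (intro imageI) simp
  qed
  have inD: "(n, \<tau>) \<in> D" if "n \<in> N_ball \<nu>" "0 < \<tau>" "\<tau> < \<nu>" for n \<tau>
    using that by (simp add: D)
  have d7: "chi ` (N_ball \<nu> \<times> {0<..<\<nu>}) \<subseteq> M"
    using chi_in_M inD by (auto simp: chi_def)
  have d8: "chi ` {(n, \<tau>) \<in> N_ball \<nu> \<times> {0<..<\<nu>}. \<mu> n < \<tau>\<^sup>2} \<subseteq> M \<inter> {u. 0 < q u}"
  proof clarify
    fix n \<tau> assume n: "n \<in> N_ball \<nu>" "\<mu> n < \<tau>\<^sup>2" and "\<tau> \<in> {0<..<\<nu>}"
    then have \<tau>: "0 < \<tau>" "\<tau> < \<nu>" by auto
    note nD = inD[OF n(1) \<tau>]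
    have "0 < B (chi (n, \<tau>)) (chi (n, \<tau>))"
      unfolding chi_def B_chi[OF nD] using w_properties(3)[OF nD] n(2) by (simp add: \<mu>)
    then show "chi (n, \<tau>) \<in> M \<inter> {u. 0 < q u}"
      using chi_in_M[OF nD \<tau>(1)] by (simp add: qB chi_def)
  qed
  have g: "(f \<circ> \<psi> \<circ> chi) x = f c + B (chi_map s p \<theta> x) (chi_map s p \<theta> x)" if "x \<in> D" for x
  proof -
    have "chi x \<in> U" using d3 that by blast
    from hess[OF this] show ?thesis by (simp add: hB chi_def)
  qed
  have d9: "{x. critical_point_on D (f \<circ> \<psi> \<circ> chi) x} = {(0, 0)}"
    by (rule critical_points[OF g])
  have h: "linear_hessian (f \<circ> \<psi> \<circ> chi) (0, 0) (n, \<tau>) = \<tau>\<^sup>2 - m n n" if "n \<in> N" for n \<tau>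
    by (rule linear_hessian_chi[OF g that])
  have d10: "nondegenerate_on (N \<times> UNIV) (linear_hessian (f \<circ> \<psi> \<circ> chi) (0, 0))"
    by (rule nondegenerate_model[OF h])
  have d11: "coindex_on (N \<times> UNIV) (linear_hessian (f \<circ> \<psi> \<circ> chi) (0, 0)) = 1"
    by (rule coindex_model[OF h])
  have chi00: "chi (0, 0) = 0" by (simp add: chi0)
  \<comment> \<open>The last witness is \<open>\<delta> = \<nu>\<close>.\<close>
  show ?thesis
    unfolding Let_def
    by (rule exI[of _ s], rule exI[of _ \<nu>], rule exI[of _ \<rho>], rule exI[of _ \<theta>],
        intro conjI s_pos \<nu>(1) \<rho>(1) c1 c2 c3 c4 c5 c6 \<theta>0, rule exI[of _ \<nu>],
        unfold chi_def[symmetric] D[symmetric],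
        intro conjI \<nu>(1) d1 d2 d3 d4 d5 chi00 d6 d7 d8 d9 d10 d11)
qed

end
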